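(* Let $A,A^*$ be a Leonard pair in $\mathcal A$, let $\Phi=(A;\{E_i\}_{i=0}^d;A^*;\{E^*_i\}_{i=0}^d)$ be a Leonard system associated with $A,A^*$, and let $(\{\theta_i\}_{i=0}^d;\{\theta^*_i\}_{i=0}^d;\{\varphi_i\}_{i=1}^d;\{\phi_i\}_{i=1}^d)$ be the parameter array of $\Phi$. Assume $d\ge1$. Let $\xi,\zeta,\xi^*,\zeta^*\in\mathbb K$ with $\xi,\xi^*$ nonzero. Then the Leonard pair $A^*,A$ is isomorphic to the Leonard pair $\xi A+\zeta I,\ \xi^*A^*+\zeta^*I$ if and only if at least one of (i)--(iv) holds: (i) $\phi_1=\phi_d$, $\xi=(\theta^*_d-\theta^*_0)(\theta_d-\theta_0)^{-1}$, $\zeta=\theta^*_0-\xi\theta_0$, $\xi^*=\xi^{-1}$, $\zeta^*=\theta_0-\xi^*\theta^*_0$. (ii) $\varphi_1=\varphi_d=-\phi_1=-\phi_d$, $\xi=(\theta^*_0-\theta^*_d)(\theta_d-\theta_0)^{-1}$, $\zeta=\theta^*_d-\xi\theta_0$, $\xi^*=-\xi^{-1}$, $\zeta^*=\theta_0-\xi^*\theta^*_0$. (iii) $\varphi_1=\varphi_d=-\phi_1=-\phi_d$, $\xi=(\theta^*_d-\theta^*_0)(\theta_d-\theta_0)^{-1}$, $\zeta=\theta^*_0-\xi\theta_0$, $\xi^*=-\xi^{-1}$, $\zeta^*=\theta_0-\xi^*\theta^*_d$. (iv) $\varphi_1=\varphi_d$, $\xi=(\theta^*_0-\theta^*_d)(\theta_d-\theta_0)^{-1}$,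 $\zeta=\theta^*_d-\xi\theta_0$, $\xi^*=\xi^{-1}$, $\zeta^*=\theta_0-\xi^*\theta^*_d$. In this case precisely one of (i)--(iv) holds.
   Context: Let $\mathbb K$ be a field, $d\ge 0$ an integer, $\mathcal A$ a $\mathbb K$-algebra isomorphic to $\mathrm{Mat}_{d+1}(\mathbb K)$ with identity $I$, and $V$ an irreducible left $\mathcal A$-module (so $\dim V=d+1$). A square matrix is irreducible tridiagonal if its nonzero entries all lie on the diagonal, subdiagonal or superdiagonal, and every subdiagonal and superdiagonal entry is nonzero. Leonard pair: an ordered pair $A,A^*$ of elements of $\mathcal A$ is a Leonard pair in $\mathcal A$ if (i) there is a basis of $V$ with respect to which the matrix representing $A$ is irreducible tridiagonal and the matrix representing $A^*$ is diagonal, and (ii) there is a basis of $V$ with respect to which the matrix representing $A^*$ is irreducible tridiagonal and the matrix representing $A$ is diagonal. ($A^*$ is just a name; it does not denote the conjugate transpose.) If $A,A^*$ is a Leonard pair in $\mathcal A$, then so are $A^*,A$ and $\xi A+\zeta I,\ \xi^*A^*+\zeta^*I$ for all $\xi,\zeta,\xi^*,\zeta^*\in\mathbb K$ with $\xi,\xi^*$ nonzero. Leonard pairs $A,A^*$ in $\mathcal A$ and $B,B^*$ in $\mathcal A'$ are isomorphic if there is a $\mathbb K$-algebra isomorphism $\mathcal A\to\mathcal A'$ sending $A\mapsto B$ and $A^*\mapsto B^*$. Leonard system: an element $A\in\mathcal A$ is multiplicity-free if it has $d+1$ mutually distinct eigenvalues $\theta_0,\dots,\theta_d$ in $\mathbb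 K$; its primitive idempotent associated with $\theta_i$ is $E_i=\prod_{j\neq i}(A-\theta_jI)/(\theta_i-\theta_j)$. A Leonard system in $\mathcal A$ is a sequence $\Phi=(A;\{E_i\}_{i=0}^d;A^*;\{E^*_i\}_{i=0}^d)$ such that $A,A^*\in\mathcal A$ are multiplicity-free, $\{E_i\}_{i=0}^d$ (resp. $\{E_i^*\}_{i=0}^d$) is an ordering of the primitive idempotents of $A$ (resp. $A^*$), and for $0\le i,j\le d$ each of $E_iA^*E_j$ and $E^*_iAE^*_j$ is zero if $|i-j|>1$ and nonzero if $|i-j|=1$. If $\Phi$ is a Leonard system then $A,A^*$ is a Leonard pair, and $\Phi$ is said to be associated with $A,A^*$; every Leonard pair has an associated Leonard system. Parameter array: let $\theta_i$ (resp. $\theta_i^*$) be the eigenvalue of $A$ (resp. $A^*$) associated with $E_i$ (resp. $E^*_i$). For $1\le i\le d$ put $$\varphi_i=(\theta^*_0-\theta^*_i)\frac{\mathrm{tr}\bigl(E^*_0\prod_{h=0}^{i-1}(A-\theta_hI)\bigr)}{\mathrm{tr}\bigl(E^*_0\prod_{h=0}^{i-2}(A-\theta_hI)\bigr)},\qquad \phi_i=(\theta^*_0-\theta^*_i)\frac{\mathrm{tr}\bigl(E^*_0\prod_{h=0}^{i-1}(A-\theta_{d-h}I)\bigr)}{\mathrm{tr}\bigl(E^*_0\prod_{h=0}^{i-2}(A-\theta_{d-h}I)\bigr)},$$ where the empty product is $I$ and the denominators are known to be nonzero. The parameter array of $\Phi$ is $(\{\theta_i\}_{i=0}^d;\{\theta^*_i\}_{i=0}^d;\{\varphi_i\}_{i=1}^d;\{\phi_i\}_{i=1}^d)$.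 *)

theory Defs
  imports "Jordan_Normal_Form.Matrix"
begin

text \<open>
  Algebras and modules are whole types with an explicit scalar multiplication. The qualified
  names \<open>Modules.module.\<dots>\<close> are the linear-algebra notions of \<open>HOL.Modules\<close>
  (\<open>HOL-Algebra\<close> has another locale called \<open>module\<close>).
\<close>

locale k_algebra = vector_space sc
  for sc :: "'k::field \<Rightarrow> 'a::ring_1 \<Rightarrow> 'a" +
  assumes scale_mult_left: "sc c x * y = sc c (x * y)"
    and scale_mult_right: "x * sc c y = sc c (x * y)"

definition algebra_iso ::
  "('k::field \<Rightarrow> 'a::ring_1 \<Rightarrow> 'a) \<Rightarrow> ('k \<Rightarrow> 'b::ring_1 \<Rightarrow> 'b) \<Rightarrow> ('a \<Rightarrow> 'b) \<Rightarrow> bool" where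
  "algebra_iso sc sc' f \<longleftrightarrow>
     bij f \<and> f 1 = 1 \<and>
     (\<forall>x y. f (x + y) = f x + f y) \<and>
     (\<forall>x y. f (x * y) = f x * f y) \<and>
     (\<forall>c x. f (sc c x) = sc' c (f x))"

definition matrix_algebra_iso ::
  "nat \<Rightarrow> ('k::field \<Rightarrow> 'a::ring_1 \<Rightarrow> 'a) \<Rightarrow> ('a \<Rightarrow> 'k mat) \<Rightarrow> bool" where
  "matrix_algebra_iso n sc f \<longleftrightarrow>
     bij_betw f UNIV (carrier_mat n n) \<and> f 1 = 1\<^sub>m n \<and>
     (\<forall>x y. f (x + y) = f x + f y) \<and>
     (\<forall>x y. f (x * y) = f x * f y) \<and>
     (\<forall>c x. f (sc c x) = c \<cdot>\<^sub>m f x)"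

definition submodule_of :: "('a::ring_1 \<Rightarrow> 'v::ab_group_add \<Rightarrow> 'v) \<Rightarrow> 'v set \<Rightarrow> bool" where
  "submodule_of act W \<longleftrightarrow>
     0 \<in> W \<and> (\<forall>v\<in>W. \<forall>w\<in>W. v + w \<in> W) \<and> (\<forall>x. \<forall>v\<in>W. act x v \<in> W)"

locale leonard_setting =
  alg: k_algebra sc + vs: vector_space vsc
  for d :: nat
    and sc :: "'k::field \<Rightarrow> 'a::ring_1 \<Rightarrow> 'a"
    and vsc :: "'k \<Rightarrow> 'v::ab_group_add \<Rightarrow> 'v"
    and act :: "'a \<Rightarrow> 'v \<Rightarrow> 'v" +
  assumes matrix_algebra: "\<exists>f. matrix_algebra_iso (d + 1) sc f"
    and act_add_left: "act (x + y) v = act x v + act y v"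
    and act_add_right: "act x (v + w) = act x v + act x w"
    and act_mult: "act (x * y) v = act x (act y v)"
    and act_one: "act 1 v = v"
    and act_scale: "act (sc c x) v = vsc c (act x v)"
    and nontrivial: "\<exists>v::'v. v \<noteq> 0"
    and irreducible: "submodule_of act W \<Longrightarrow> W = {0} \<or> W = UNIV"

definition is_basis :: "nat \<Rightarrow> ('k::field \<Rightarrow> 'v::ab_group_add \<Rightarrow> 'v) \<Rightarrow> (nat \<Rightarrow> 'v) \<Rightarrow> bool" where
  "is_basis d vsc b \<longleftrightarrow>
     inj_on b {..d} \<and> \<not> Modules.module.dependent vsc (b ` {..d}) \<and>
     Modules.module.span vsc (b ` {..d}) = UNIV"

text \<open>The matrix \<open>M\<close> representing \<open>X\<close> satisfies \<open>X b\<^sub>j = (\<Sum>i\<le>d. M\<^sub>i\<^sub>j b\<^sub>i)\<close>.\<close>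

definition rep_mat ::
  "nat \<Rightarrow> ('k::field \<Rightarrow> 'v::ab_group_add \<Rightarrow> 'v) \<Rightarrow> ('a \<Rightarrow> 'v \<Rightarrow> 'v) \<Rightarrow> (nat \<Rightarrow> 'v) \<Rightarrow> 'a \<Rightarrow> 'k mat" where
  "rep_mat d vsc act b X =
     mat (d + 1) (d + 1)
       (\<lambda>(i, j). Modules.module.representation vsc (b ` {..d}) (act X (b j)) (b i))"

definition irreducible_tridiagonal :: "'k::zero mat \<Rightarrow> bool" where
  "irreducible_tridiagonal M \<longleftrightarrow>
     square_mat M \<and>
     (\<forall>i<dim_row M. \<forall>j<dim_row M.
        (\<bar>int i - int j\<bar> > 1 \<longrightarrow> M $$ (i, j) = 0) \<and>
        (\<bar>int i - int j\<bar> = 1 \<longrightarrow> M $$ (i, j) \<noteq> 0))"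

definition leonard_pair ::
  "nat \<Rightarrow> ('k::field \<Rightarrow> 'v::ab_group_add \<Rightarrow> 'v) \<Rightarrow> ('a \<Rightarrow> 'v \<Rightarrow> 'v) \<Rightarrow> 'a \<Rightarrow> 'a \<Rightarrow> bool" where
  "leonard_pair d vsc act A As \<longleftrightarrow>
     (\<exists>b. is_basis d vsc b \<and> irreducible_tridiagonal (rep_mat d vsc act b A) \<and>
          diagonal_mat (rep_mat d vsc act b As)) \<and>
     (\<exists>b. is_basis d vsc b \<and> irreducible_tridiagonal (rep_mat d vsc act b As) \<and>
          diagonal_mat (rep_mat d vsc act b A))"

definition leonard_pairs_isomorphic ::
  "('k::field \<Rightarrow> 'a::ring_1 \<Rightarrow> 'a) \<Rightarrow> ('k \<Rightarrow> 'b::ring_1 \<Rightarrow> 'b) \<Rightarrow> 'a \<times> 'a \<Rightarrow> 'b \<times> 'b \<Rightarrow> bool" where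
  "leonard_pairs_isomorphic sc sc' P Q \<longleftrightarrow>
     (\<exists>f. algebra_iso sc sc' f \<and> f (fst P) = fst Q \<and> f (snd P) = snd Q)"

definition eigenvalues_of ::
  "('k::field \<Rightarrow> 'v::ab_group_add \<Rightarrow> 'v) \<Rightarrow> ('a \<Rightarrow> 'v \<Rightarrow> 'v) \<Rightarrow> 'a \<Rightarrow> 'k set" where
  "eigenvalues_of vsc act X = {t. \<exists>v. v \<noteq> 0 \<and> act X v = vsc t v}"

definition multiplicity_free ::
  "nat \<Rightarrow> ('k::field \<Rightarrow> 'v::ab_group_add \<Rightarrow> 'v) \<Rightarrow> ('a \<Rightarrow> 'v \<Rightarrow> 'v) \<Rightarrow> 'a \<Rightarrow> bool" where
  "multiplicity_free d vsc act X \<longleftrightarrow> card (eigenvalues_of vsc act X) = d + 1"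

text \<open>The algebra is not commutative, so products are taken over lists; the factors of the
  products below commute with each other, so the order of the lists is irrelevant.\<close>

definition primitive_idempotent ::
  "nat \<Rightarrow> ('k::field \<Rightarrow> 'a::ring_1 \<Rightarrow> 'a) \<Rightarrow> 'a \<Rightarrow> (nat \<Rightarrow> 'k) \<Rightarrow> nat \<Rightarrow> 'a" where
  "primitive_idempotent d sc X \<theta> i =
     (\<Prod>j \<leftarrow> filter (\<lambda>j. j \<noteq> i) [0..<d + 1]. sc (1 / (\<theta> i - \<theta> j)) (X - sc (\<theta> j) 1))"

text \<open>\<open>E\<^sub>0, \<dots>, E\<^sub>d\<close> is an ordering of the primitive idempotents of \<open>X\<close>, and \<open>\<theta>\<^sub>i\<close> is the
  eigenvalue of \<open>X\<close> associated with \<open>E\<^sub>i\<close>. Values at indices above \<open>d\<close> play no role.\<close>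

definition idempotent_ordering ::
  "nat \<Rightarrow> ('k::field \<Rightarrow> 'a::ring_1 \<Rightarrow> 'a) \<Rightarrow> ('k \<Rightarrow> 'v::ab_group_add \<Rightarrow> 'v) \<Rightarrow> ('a \<Rightarrow> 'v \<Rightarrow> 'v) \<Rightarrow>
   'a \<Rightarrow> (nat \<Rightarrow> 'a) \<Rightarrow> (nat \<Rightarrow> 'k) \<Rightarrow> bool" where
  "idempotent_ordering d sc vsc act X E \<theta> \<longleftrightarrow>
     bij_betw \<theta> {..d} (eigenvalues_of vsc act X) \<and>
     (\<forall>i\<le>d. E i = primitive_idempotent d sc X \<theta> i)"

definition leonard_system ::
  "nat \<Rightarrow> ('k::field \<Rightarrow> 'a::ring_1 \<Rightarrow> 'a) \<Rightarrow> ('k \<Rightarrow> 'v::ab_group_add \<Rightarrow> 'v) \<Rightarrow> ('a \<Rightarrow> 'v \<Rightarrow> 'v) \<Rightarrow>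
   'a \<Rightarrow> (nat \<Rightarrow> 'a) \<Rightarrow> 'a \<Rightarrow> (nat \<Rightarrow> 'a) \<Rightarrow> bool" where
  "leonard_system d sc vsc act A E As Es \<longleftrightarrow>
     multiplicity_free d vsc act A \<and> multiplicity_free d vsc act As \<and>
     (\<exists>\<theta>. idempotent_ordering d sc vsc act A E \<theta>) \<and>
     (\<exists>\<theta>s. idempotent_ordering d sc vsc act As Es \<theta>s) \<and>
     (\<forall>i\<le>d. \<forall>j\<le>d.
        (\<bar>int i - int j\<bar> > 1 \<longrightarrow> E i * As * E j = 0 \<and> Es i * A * Es j = 0) \<and>
        (\<bar>int i - int j\<bar> = 1 \<longrightarrow> E i * As * E j \<noteq> 0 \<and> Es i * A * Es j \<noteq> 0))"

text \<open>The trace of the action on the module; it does not depend on the basis chosen.\<close>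

definition alg_trace ::
  "nat \<Rightarrow> ('k::field \<Rightarrow> 'v::ab_group_add \<Rightarrow> 'v) \<Rightarrow> ('a \<Rightarrow> 'v \<Rightarrow> 'v) \<Rightarrow> 'a \<Rightarrow> 'k" where
  "alg_trace d vsc act X =
     (\<Sum>i\<le>d. rep_mat d vsc act (SOME b. is_basis d vsc b) X $$ (i, i))"

definition shifted_prod ::
  "('k::field \<Rightarrow> 'a::ring_1 \<Rightarrow> 'a) \<Rightarrow> 'a \<Rightarrow> (nat \<Rightarrow> 'k) \<Rightarrow> nat \<Rightarrow> 'a" where
  "shifted_prod sc X \<theta> n = (\<Prod>h \<leftarrow> [0..<n]. X - sc (\<theta> h) 1)"

text \<open>\<open>vphi\<close> and \<open>phi\<close> stand for the sequences \<open>\<varphi>\<close> and \<open>\<phi>\<close>, indexed by \<open>1, \<dots>, d\<close>.\<close>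

definition parameter_array ::
  "nat \<Rightarrow> ('k::field \<Rightarrow> 'a::ring_1 \<Rightarrow> 'a) \<Rightarrow> ('k \<Rightarrow> 'v::ab_group_add \<Rightarrow> 'v) \<Rightarrow> ('a \<Rightarrow> 'v \<Rightarrow> 'v) \<Rightarrow>
   'a \<Rightarrow> (nat \<Rightarrow> 'a) \<Rightarrow> 'a \<Rightarrow> (nat \<Rightarrow> 'a) \<Rightarrow>
   (nat \<Rightarrow> 'k) \<Rightarrow> (nat \<Rightarrow> 'k) \<Rightarrow> (nat \<Rightarrow> 'k) \<Rightarrow> (nat \<Rightarrow> 'k) \<Rightarrow> bool" where
  "parameter_array d sc vsc act A E As Es \<theta> \<theta>s vphi phi \<longleftrightarrow>
     idempotent_ordering d sc vsc act A E \<theta> \<and>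
     idempotent_ordering d sc vsc act As Es \<theta>s \<and>
     (\<forall>i\<in>{1..d}.
        vphi i = (\<theta>s 0 - \<theta>s i) *
          (alg_trace d vsc act (Es 0 * shifted_prod sc A \<theta> i) /
           alg_trace d vsc act (Es 0 * shifted_prod sc A \<theta> (i - 1))) \<and>
        phi i = (\<theta>s 0 - \<theta>s i) *
          (alg_trace d vsc act (Es 0 * shifted_prod sc A (\<lambda>h. \<theta> (d - h)) i) /
           alg_trace d vsc act (Es 0 * shifted_prod sc A (\<lambda>h. \<theta> (d - h)) (i - 1))))"

end

theory Submission
  imports Defs
begin

text \<open>
  Write \<open>A*\<close> for the element \<open>As\<close>, \<open>v\<^sub>i\<close> for an eigenbasis of \<open>A*\<close> (eigenvalues \<open>\<theta>s i\<close>) in which \<open>A\<close> is irreducible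
  tridiagonal, \<open>w\<^sub>i\<close> for an eigenbasis of \<open>A\<close> (eigenvalues \<open>\<theta> i\<close>) in which \<open>A*\<close> is irreducible
  tridiagonal, and \<open>a i\<close>, \<open>as i\<close> for the diagonal entries of these two tridiagonal matrices. Almost
  everything happens on the module, in the coordinates of these two bases.

  \<^emph>\<open>The parameter array in terms of the diagonals.\<close> The vectors
  \<open>u\<^sub>i = (A - \<theta> (i - 1)) \<cdots> (A - \<theta> 0) v\<^sub>0\<close> form the split basis: \<open>A\<close> is lower bidiagonal and \<open>A*\<close>
  is upper bidiagonal in it. Comparing leading coefficients in the basis \<open>v\<close> gives the superdiagonal
  entry of \<open>A*\<close> as \<open>(\<theta>s (i - 1) - \<theta>s i) (\<Sum>h<i. a h - \<theta> h)\<close>, and this is the \<open>i\<close>-th first split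
  parameter; in the basis \<open>w\<close> the same entry is \<open>(\<theta> (i - 1) - \<theta> i) (\<Sum>h<i. as h - \<theta>s h)\<close>
  (\<open>split_coeff_quotient\<close>, \<open>split_coeff_dual\<close>). Reversing the order of \<open>w\<close> gives the second split
  parameters. In particular the four extreme parameters are expressed through \<open>a\<close> and \<open>as\<close> at the
  indices \<open>0\<close> and \<open>d\<close>.

  \<^emph>\<open>Necessity.\<close> An algebra isomorphism \<open>A* \<mapsto> \<xi> A + \<zeta>\<close>, \<open>A \<mapsto> \<xi>s A* + \<zeta>s\<close> permutes the primitive
  idempotents. Since it preserves the pattern of vanishing products, each of the two permutations is
  an automorphism of a path, so it is the identity or the reversal. The four combinations
  are the four cases; in each of them comparing eigenvalues and diagonal entries at the ends gives the
  stated conditions.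

  \<^emph>\<open>Sufficiency.\<close> Two Leonard pairs with equal eigenvalue sequences and equal split parameters are
  conjugate, because they have the same matrices in their split bases (\<open>intertwiner\<close>). Reversing
  \<open>w\<close> turns \<open>c4\<close> into \<open>c1\<close> and \<open>c3\<close> into \<open>c2\<close>. In case \<open>c1\<close>, equality of the second split parameters
  at both ends says that the points \<open>(\<theta> i, \<theta>s i)\<close> for \<open>i = 0, 1, d\<close> are collinear. Both sequences
  satisfy a three-term recurrence with the same \<open>\<beta>\<close> (\<open>eigenvalue_recurrence\<close>), and this forces all
  the points onto the line; the symmetry of the split parameters under \<open>A \<leftrightarrow> A*\<close> finishes
  the case. Case \<open>c2\<close> also needs that every \<open>a i\<close> is the midpoint of \<open>\<theta> 0\<close> and \<open>\<theta> d\<close>. This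
  holds at both ends by hypothesis; in between it holds because, by the Askey-Wilson relation,
  \<open>2 a i - (\<theta> 0 + \<theta> d)\<close> times a nonzero factor is an affine function of \<open>\<theta>s i\<close> that vanishes at
  \<open>\<theta>s 0\<close> and \<open>\<theta>s d\<close> (\<open>constant_diagonal\<close>).

  A conjugating linear bijection of the module induces an automorphism of the algebra because the
  algebra acts faithfully and by all linear maps (\<open>faithful\<close>, \<open>operator_represented\<close>).
\<close>

section \<open>Coordinates and tridiagonal operators\<close>

text \<open>
  A basis together with its dual basis. Using the coordinate functionals \<open>vc\<close> as data keeps
  reindexing and reversal of a basis free of any choice.
\<close>

locale coordinates = vector_space scale
  for scale :: "'k::field \<Rightarrow> 'v::ab_group_add \<Rightarrow> 'v" (infixr \<open>*s\<close> 75) +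
  fixes d :: nat and v :: "nat \<Rightarrow> 'v" and vc :: "nat \<Rightarrow> 'v \<Rightarrow> 'k"
  assumes vc_add: "i \<le> d \<Longrightarrow> vc i (x + y) = vc i x + vc i y"
    and vc_scale: "i \<le> d \<Longrightarrow> vc i (c *s x) = c * vc i x"
    and vc_v: "i \<le> d \<Longrightarrow> j \<le> d \<Longrightarrow> vc i (v j) = (if i = j then 1 else 0)"
    and expand: "x = (\<Sum>i\<le>d. vc i x *s v i)"
begin

lemma vc_zero: "i \<le> d \<Longrightarrow> vc i 0 = 0"
  using vc_scale[of i 0 0] by simp

lemma vc_minus: "i \<le> d \<Longrightarrow> vc i (- x) = - vc i x"
  using vc_scale[of i "-1" x] by simp

lemma vc_diff: "i \<le> d \<Longrightarrow> vc i (x - y) = vc i x - vc i y"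
  using vc_add[of i x "- y"] by (simp add: vc_minus)

lemma vc_sum: "i \<le> d \<Longrightarrow> vc i (sum f S) = (\<Sum>s\<in>S. vc i (f s))"
  by (induction S rule: infinite_finite_induct) (auto simp: vc_zero vc_add)

lemmas vc_linear = vc_add vc_scale vc_zero vc_minus vc_diff vc_sum

lemma vc_combination:
  assumes "i \<le> d" shows "vc i (\<Sum>j\<le>d. c j *s v j) = c i"
  using assms by (simp add: vc_sum vc_scale vc_v if_distrib[of "\<lambda>t. _ * t"] cong: if_cong)

lemma eq_iff_vc: "x = y \<longleftrightarrow> (\<forall>i\<le>d. vc i x = vc i y)"
  using expand[of x] expand[of y] by (metis (no_types, lifting) atMost_iff sum.cong)

lemma eqI_vc: "(\<And>i. i \<le> d \<Longrightarrow> vc i x = vc i y) \<Longrightarrow> x = y"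
  by (simp add: eq_iff_vc)

lemma v_nonzero: "i \<le> d \<Longrightarrow> v i \<noteq> 0"
  using vc_v[of i i] vc_zero[of i] by auto

end

lemma (in vector_space) linear_map_zero:
  fixes f :: "'b \<Rightarrow> 'b"
  assumes "\<And>c x. f (scale c x) = scale c (f x)" shows "f 0 = 0"
  using assms[of 0 0] by simp

lemma (in vector_space) linear_map_sum:
  fixes f :: "'b \<Rightarrow> 'b"
  assumes "\<And>x y. f (x + y) = f x + f y" "\<And>c x. f (scale c x) = scale c (f x)"
  shows "f (sum g S) = (\<Sum>s\<in>S. f (g s))"
  by (induction S rule: infinite_finite_induct) (auto simp: assms linear_map_zero)

lemma (in vector_space) linear_map_diff:
  fixes f :: "'b \<Rightarrow> 'b"
  assumes "\<And>x y. f (x + y) = f x + f y" "\<And>c x. f (scale c x) = scale c (f x)"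
  shows "f (x - y) = f x - f y"
  using assms(1)[of x "- y"] assms(2)[of "-1" y] by simp

text \<open>
  One half of a Leonard pair: \<open>As\<close> is diagonal with distinct eigenvalues and \<open>A\<close> is irreducible
  tridiagonal in the basis \<open>v\<close>. The basis is not normalised, so that the notion is stable under
  reversing the order of \<open>v\<close> and under affine changes of \<open>A\<close> and \<open>As\<close>.
\<close>

locale tridiagonal_action = coordinates scale d v vc
  for scale :: "'k::field \<Rightarrow> 'v::ab_group_add \<Rightarrow> 'v" (infixr \<open>*s\<close> 75)
    and d v vc +
  fixes A As :: "'v \<Rightarrow> 'v" and \<theta>s :: "nat \<Rightarrow> 'k"
  assumes A_add: "A (x + y) = A x + A y"
    and A_scale: "A (c *s x) = c *s A x"
    and As_add: "As (x + y) = As x + As y"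
    and As_scale: "As (c *s x) = c *s As x"
    and As_v: "i \<le> d \<Longrightarrow> As (v i) = \<theta>s i *s v i"
    and inj_\<theta>s: "inj_on \<theta>s {..d}"
    and A_far: "i \<le> d \<Longrightarrow> j \<le> d \<Longrightarrow> \<bar>int i - int j\<bar> > 1 \<Longrightarrow> vc i (A (v j)) = 0"
    and A_near: "i \<le> d \<Longrightarrow> j \<le> d \<Longrightarrow> \<bar>int i - int j\<bar> = 1 \<Longrightarrow> vc i (A (v j)) \<noteq> 0"
begin

lemmas A_sum = linear_map_sum[of A, OF A_add A_scale]
lemmas As_sum = linear_map_sum[of As, OF As_add As_scale]
lemmas A_diff = linear_map_diff[of A, OF A_add A_scale]
lemmas As_diff = linear_map_diff[of As, OF As_add As_scale]
lemmas A_zero = linear_map_zero[of A, OF A_scale]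
lemmas As_zero = linear_map_zero[of As, OF As_scale]

lemmas operators_linear = A_add A_scale A_diff A_sum A_zero As_add As_scale As_diff As_sum As_zero

definition a :: "nat \<Rightarrow> 'k" where "a i = vc i (A (v i))"
definition subdiag :: "nat \<Rightarrow> 'k" where "subdiag i = vc (Suc i) (A (v i))"
definition superdiag :: "nat \<Rightarrow> 'k" where "superdiag i = vc i (A (v (Suc i)))"

lemma subdiag_nonzero: "i < d \<Longrightarrow> subdiag i \<noteq> 0"
  unfolding subdiag_def by (rule A_near) auto

lemma superdiag_nonzero: "i < d \<Longrightarrow> superdiag i \<noteq> 0"
  unfolding superdiag_def by (rule A_near) auto

lemma \<theta>s_distinct: "i \<le> d \<Longrightarrow> j \<le> d \<Longrightarrow> i \<noteq> j \<Longrightarrow> \<theta>s i \<noteq> \<theta>s j"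
  using inj_\<theta>s by (auto simp: inj_on_def)

lemma vc_A_matrix:
  assumes "i \<le> d" shows "vc i (A x) = (\<Sum>j\<le>d. vc i (A (v j)) * vc j x)"
proof -
  have "vc i (A x) = vc i (A (\<Sum>j\<le>d. vc j x *s v j))"
    using expand[of x] by simp
  then show ?thesis
    using assms by (simp add: A_sum A_scale vc_sum vc_scale mult.commute)
qed

lemma vc_As: 
  assumes "i \<le> d" shows "vc i (As x) = \<theta>s i * vc i x"
proof -
  have "vc i (As x) = vc i (As (\<Sum>j\<le>d. vc j x *s v j))"
    using expand[of x] by simp
  also have "\<dots> = vc i (\<Sum>j\<le>d. (\<theta>s j * vc j x) *s v j)"
    by (simp add: As_sum As_scale As_v mult.commute)
  also have "\<dots> = \<theta>s i * vc i x"
    using assms by (rule vc_combination)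
  finally show ?thesis .
qed

lemma vc_A:
  assumes "i \<le> d"
  shows "vc i (A x) = (if i = 0 then 0 else subdiag (i - 1) * vc (i - 1) x) + a i * vc i x
    + (if i = d then 0 else superdiag i * vc (Suc i) x)"
proof -
  let ?f = "\<lambda>j. vc i (A (v j)) * vc j x"
  let ?lo = "if i = 0 then {} else {i - 1}" and ?hi = "if i = d then {} else {Suc i}"
  have "vc i (A x) = (\<Sum>j\<le>d. ?f j)"
    using assms by (rule vc_A_matrix)
  also have "\<dots> = (\<Sum>j \<in> ?lo \<union> ({i} \<union> ?hi). ?f j)"
    by (rule sum.mono_neutral_right) (use assms A_far[of i] in \<open>auto split: if_splits\<close>)
  also have "\<dots> = (\<Sum>j\<in>?lo. ?f j) + (?f i + (\<Sum>j\<in>?hi. ?f j))"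
    by (subst sum.union_disjoint; (subst sum.union_disjoint)?) auto
  finally show ?thesis
    by (simp add: a_def subdiag_def superdiag_def)
qed

definition vanishes_above :: "nat \<Rightarrow> 'v \<Rightarrow> bool" where
  "vanishes_above n x \<longleftrightarrow> (\<forall>j\<le>d. n < j \<longrightarrow> vc j x = 0)"

lemma vanishes_above_mono: "vanishes_above n x \<Longrightarrow> n \<le> m \<Longrightarrow> vanishes_above m x"
  by (auto simp: vanishes_above_def)

lemma vanishes_above_v: "n \<le> d \<Longrightarrow> vanishes_above n (v n)"
  by (auto simp: vanishes_above_def vc_v)

lemma vanishes_above_diff:
  "vanishes_above n x \<Longrightarrow> vanishes_above n y \<Longrightarrow> vanishes_above n (x - y)"
  by (auto simp: vanishes_above_def vc_diff)

lemma vanishes_above_scale: "vanishes_above n x \<Longrightarrow> vanishes_above n (c *s x)"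
  by (auto simp: vanishes_above_def vc_scale)

lemma vanishes_above_As: "vanishes_above n x \<Longrightarrow> vanishes_above n (As x)"
  by (auto simp: vanishes_above_def vc_As)

lemma vanishes_above_A: "vanishes_above n x \<Longrightarrow> vanishes_above (Suc n) (A x)"
  by (auto simp: vanishes_above_def vc_A)

lemma vc_Suc_A:
  "vanishes_above n x \<Longrightarrow> n < d \<Longrightarrow> vc (Suc n) (A x) = subdiag n * vc n x"
  by (auto simp: vanishes_above_def vc_A)

text \<open>
  Read from the top, the rows of \<open>A x = t x\<close> determine every coordinate of \<open>x\<close> from the first one,
  because the superdiagonal entries are invertible.
\<close>

lemma eigenvector_first_coordinate:
  assumes "A x = t *s x" "x \<noteq> 0"
  shows "vc 0 x \<noteq> 0"
proof
  assume zero: "vc 0 x = 0"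
  have "vc i x = 0" if "i \<le> d" for i
    using that
  proof (induction i rule: less_induct)
    case (less i)
    show ?case
    proof (cases i)
      case (Suc j)
      have "vc j (A x) = t * vc j x"
        using less.prems Suc by (simp add: assms vc_scale)
      then have "superdiag j * vc i x = 0"
        using less.IH[of j] less.IH[of "j - 1"] less.prems Suc by (auto simp: vc_A split: if_splits)
      then show ?thesis
        using superdiag_nonzero[of j] less.prems Suc by auto
    qed (use zero in simp)
  qed
  then have "x = 0"
    by (intro eqI_vc) (auto simp: vc_zero)
  then show False
    using assms by simp
qed

text \<open>
  The factors of the product \<open>(A - \<rho> (m - 1)) \<cdots> (A - \<rho> 0)\<close> commute; peeling off the last one on the
  left makes the growth of the support by one index per factor visible.
\<close>

primrec chain :: "(nat \<Rightarrow> 'k) \<Rightarrow> nat \<Rightarrow> 'v \<Rightarrow> 'v" where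
  "chain \<rho> 0 y = y"
| "chain \<rho> (Suc m) y = A (chain \<rho> m y) - \<rho> m *s chain \<rho> m y"

lemma vanishes_above_chain: "vanishes_above n y \<Longrightarrow> vanishes_above (n + m) (chain \<rho> m y)"
proof (induction m)
  case (Suc m)
  then have "vanishes_above (n + m) (chain \<rho> m y)" by blast
  then show ?case
    by (auto intro!: vanishes_above_diff vanishes_above_scale dest: vanishes_above_A
        elim: vanishes_above_mono)
qed simp

lemma vc_top_chain:
  assumes "vanishes_above n y" "n + m \<le> d"
  shows "vc (n + m) (chain \<rho> m y) = (\<Prod>h<m. subdiag (n + h)) * vc n y"
  using assms
proof (induction m)
  case (Suc m)
  have below: "vanishes_above (n + m) (chain \<rho> m y)"
    using Suc.prems by (intro vanishes_above_chain)
  then have "vc (n + Suc m) (chain \<rho> m y) = 0"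
    using Suc.prems by (auto simp: vanishes_above_def)
  then show ?case
    using Suc below vc_Suc_A[OF below] by (simp add: vc_linear)
qed simp

definition lead :: "nat \<Rightarrow> 'k" where "lead n = (\<Prod>h<n. subdiag h)"

lemma lead_nonzero: "n \<le> d \<Longrightarrow> lead n \<noteq> 0"
  by (auto simp: lead_def subdiag_nonzero)

lemma lead_Suc: "lead (Suc n) = subdiag n * lead n"
  by (simp add: lead_def)

lemma vc_top_chain_v0: "n \<le> d \<Longrightarrow> vc n (chain \<rho> n (v 0)) = lead n"
  using vc_top_chain[of 0 "v 0" n \<rho>] vanishes_above_v[of 0] by (simp add: lead_def vc_v)

lemma vanishes_above_chain_v0: "vanishes_above n (chain \<rho> n (v 0))"
  using vanishes_above_chain[of 0 "v 0" n \<rho>] vanishes_above_v[of 0] by simp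

text \<open>
  The second highest coefficient of a monic polynomial in a tridiagonal matrix, applied to the first
  basis vector, sees only the diagonal. For \<open>n = d\<close> this still makes sense: the would-be leading
  vector \<open>v\<^sub>d\<^sub>+\<^sub>1\<close> is zero, and the lemma becomes the trace formula used in \<open>sum_a\<close>.
\<close>

lemma vc_below_top_chain_v0:
  "n \<le> d \<Longrightarrow> vc n (chain \<rho> (Suc n) (v 0)) = lead n * (\<Sum>h\<le>n. a h - \<rho> h)"
proof (induction n)
  case 0
  have "vc (Suc 0) (v 0) = 0" if "0 < d"
    using that by (simp add: vc_v)
  then show ?case
    by (auto simp: vc_linear vc_A vc_v lead_def)
next
  case (Suc n)
  have above: "vc (Suc (Suc n)) (chain \<rho> (Suc n) (v 0)) = 0" if "Suc n \<noteq> d"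
    using vanishes_above_chain_v0[of "Suc n" \<rho>] Suc.prems that
    by (auto simp: vanishes_above_def)
  have "vc (Suc n) (chain \<rho> (Suc (Suc n)) (v 0)) =
      subdiag n * vc n (chain \<rho> (Suc n) (v 0)) + (a (Suc n) - \<rho> (Suc n)) * vc (Suc n) (chain \<rho> (Suc n) (v 0))"
    using Suc.prems above
    by (simp add: vc_linear vc_A[of "Suc n" "chain \<rho> (Suc n) (v 0)"] algebra_simps del: chain.simps(2) 
        add: chain.simps(2)[of \<rho> "Suc n"])
  also have "\<dots> = lead (Suc n) * (\<Sum>h\<le>Suc n. a h - \<rho> h)"
    using Suc by (simp add: vc_top_chain_v0 lead_Suc algebra_simps del: chain.simps)
  finally show ?case .
qed

end

section \<open>The split basis\<close>

text \<open>
  A Leonard pair with a chosen ordering of both eigenbases, that is, a Leonard system acting on its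
  module. The axioms are symmetric under the exchange of the two halves (\<open>dual\<close>).
\<close>

locale leonard_bases =
  vside: tridiagonal_action scale d v vc A As \<theta>s +
  wside: tridiagonal_action scale d w wc As A \<theta>
  for scale :: "'k::field \<Rightarrow> 'v::ab_group_add \<Rightarrow> 'v" (infixr \<open>*s\<close> 75)
    and d v vc A As \<theta>s w wc \<theta>
begin

lemma dual: "leonard_bases scale d w wc As A \<theta> v vc \<theta>s"
  by unfold_locales

abbreviation "a \<equiv> vside.a"
abbreviation "as \<equiv> wside.a"

definition split :: "nat \<Rightarrow> 'v" where "split n = vside.chain \<theta> n (v 0)"

text \<open>
  Will be identified with the first split sequence of the parameter array in
  \<open>split_coeff_quotient\<close>.
\<close>

definition split_coeff :: "nat \<Rightarrow> 'k" where
  "split_coeff i = (\<theta>s (i - 1) - \<theta>s i) * (\<Sum>h<i. a h - \<theta> h)"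

lemma wc_chain:
  assumes "j \<le> d"
  shows "wc j (vside.chain \<rho> m y) = (\<Prod>h<m. \<theta> j - \<rho> h) * wc j y"
  using assms by (induction m) (auto simp: wside.vc_linear wside.vc_As algebra_simps)

lemma wc_expand:
  assumes "j \<le> d" shows "wc j x = (\<Sum>l\<le>d. vc l x * wc j (v l))"
proof -
  have "wc j x = wc j (\<Sum>l\<le>d. vc l x *s v l)"
    using vside.expand[of x] by simp
  then show ?thesis
    using assms by (simp add: wside.vc_sum wside.vc_scale)
qed

text \<open>
  The vector \<open>v 0\<close> is cyclic for \<open>A\<close>, so its component along an eigenvector of \<open>A\<close> cannot
  vanish: otherwise that coordinate would vanish on the whole space.
\<close>

lemma wc_v0_nonzero:
  assumes "j \<le> d" shows "wc j (v 0) \<noteq> 0"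
proof
  assume zero: "wc j (v 0) = 0"
  have v_zero: "wc j (v i) = 0" if "i \<le> d" for i
    using that
  proof (induction i rule: less_induct)
    case (less i)
    show ?case
    proof (cases i)
      case (Suc n)
      have "wc j (A (v n)) = (\<Sum>l\<le>d. vc l (A (v n)) * wc j (v l))"
        using assms by (rule wc_expand)
      also have "\<dots> = (\<Sum>l\<in>{i}. vc l (A (v n)) * wc j (v l))"
      proof (rule sum.mono_neutral_right)
        show "\<forall>l\<in>{..d} - {i}. vc l (A (v n)) * wc j (v l) = 0"
        proof
          fix l assume l: "l \<in> {..d} - {i}"
          show "vc l (A (v n)) * wc j (v l) = 0"
          proof (cases "l < i")
            case False
            then have "vc l (A (v n)) = 0"
              using l Suc less.prems by (intro vside.A_far) auto
            then show ?thesis by simp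
          qed (use less.IH l in auto)
        qed
      qed (use less.prems in auto)
      finally have "vside.subdiag n * wc j (v i) = wc j (A (v n))"
        by (simp add: Suc vside.subdiag_def)
      also have "\<dots> = 0"
        using assms less Suc by (simp add: wside.vc_As)
      finally show ?thesis
        using vside.subdiag_nonzero[of n] less.prems Suc by simp
    qed (use zero in simp)
  qed
  have "wc j (w j) = (\<Sum>l\<le>d. vc l (w j) * wc j (v l))"
    using assms by (rule wc_expand)
  then show False
    using assms v_zero by (simp add: wside.vc_v)
qed

lemma vc0_w_nonzero: "j \<le> d \<Longrightarrow> vc 0 (w j) \<noteq> 0"
  using vside.eigenvector_first_coordinate[OF wside.As_v] wside.v_nonzero by blast

text \<open>
  The flag spanned by \<open>v 0, \<dots>, v (k - 1)\<close> meets the flag spanned by \<open>w k, \<dots>, w d\<close> trivially.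
  The polynomial in \<open>A\<close> with roots \<open>\<theta> k, \<dots>, \<theta> d\<close> annihilates the second one, but its degree
  \<open>d + 1 - k\<close> is so small that it only shifts the leading term of a nonzero vector of the first one
  to a higher basis vector.
\<close>

lemma flags_transversal:
  assumes "k \<le> Suc d"
    and high: "\<And>j. j \<le> d \<Longrightarrow> k \<le> j \<Longrightarrow> vc j y = 0"
    and low: "\<And>j. j < k \<Longrightarrow> wc j y = 0"
  shows "y = 0"
proof (rule ccontr)
  assume "y \<noteq> 0"
  then have ne: "{j. j \<le> d \<and> vc j y \<noteq> 0} \<noteq> {}"
    using vside.eqI_vc[of y 0] by (auto simp: vside.vc_zero)
  define n where "n = Max {j. j \<le> d \<and> vc j y \<noteq> 0}"
  have "n \<in> {j. j \<le> d \<and> vc j y \<noteq> 0}"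
    unfolding n_def by (rule Max_in[OF _ ne]) simp
  then have n: "n \<le> d" "vc n y \<noteq> 0" by auto
  have "vside.vanishes_above n y"
    unfolding vside.vanishes_above_def
    using Max_ge[of "{j. j \<le> d \<and> vc j y \<noteq> 0}"] by (fastforce simp: n_def)
  have "n < k"
    using n high[of n] by (meson not_le_imp_less)
  \<comment> \<open>The polynomial has one root for each of the indices \<open>k, \<dots>, d\<close>.\<close>
  define m where "m = Suc d - k"
  have m: "n + m \<le> d"
    using \<open>n < k\<close> assms(1) by (simp add: m_def)
  let ?z = "vside.chain (\<lambda>h. \<theta> (k + h)) m y"
  have "?z = 0"
  proof (rule wside.eqI_vc)
    fix i assume i: "i \<le> d"
    show "wc i ?z = wc i 0"
    proof (cases "i < k")
      case False
      then have "(\<Prod>h<m. \<theta> i - \<theta> (k + h)) = 0"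
        using i by (intro prod_zero) (auto intro!: bexI[of _ "i - k"] simp: m_def)
      then show ?thesis
        using i by (simp add: wc_chain wside.vc_zero)
    qed (use i low in \<open>simp add: wc_chain wside.vc_zero\<close>)
  qed
  moreover have "vc (n + m) ?z \<noteq> 0"
    using vside.vc_top_chain[OF \<open>vside.vanishes_above n y\<close> m] n m vside.subdiag_nonzero by auto
  ultimately show False
    using m by (simp add: vside.vc_zero)
qed

lemma wc_split: "j \<le> d \<Longrightarrow> wc j (split n) = (\<Prod>h<n. \<theta> j - \<theta> h) * wc j (v 0)"
  by (simp add: split_def wc_chain)

lemma wc_split_below: "j \<le> d \<Longrightarrow> j < n \<Longrightarrow> wc j (split n) = 0"
  by (auto simp: wc_split)

lemma wc_split_diag_nonzero: "n \<le> d \<Longrightarrow> wc n (split n) \<noteq> 0"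
  using wside.\<theta>s_distinct wc_v0_nonzero by (simp add: wc_split)

lemma split_Suc: "split (Suc n) = A (split n) - \<theta> n *s split n"
  by (simp add: split_def)

lemma split_end: "split (Suc d) = 0"
  by (rule wside.eqI_vc) (auto simp: wc_split_below wside.vc_zero)

text \<open>
  Both sides are the trace of \<open>A\<close>; here it comes out of the vanishing of the characteristic
  polynomial of \<open>A\<close> on \<open>v 0\<close>.
\<close>

lemma sum_a: "(\<Sum>h\<le>d. a h) = (\<Sum>h\<le>d. \<theta> h)"
proof -
  have "vside.lead d * (\<Sum>h\<le>d. a h - \<theta> h) = 0"
    using vside.vc_below_top_chain_v0[of d \<theta>] split_end by (simp add: split_def vside.vc_zero)
  then show ?thesis
    using vside.lead_nonzero[of d] by (simp add: sum_subtractf)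
qed

text \<open>
  The difference of the two sides lies in both flags of \<open>flags_transversal\<close>: by construction of the
  split vectors it has no components along \<open>w j\<close> for \<open>j < n\<close>, and none along \<open>v j\<close> for \<open>j > n\<close>. The
  coefficient \<open>split_coeff (Suc n)\<close> is the one that also removes the component along \<open>v n\<close>.
\<close>

lemma As_split:
  assumes "Suc n \<le> d"
  shows "As (split (Suc n)) = \<theta>s (Suc n) *s split (Suc n) + split_coeff (Suc n) *s split n"
proof -
  let ?y = "As (split (Suc n)) - \<theta>s (Suc n) *s split (Suc n) - split_coeff (Suc n) *s split n"
  have above: "vside.vanishes_above m (split m)" for m
    unfolding split_def by (rule vside.vanishes_above_chain_v0)
  have "?y = 0"
  proof (rule flags_transversal[of n])
    fix j assume j: "j \<le> d" "n \<le> j"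
    consider "j = n" | "j = Suc n" | "Suc n < j" using j by linarith
    then show "vc j ?y = 0"
    proof cases
      case 1
      then show ?thesis
        using j vside.vc_below_top_chain_v0[of n \<theta>] vside.vc_top_chain_v0[of n \<theta>]
        by (simp add: vside.vc_linear vside.vc_As split_def split_coeff_def lessThan_Suc_atMost
            algebra_simps del: vside.chain.simps)
    next
      case 2
      then show ?thesis
        using j above[of n] by (simp add: vside.vc_linear vside.vc_As vside.vanishes_above_def)
    next
      case 3
      then show ?thesis
        using j above[of n] above[of "Suc n"]
        by (simp add: vside.vc_linear vside.vc_As vside.vanishes_above_def)
    qed
  next
    fix j assume "j < n"
    then show "wc j ?y = 0"
      using assms wc_split_below[of j n] wc_split_below[of j "Suc n"]
        wc_split_below[of "j - 1" "Suc n"] wc_split_below[of "Suc j" "Suc n"]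
      by (simp add: wside.vc_linear wside.vc_A)
  qed (use assms in simp)
  then show ?thesis
    by (simp add: algebra_simps)
qed

lemma As_split_0: "As (split 0) = \<theta>s 0 *s split 0"
  by (simp add: split_def vside.As_v)

lemma vc0_split_Suc:
  assumes "Suc n \<le> d"
  shows "(\<theta>s 0 - \<theta>s (Suc n)) * vc 0 (split (Suc n)) = split_coeff (Suc n) * vc 0 (split n)"
proof -
  have "\<theta>s 0 * vc 0 (split (Suc n)) =
      \<theta>s (Suc n) * vc 0 (split (Suc n)) + split_coeff (Suc n) * vc 0 (split n)"
    using vside.vc_As[of 0 "split (Suc n)"] As_split[OF assms] by (simp add: vside.vc_linear)
  then show ?thesis
    by (simp add: algebra_simps)
qed

text \<open>
  The last split vector is a nonzero multiple of the eigenvector \<open>w d\<close>, and the recursion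
  \<open>vc0_split_Suc\<close> carries nonvanishing down from \<open>d\<close>.
\<close>

lemma vc0_split_nonzero:
  assumes "n \<le> d" shows "vc 0 (split n) \<noteq> 0"
proof -
  have last: "vc 0 (split d) \<noteq> 0"
  proof -
    have "split d = wc d (split d) *s w d"
      by (rule wside.eqI_vc) (auto simp: wside.vc_scale wside.vc_v wc_split_below)
    then have "vc 0 (split d) = wc d (split d) * vc 0 (w d)"
      by (metis vside.vc_scale zero_le)
    then show ?thesis
      using wc_split_diag_nonzero vc0_w_nonzero by simp
  qed
  show ?thesis
    using assms
  proof (induction n rule: inc_induct)
    case (step n)
    then show ?case
      using vc0_split_Suc[of n] vside.\<theta>s_distinct[of 0 "Suc n"] by auto
  qed (rule last)
qed

text \<open>
  The left-hand side is the definition of the first split parameter: the trace of \<open>E*\<^sub>0 p(A)\<close> is the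
  first coordinate of \<open>p(A) (v 0)\<close>.
\<close>

lemma split_coeff_quotient:
  assumes "i \<in> {1..d}"
  shows "(\<theta>s 0 - \<theta>s i) * (vc 0 (split i) / vc 0 (split (i - 1))) = split_coeff i"
proof -
  obtain n where "i = Suc n" "Suc n \<le> d"
    using assms by (cases i) auto
  then show ?thesis
    using vc0_split_Suc[of n] vc0_split_nonzero[of n] by simp
qed

text \<open>
  Compare the coordinates of \<open>As u\<^sub>n\<close> and \<open>As u\<^sub>n\<^sub>+\<^sub>1\<close> along \<open>w n\<close>, computed once from the
  tridiagonal form of \<open>As\<close> in the basis \<open>w\<close> and once from its bidiagonal form in the split basis.
\<close>

lemma as_eq:
  assumes "n \<le> d"
  shows "as n - \<theta>s n = (if n = 0 then 0 else split_coeff n / (\<theta> n - \<theta> (n - 1)))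
    - (if n = d then 0 else split_coeff (Suc n) / (\<theta> (Suc n) - \<theta> n))"
proof -
  define r where "r m = wc m (split m)" for m
  have r: "r m \<noteq> 0" if "m \<le> d" for m
    using that by (simp add: r_def wc_split_diag_nonzero)
  have r_Suc: "r (Suc m) = (\<theta> (Suc m) - \<theta> m) * wc (Suc m) (split m)" if "Suc m \<le> d" for m
    using that by (simp add: r_def split_Suc wside.vc_linear wside.vc_As algebra_simps)
  have gap: "\<theta> (Suc m) - \<theta> m \<noteq> 0" if "Suc m \<le> d" for m
    using that wside.\<theta>s_distinct[of "Suc m" m] by simp
  have upper: "wside.superdiag m * r (Suc m) = split_coeff (Suc m) * r m" if "Suc m \<le> d" for m
    using wside.vc_A[of m "split (Suc m)"] that As_split[OF that]
    by (auto simp: wside.vc_linear wc_split_below r_def)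
  have "wc n (As (split n)) = \<theta>s n * r n
      + (if n = 0 then 0 else split_coeff n * wc n (split (n - 1)))"
  proof (cases n)
    case 0
    then show ?thesis using assms As_split_0 by (simp add: r_def wside.vc_linear)
  next
    case (Suc m)
    then show ?thesis using assms As_split[of m] by (simp add: r_def wside.vc_linear)
  qed
  moreover have "wc n (As (split n)) = as n * r n
      + (if n = d then 0 else wside.superdiag n * wc (Suc n) (split n))"
    using assms by (simp add: wside.vc_A wc_split_below r_def)
  ultimately have eq: "(as n - \<theta>s n) * r n = (if n = 0 then 0 else split_coeff n * wc n (split (n - 1)))
      - (if n = d then 0 else wside.superdiag n * wc (Suc n) (split n))"
    by (simp add: algebra_simps)
  have "(if n = 0 then 0 else split_coeff n * wc n (split (n - 1)))
      = (if n = 0 then 0 else split_coeff n / (\<theta> n - \<theta> (n - 1))) * r n"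
    using r_Suc[of "n - 1"] gap[of "n - 1"] assms by auto
  moreover have "(if n = d then 0 else wside.superdiag n * wc (Suc n) (split n))
      = (if n = d then 0 else split_coeff (Suc n) / (\<theta> (Suc n) - \<theta> n)) * r n"
  proof (cases "n = d")
    case False
    then have n: "Suc n \<le> d" using assms by simp
    have "wside.superdiag n * wc (Suc n) (split n) * (\<theta> (Suc n) - \<theta> n) = split_coeff (Suc n) * r n"
      using upper[OF n] by (simp add: r_Suc[OF n] mult_ac)
    then show ?thesis
      using gap[OF n] False by (simp add: eq_divide_eq)
  qed simp
  ultimately have "(as n - \<theta>s n) * r n = ((if n = 0 then 0 else split_coeff n / (\<theta> n - \<theta> (n - 1)))
    - (if n = d then 0 else split_coeff (Suc n) / (\<theta> (Suc n) - \<theta> n))) * r n"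
    using eq by (simp add: left_diff_distrib)
  then show ?thesis
    using r[OF assms] by simp
qed

text \<open>
  The parameters are unchanged when the two operators are exchanged: \<open>as_eq\<close> telescopes to the
  defining formula of the split coefficients for the exchanged pair.
\<close>

lemma split_coeff_dual:
  assumes "i \<in> {1..d}"
  shows "split_coeff i = (\<theta> (i - 1) - \<theta> i) * (\<Sum>h<i. as h - \<theta>s h)"
proof -
  have "(\<Sum>h\<le>n. as h - \<theta>s h) = - split_coeff (Suc n) / (\<theta> (Suc n) - \<theta> n)" if "n < d" for n
    using that
  proof (induction n)
    case (Suc n)
    then show ?case using as_eq[of "Suc n"] by simp
  qed (simp add: as_eq)
  from this[of "i - 1"] show ?thesis
    using assms wside.\<theta>s_distinct[of i "i - 1"] 
    by (cases i) (auto simp: lessThan_Suc_atMost field_simps)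
qed

end

section \<open>Interpolation and three-term recurrences\<close>

lemma newton_interpolation:
  fixes \<theta> z :: "nat \<Rightarrow> 'k::field"
  assumes "inj_on \<theta> {..d}"
  shows "\<exists>g. \<forall>j\<le>d. z j = (\<Sum>k\<le>d. g k * (\<Prod>h<k. \<theta> j - \<theta> h))"
  using assms
proof (induction d)
  case 0
  show ?case by (rule exI[of _ z]) simp
next
  case (Suc d)
  then obtain g where g: "\<forall>j\<le>d. z j = (\<Sum>k\<le>d. g k * (\<Prod>h<k. \<theta> j - \<theta> h))"
    using inj_on_subset[of \<theta> "{..Suc d}" "{..d}"] by fastforce
  define q where "q = (\<Prod>h<Suc d. \<theta> (Suc d) - \<theta> h)"
  have "q \<noteq> 0"
    using Suc.prems by (fastforce simp: q_def inj_on_def simp del: prod.lessThan_Suc)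
  define g' where "g' = g(Suc d := (z (Suc d) - (\<Sum>k\<le>d. g k * (\<Prod>h<k. \<theta> (Suc d) - \<theta> h))) / q)"
  have "z j = (\<Sum>k\<le>Suc d. g' k * (\<Prod>h<k. \<theta> j - \<theta> h))" if "j \<le> Suc d" for j
  proof (cases "j = Suc d")
    case True
    then show ?thesis
      using \<open>q \<noteq> 0\<close> by (simp add: g'_def q_def)
  next
    case False
    then have "(\<Prod>h<Suc d. \<theta> j - \<theta> h) = 0"
      using that by (intro prod_zero) auto
    then show ?thesis
      using g False that by (simp add: g'_def)
  qed
  then show ?case by blast
qed

text \<open>
  The hypotheses say that the divided differences of the cubic \<open>N\<close> at \<open>(x, y)\<close> and \<open>(y, w)\<close> are
  \<open>x y\<close> and \<open>y w\<close>. The second divided difference is therefore \<open>y\<close>, and the right-hand side is its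
  value for a cubic in Newton form.
\<close>

lemma cubic_divided_difference:
  fixes x y w g0 g1 g2 g3 t0 t1 t2 :: "'k::field"
  defines "N \<equiv> \<lambda>u. g0 + g1 * (u - t0) + g2 * ((u - t0) * (u - t1)) + g3 * ((u - t0) * (u - t1) * (u - t2))"
  assumes "N x - N y = x * y * (x - y)" "N y - N w = y * w * (y - w)"
    and "x \<noteq> y" "y \<noteq> w" "x \<noteq> w"
  shows "y = g2 + g3 * (x + y + w - (t0 + t1 + t2))"
proof -
  define D where "D = (\<lambda>u v. g1 + g2 * (u + v - t0 - t1)
    + g3 * (u * u + u * v + v * v - (u + v) * (t0 + t1 + t2) + t0 * t1 + t0 * t2 + t1 * t2))"
  have D: "N u - N v = (u - v) * D u v" for u v
    by (simp add: N_def D_def algebra_simps)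
  have "D x y = x * y" "D y w = y * w"
    using assms(2-) D[of x y] D[of y w] by auto
  moreover have "D x y - D y w = (x - w) * (g2 + g3 * (x + y + w - (t0 + t1 + t2)))"
    by (simp add: D_def algebra_simps)
  ultimately have "(x - w) * y = (x - w) * (g2 + g3 * (x + y + w - (t0 + t1 + t2)))"
    by (simp add: algebra_simps)
  then show ?thesis
    using \<open>x \<noteq> w\<close> by simp
qed

text \<open>
  The solution of the inhomogeneous recurrence that measures the failure of collinearity. For
  \<open>\<beta> = q\<^sup>2 + q\<^sup>-\<^sup>2\<close> it is the product of quantum integers \<open>[n] [n - 1] / [2]\<close>; working with the recurrence
  covers all characteristics and all \<open>\<beta>\<close> at once.
\<close>

fun step_seq :: "'k::field \<Rightarrow> nat \<Rightarrow> 'k" where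
  "step_seq \<beta> 0 = 0"
| "step_seq \<beta> (Suc 0) = 0"
| "step_seq \<beta> (Suc (Suc n)) = \<beta> * step_seq \<beta> (Suc n) - step_seq \<beta> n + 1"

text \<open>
  In terms of quantum integers both sides are \<open>[n + 2] [n + 1] [n] [n - 1] / [2]\<^sup>2\<close>.
\<close>

lemma step_seq_product:
  "step_seq \<beta> (Suc (Suc n)) * step_seq \<beta> n = step_seq \<beta> (Suc n) * (step_seq \<beta> (Suc n) - 1)"
proof (induction n)
  case (Suc n)
  define s0 s1 s2 where "s0 = step_seq \<beta> n" and "s1 = step_seq \<beta> (Suc n)"
    and "s2 = step_seq \<beta> (Suc (Suc n))"
  have s2: "s2 = \<beta> * s1 - s0 + 1" by (simp add: s0_def s1_def s2_def)
  have IH: "s2 * s0 = s1 * (s1 - 1)" using Suc by (simp only: s0_def s1_def s2_def)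
  have "(\<beta> * s2 - s1 + 1) * s1 = s2 * (\<beta> * s1) - s1 * (s1 - 1)"
    by (simp add: algebra_simps)
  also have "\<dots> = s2 * (s2 - 1)"
    unfolding IH[symmetric] by (simp add: s2 algebra_simps)
  finally show ?case
    by (simp only: step_seq.simps(3)[of \<beta> "Suc n"] s1_def s2_def)
qed simp

lemma recurrence_solution:
  fixes y :: "nat \<Rightarrow> 'k::field"
  assumes "y 0 = 0" and "\<And>n. Suc n < d \<Longrightarrow> y (Suc (Suc n)) = \<beta> * y (Suc n) - y n + c"
    and "n \<le> d"
  shows "y n = y 1 * step_seq \<beta> (Suc n) + (c - y 1) * step_seq \<beta> n"
  using assms(3)
proof (induction n rule: induct_nat_012)
  case (ge2 n)
  then have "y (Suc (Suc n)) = \<beta> * (y 1 * step_seq \<beta> (Suc (Suc n)) + (c - y 1) * step_seq \<beta> (Suc n))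
      - (y 1 * step_seq \<beta> (Suc n) + (c - y 1) * step_seq \<beta> n) + c"
    using assms(2)[of n] by simp
  then show ?case
    by (simp add: algebra_simps)
qed (use assms in auto)

text \<open>
  If \<open>step_seq \<beta> d\<close> vanished, then so would one of its two neighbours by \<open>step_seq_product\<close>, and
  \<open>recurrence_solution\<close> would give \<open>y d = 0\<close> or \<open>y (d - 1) = 0\<close>. It is applied to \<open>y n = \<theta> n - \<theta> 0\<close>.
\<close>

lemma step_seq_nonzero:
  fixes y :: "nat \<Rightarrow> 'k::field"
  assumes "y 0 = 0" and "\<And>n. Suc n < d \<Longrightarrow> y (Suc (Suc n)) = \<beta> * y (Suc n) - y n + c"
    and "\<And>n. n \<in> {1..d} \<Longrightarrow> y n \<noteq> 0" and "2 \<le> d"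
  shows "step_seq \<beta> d \<noteq> 0"
proof
  assume zero: "step_seq \<beta> d = 0"
  obtain n where n: "d = Suc n" "1 \<le> n"
    using assms(4) by (cases d) auto
  have "y d = y 1 * step_seq \<beta> (Suc d)" "y n = (c - y 1) * step_seq \<beta> n"
    using recurrence_solution[of y d \<beta> c d] recurrence_solution[of y d \<beta> c n] assms zero n by auto
  then have "step_seq \<beta> (Suc d) * step_seq \<beta> n \<noteq> 0"
    using assms(3)[of d] assms(3)[of n] n by auto
  then show False
    using step_seq_product[of \<beta> n] zero n by simp
qed

text \<open>
  The deviation \<open>\<sigma>\<close> of \<open>\<theta>s\<close> from the line through the points \<open>0\<close> and \<open>d\<close> satisfies the same recurrence
  up to a constant. As \<open>\<sigma> 0 = \<sigma> 1 = 0\<close>, it is a multiple of \<open>step_seq \<beta>\<close>, and \<open>\<sigma> d = 0\<close> kills the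
  factor.
\<close>

lemma collinear_recurrent_sequences:
  fixes \<theta> \<theta>s :: "nat \<Rightarrow> 'k::field"
  assumes "1 \<le> d" and inj: "inj_on \<theta> {..d}"
    and rec: "\<And>i. 1 \<le> i \<Longrightarrow> i < d \<Longrightarrow> \<theta> (i - 1) - \<beta> * \<theta> i + \<theta> (i + 1) = \<gamma>"
    and recs: "\<And>i. 1 \<le> i \<Longrightarrow> i < d \<Longrightarrow> \<theta>s (i - 1) - \<beta> * \<theta>s i + \<theta>s (i + 1) = \<gamma>s"
    and col: "(\<theta>s 0 - \<theta>s 1) * (\<theta> 0 - \<theta> d) = (\<theta> 0 - \<theta> 1) * (\<theta>s 0 - \<theta>s d)"
    and "i \<le> d"
  shows "\<theta>s i = \<theta>s 0 + (\<theta>s d - \<theta>s 0) / (\<theta> d - \<theta> 0) * (\<theta> i - \<theta> 0)"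
proof -
  define \<kappa> where "\<kappa> = (\<theta>s d - \<theta>s 0) / (\<theta> d - \<theta> 0)"
  define y where "y n = \<theta> n - \<theta> 0" for n
  define \<sigma> where "\<sigma> n = \<theta>s n - \<theta>s 0 - \<kappa> * y n" for n
  define c where "c = \<gamma> - (2 - \<beta>) * \<theta> 0"
  define c' where "c' = \<gamma>s - (2 - \<beta>) * \<theta>s 0 - \<kappa> * c"
  have distinct: "\<theta> m \<noteq> \<theta> n" if "m \<le> d" "n \<le> d" "m \<noteq> n" for m n
    using that inj by (auto simp: inj_on_def)
  have "\<theta> d - \<theta> 0 \<noteq> 0"
    using distinct[of d 0] assms(1) by auto
  then have \<sigma>0: "\<sigma> 0 = 0" and \<sigma>1: "\<sigma> 1 = 0" and \<sigma>d: "\<sigma> d = 0"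
    using col by (auto simp: \<sigma>_def y_def \<kappa>_def field_simps)
  have y_rec: "y (Suc (Suc n)) = \<beta> * y (Suc n) - y n + c" if "Suc n < d" for n
    using rec[of "Suc n"] that by (simp add: y_def c_def algebra_simps)
  have \<sigma>_rec: "\<sigma> (Suc (Suc n)) = \<beta> * \<sigma> (Suc n) - \<sigma> n + c'" if "Suc n < d" for n
  proof -
    have step: "\<theta>s (Suc (Suc n)) = \<beta> * \<theta>s (Suc n) - \<theta>s n + \<gamma>s"
      using recs[of "Suc n"] that by (simp add: algebra_simps)
    show ?thesis
      unfolding \<sigma>_def y_rec[OF that] step c'_def by (simp add: algebra_simps)
  qed
  have \<sigma>: "\<sigma> n = c' * step_seq \<beta> n" if "n \<le> d" for n
    using recurrence_solution[of \<sigma> d \<beta> c' n] \<sigma>0 \<sigma>1 \<sigma>_rec that by simp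
  have "\<sigma> i = 0"
  proof (cases "2 \<le> d")
    case True
    have "step_seq \<beta> d \<noteq> 0"
    proof (rule step_seq_nonzero[of y d \<beta> c, OF _ y_rec _ True])
      show "y n \<noteq> 0" if "n \<in> {1..d}" for n
        using that distinct[of n 0] by (auto simp: y_def)
    qed (simp add: y_def)
    then show ?thesis
      using \<sigma>[of d] \<sigma>d \<sigma>[OF assms(6)] by simp
  next
    case False
    then have "i = 0 \<or> i = 1"
      using assms(6) by linarith
    then show ?thesis
      using \<sigma>0 \<sigma>1 by auto
  qed
  then show ?thesis
    by (simp add: \<sigma>_def \<kappa>_def[symmetric] y_def algebra_simps)
qed

context leonard_bases
begin

section \<open>Relations between the two eigenvalue sequences\<close>

definition spectral :: "(nat \<Rightarrow> 'k) \<Rightarrow> 'v \<Rightarrow> 'v" where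
  "spectral z x = (\<Sum>j\<le>d. (z j * wc j x) *s w j)"

lemma wc_spectral: "j \<le> d \<Longrightarrow> wc j (spectral z x) = z j * wc j x"
  unfolding spectral_def by (rule wside.vc_combination)

text \<open>
  An operator that is diagonal in the basis \<open>w\<close> is a polynomial in \<open>A\<close>; its degree can be read off
  from the support of the image of \<open>v 0\<close>, because a polynomial of degree \<open>k\<close> in \<open>A\<close> maps \<open>v 0\<close> to a
  vector with leading term at \<open>v k\<close>. The Newton form with nodes \<open>\<theta> 0, \<theta> 1, \<dots>\<close> matches the split
  vectors.
\<close>

lemma spectral_newton:
  assumes "m \<le> d" and "vside.vanishes_above m (spectral z (v 0))"
  obtains g where
    "\<And>j. j \<le> d \<Longrightarrow> z j = (\<Sum>k\<le>m. g k * (\<Prod>h<k. \<theta> j - \<theta> h))"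
    "vc m (spectral z (v 0)) = g m * vside.lead m"
    "\<And>x. spectral z x = (\<Sum>k\<le>m. g k *s vside.chain \<theta> k x)"
proof -
  obtain g where g: "\<And>j. j \<le> d \<Longrightarrow> z j = (\<Sum>k\<le>d. g k * (\<Prod>h<k. \<theta> j - \<theta> h))"
    using newton_interpolation[OF wside.inj_\<theta>s] by blast
  have form: "spectral z (v 0) = (\<Sum>k\<le>d. g k *s split k)"
    by (rule wside.eqI_vc)
      (simp add: wc_spectral wside.vc_linear wc_split g sum_distrib_right mult.assoc)
  have top: "vc n (spectral z (v 0)) = g n * vside.lead n"
    if "n \<le> d" and high: "\<And>k. n < k \<Longrightarrow> k \<le> d \<Longrightarrow> g k = 0" for n
  proof -
    have "vc n (spectral z (v 0)) = (\<Sum>k\<le>d. g k * vc n (split k))"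
      using \<open>n \<le> d\<close> by (simp add: form vside.vc_linear)
    also have "\<dots> = (\<Sum>k\<in>{n}. g k * vc n (split k))"
    proof (rule sum.mono_neutral_right)
      have "vc n (split k) = 0" if "k < n" for k
        using vside.vanishes_above_chain_v0[of k \<theta>] that \<open>n \<le> d\<close>
        by (auto simp: split_def vside.vanishes_above_def)
      then show "\<forall>k\<in>{..d} - {n}. g k * vc n (split k) = 0"
        using high by (metis DiffD1 DiffD2 atMost_iff mult_eq_0_iff nat_neq_iff singletonI)
    qed (use that in auto)
    finally show ?thesis
      using \<open>n \<le> d\<close> by (simp add: split_def vside.vc_top_chain_v0)
  qed
  have g_zero: "g k = 0" if "m < k" "k \<le> d" for k
    using that
  proof (induction "d - k" arbitrary: k rule: less_induct)
    case less
    then have "vc k (spectral z (v 0)) = g k * vside.lead k"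
      by (intro top) auto
    moreover have "vc k (spectral z (v 0)) = 0"
      using assms(2) less.prems by (auto simp: vside.vanishes_above_def)
    ultimately show ?case
      using vside.lead_nonzero less.prems by auto
  qed
  have z: "z j = (\<Sum>k\<le>m. g k * (\<Prod>h<k. \<theta> j - \<theta> h))" if "j \<le> d" for j
    unfolding g[OF that] by (rule sum.mono_neutral_right) (use assms(1) g_zero in auto)
  show thesis
  proof (rule that[OF z])
    show "vc m (spectral z (v 0)) = g m * vside.lead m"
      using g_zero assms(1) by (intro top) auto
    show "spectral z x = (\<Sum>k\<le>m. g k *s vside.chain \<theta> k x)" for x
      by (rule wside.eqI_vc)
        (simp add: wc_spectral wside.vc_linear wc_chain z sum_distrib_right mult.assoc)
  qed
qed

text \<open>
  The tridiagonal relation in disguise. Choose the operator \<open>Z\<close>, diagonal in the basis \<open>w\<close>, such that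
  \<open>Z A* - A* Z = A\<^sup>2 A* A - A A* A\<^sup>2\<close>; as \<open>A*\<close> is tridiagonal in this basis, this only prescribes the
  differences of consecutive eigenvalues of \<open>Z\<close>. In the basis \<open>v\<close> the right-hand side raises indices
  by at most \<open>3\<close>, so \<open>Z\<close> is a cubic in \<open>A\<close>, with leading coefficient \<open>p\<close> say. The entries of the
  relation that raise the index by exactly \<open>3\<close> give
  \<open>p (\<theta>s i - \<theta>s (i + 3)) = \<theta>s (i + 1) - \<theta>s (i + 2)\<close>, and the cubic form of the eigenvalues of \<open>Z\<close>
  gives the corresponding relation for \<open>\<theta>\<close>. Both amount to the recurrence with \<open>\<beta> = 1/p - 1\<close>.
\<close>

lemma eigenvalue_recurrence_3:
  assumes "3 \<le> d"
  shows "\<exists>\<beta> \<gamma> \<gamma>s. \<forall>i. 1 \<le> i \<longrightarrow> i < d \<longrightarrow>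
    \<theta> (i - 1) - \<beta> * \<theta> i + \<theta> (i + 1) = \<gamma> \<and> \<theta>s (i - 1) - \<beta> * \<theta>s i + \<theta>s (i + 1) = \<gamma>s"
proof -
  \<comment> \<open>The difference of consecutive values must be the coefficient
      \<open>\<theta> i\<^sup>2 \<theta> (i + 1) - \<theta> i \<theta> (i + 1)\<^sup>2\<close> of \<open>A*\<close> in \<open>A\<^sup>2 A* A - A A* A\<^sup>2\<close>.\<close>
  define z where "z i = - (\<Sum>h<i. \<theta> h * \<theta> (Suc h) * (\<theta> h - \<theta> (Suc h)))" for i
  have z_step: "z i - z (Suc i) = \<theta> i * \<theta> (Suc i) * (\<theta> i - \<theta> (Suc i))" for i
    by (simp add: z_def)
  let ?Z = "spectral z"
  have commutator: "?Z (As x) - As (?Z x) = A (A (As (A x))) - A (As (A (A x)))" for x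
  proof (rule wside.eqI_vc)
    fix i assume i: "i \<le> d"
    define m where "m j = wc i (As (w j))" for j
    have wc_As: "wc i (As y) = (\<Sum>j\<le>d. m j * wc j y)" for y
      unfolding m_def using i by (rule wside.vc_A_matrix)
    have m: "m j * (z i - z j) = m j * (\<theta> i * \<theta> j * (\<theta> i - \<theta> j))" if "j \<le> d" for j
    proof -
      consider "j = i" | "j = Suc i" | "i = Suc j" | "\<bar>int i - int j\<bar> > 1" by linarith
      then show ?thesis
      proof cases
        case 3
        have "z i - z j = - (z j - z (Suc j))" using 3 by simp
        also have "\<dots> = \<theta> i * \<theta> j * (\<theta> i - \<theta> j)"
          unfolding z_step using 3 by (simp add: algebra_simps)
        finally show ?thesis by simp
      next
        case 4
        then show ?thesis
          using wside.A_far[of i j] i that by (simp add: m_def)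
      qed (use z_step in auto)
    qed
    have "wc i (?Z (As x) - As (?Z x)) = (\<Sum>j\<le>d. m j * (z i - z j) * wc j x)"
      using i by (simp add: wside.vc_linear wc_spectral wc_As
          sum_distrib_left sum_subtractf[symmetric] algebra_simps)
    also have "\<dots> = (\<Sum>j\<le>d. m j * (\<theta> i * \<theta> j * (\<theta> i - \<theta> j)) * wc j x)"
      using m by (intro sum.cong) auto
    also have "\<dots> = wc i (A (A (As (A x))) - A (As (A (A x))))"
      using i by (simp add: wside.vc_linear wside.vc_As wc_As
          sum_distrib_left sum_subtractf[symmetric] algebra_simps)
    finally show "wc i (?Z (As x) - As (?Z x)) = wc i (A (A (As (A x))) - A (As (A (A x))))" .
  qed
  have "vside.vanishes_above 3 (?Z (v 0))"
    unfolding vside.vanishes_above_def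
  proof (intro allI impI)
    fix n assume n: "n \<le> d" "3 < n"
    have v0: "vside.vanishes_above 0 (v 0)"
      by (simp add: vside.vanishes_above_v)
    have "vside.vanishes_above 3 (A (A (As (A (v 0)))) - A (As (A (A (v 0)))))"
      using v0 unfolding numeral_3_eq_3
      by (intro vside.vanishes_above_diff vside.vanishes_above_A vside.vanishes_above_As)
    then have "vc n (?Z (As (v 0)) - As (?Z (v 0))) = 0"
      unfolding commutator using n by (auto simp: vside.vanishes_above_def)
    moreover have "?Z (As (v 0)) = \<theta>s 0 *s ?Z (v 0)"
      by (rule wside.eqI_vc) (simp add: vside.As_v wc_spectral wside.vc_linear)
    ultimately have "(\<theta>s 0 - \<theta>s n) * vc n (?Z (v 0)) = 0"
      using n by (simp add: vside.vc_linear vside.vc_As algebra_simps)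
    then show "vc n (?Z (v 0)) = 0"
      using vside.\<theta>s_distinct[of 0 n] n by auto
  qed
  then obtain g where gz: "\<And>j. j \<le> d \<Longrightarrow> z j = (\<Sum>k\<le>3. g k * (\<Prod>h<k. \<theta> j - \<theta> h))"
    and gZ: "\<And>x. ?Z x = (\<Sum>k\<le>3. g k *s vside.chain \<theta> k x)"
    using spectral_newton[OF assms] by blast
  define p where "p = g 3"
  have cubic: "(\<theta>s i - \<theta>s (i + 3)) * p = \<theta>s (i + 1) - \<theta>s (i + 2)" if "i + 3 \<le> d" for i
  proof -
    define q where "q = vside.subdiag i * vside.subdiag (i + 1) * vside.subdiag (i + 2)"
    have "q \<noteq> 0"
      using that by (simp add: q_def vside.subdiag_nonzero)
    have vi: "vside.vanishes_above i (v i)"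
      using that by (simp add: vside.vanishes_above_v)
    have "vc (i + 3) (?Z (v i)) = (\<Sum>k\<le>3. g k * vc (i + 3) (vside.chain \<theta> k (v i)))"
      using that by (simp add: gZ vside.vc_linear)
    also have "\<dots> = (\<Sum>k\<in>{3}. g k * vc (i + 3) (vside.chain \<theta> k (v i)))"
    proof (rule sum.mono_neutral_right)
      have "vc (i + 3) (vside.chain \<theta> k (v i)) = 0" if "k < 3" for k
        using vside.vanishes_above_chain[OF vi, of k \<theta>] that \<open>i + 3 \<le> d\<close>
        by (auto simp: vside.vanishes_above_def)
      then show "\<forall>k\<in>{..3} - {3}. g k * vc (i + 3) (vside.chain \<theta> k (v i)) = 0" by auto
    qed auto
    also have "\<dots> = p * q"
      using vside.vc_top_chain[OF vi, of 3 \<theta>] that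
      by (simp add: p_def q_def vside.vc_v eval_nat_numeral)
    finally have Zv: "vc (i + 3) (?Z (v i)) = p * q" .
    have "?Z (As (v i)) = \<theta>s i *s ?Z (v i)"
      using that by (intro wside.eqI_vc) (simp add: vside.As_v wc_spectral wside.vc_linear)
    then have lhs: "vc (i + 3) (?Z (As (v i)) - As (?Z (v i))) = (\<theta>s i - \<theta>s (i + 3)) * (p * q)"
      using that Zv by (simp add: vside.vc_linear vside.vc_As algebra_simps)
    have b1: "vside.vanishes_above (Suc i) (A (v i))"
      by (intro vside.vanishes_above_A vi)
    have b2: "vside.vanishes_above (Suc i) (As (A (v i)))"
      by (intro vside.vanishes_above_As b1)
    have b3: "vside.vanishes_above (Suc (Suc i)) (A (As (A (v i))))"
      by (intro vside.vanishes_above_A b2)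
    have c2: "vside.vanishes_above (Suc (Suc i)) (A (A (v i)))"
      by (intro vside.vanishes_above_A b1)
    have c3: "vside.vanishes_above (Suc (Suc i)) (As (A (A (v i))))"
      by (intro vside.vanishes_above_As c2)
    have "vc (Suc (Suc (Suc i))) (A (A (As (A (v i)))) - A (As (A (A (v i)))))
        = (\<theta>s (i + 1) - \<theta>s (i + 2)) * q"
      using that
      by (simp add: vside.vc_diff vside.vc_Suc_A[OF b3] vside.vc_Suc_A[OF b2] vside.vc_Suc_A[OF vi]
        vside.vc_Suc_A[OF c3] vside.vc_Suc_A[OF b1] vside.vc_As vside.vc_v q_def algebra_simps)
    then have "(\<theta>s i - \<theta>s (i + 3)) * (p * q) = (\<theta>s (i + 1) - \<theta>s (i + 2)) * q"
      using lhs by (simp add: commutator eval_nat_numeral eq_commute)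
    then show ?thesis
      using \<open>q \<noteq> 0\<close> by simp
  qed
  have "p \<noteq> 0"
    using cubic[of 0] assms vside.\<theta>s_distinct[of 1 2] by (auto simp: numeral_2_eq_2)
  define \<beta> where "\<beta> = 1 / p - 1"
  define T where "T = \<theta> 0 + \<theta> 1 + \<theta> 2"
  have rec: "\<theta> (i - 1) - \<beta> * \<theta> i + \<theta> (i + 1) = T - g 2 / p" if "1 \<le> i" "i < d" for i
  proof -
    obtain n where n: "i = Suc n" using \<open>1 \<le> i\<close> by (cases i) auto
    have N: "z j = g 0 + g 1 * (\<theta> j - \<theta> 0) + g 2 * ((\<theta> j - \<theta> 0) * (\<theta> j - \<theta> 1))
        + p * ((\<theta> j - \<theta> 0) * (\<theta> j - \<theta> 1) * (\<theta> j - \<theta> 2))" if "j \<le> d" for j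
      using gz[OF that] by (simp add: p_def eval_nat_numeral)
    have le: "n \<le> d" "Suc n \<le> d" "Suc (Suc n) \<le> d"
      using \<open>i < d\<close> n by auto
    have "\<theta> (Suc n) = g 2 + p * (\<theta> n + \<theta> (Suc n) + \<theta> (Suc (Suc n)) - (\<theta> 0 + \<theta> 1 + \<theta> 2))"
    proof (rule cubic_divided_difference)
      show "\<theta> n \<noteq> \<theta> (Suc n)" "\<theta> (Suc n) \<noteq> \<theta> (Suc (Suc n))" "\<theta> n \<noteq> \<theta> (Suc (Suc n))"
        using le wside.\<theta>s_distinct by auto
    qed (fact z_step[of n, unfolded N[OF le(1)] N[OF le(2)]]
        z_step[of "Suc n", unfolded N[OF le(2)] N[OF le(3)]])+
    then have "\<theta> i = g 2 + p * (\<theta> (i - 1) + \<theta> i + \<theta> (i + 1) - (\<theta> 0 + \<theta> 1 + \<theta> 2))"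
      by (simp add: n)
    then have "\<theta> i / p = g 2 / p + (\<theta> (i - 1) + \<theta> i + \<theta> (i + 1) - T)"
      using \<open>p \<noteq> 0\<close> unfolding T_def by (simp add: field_simps)
    then show ?thesis
      by (simp add: \<beta>_def algebra_simps)
  qed
  define \<gamma>s where "\<gamma>s = \<theta>s 0 - \<beta> * \<theta>s 1 + \<theta>s 2"
  have recs: "Suc (Suc n) \<le> d \<Longrightarrow> \<theta>s n - \<beta> * \<theta>s (Suc n) + \<theta>s (Suc (Suc n)) = \<gamma>s" for n
  proof (induction n)
    case (Suc n)
    have "\<theta>s n - \<theta>s (n + 3) = (1 + \<beta>) * (\<theta>s (n + 1) - \<theta>s (n + 2))"
      using cubic[of n] Suc.prems \<open>p \<noteq> 0\<close> by (simp add: \<beta>_def field_simps)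
    then have "\<theta>s (Suc n) - \<beta> * \<theta>s (Suc (Suc n)) + \<theta>s (Suc (Suc (Suc n)))
        = \<theta>s n - \<beta> * \<theta>s (Suc n) + \<theta>s (Suc (Suc n))
          + ((1 + \<beta>) * (\<theta>s (n + 1) - \<theta>s (n + 2)) - (\<theta>s n - \<theta>s (n + 3)))"
      by (simp only: numeral_2_eq_2 numeral_3_eq_3) (simp add: algebra_simps)
    also have "\<dots> = \<gamma>s"
      using Suc \<open>\<theta>s n - \<theta>s (n + 3) = _\<close> by simp
    finally show ?case .
  qed (simp add: \<gamma>s_def eval_nat_numeral)
  have "\<theta>s (i - 1) - \<beta> * \<theta>s i + \<theta>s (i + 1) = \<gamma>s" if "1 \<le> i" "i < d" for i
    using recs[of "i - 1"] that by simp
  with rec show ?thesis by blast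
qed

text \<open>
  For \<open>d < 3\<close> the index \<open>i = 1\<close> is the only possible one and the constants \<open>\<gamma>\<close>, \<open>\<gamma>s\<close> absorb
  everything.
\<close>

lemma eigenvalue_recurrence:
  obtains \<beta> \<gamma> \<gamma>s where
    "\<And>i. 1 \<le> i \<Longrightarrow> i < d \<Longrightarrow> \<theta> (i - 1) - \<beta> * \<theta> i + \<theta> (i + 1) = \<gamma>"
    "\<And>i. 1 \<le> i \<Longrightarrow> i < d \<Longrightarrow> \<theta>s (i - 1) - \<beta> * \<theta>s i + \<theta>s (i + 1) = \<gamma>s"
proof (cases "3 \<le> d")
  case True
  then show ?thesis using eigenvalue_recurrence_3 that by blast
next
  case False
  then have "i = 1" if "1 \<le> i" "i < d" for i
    using that by linarith
  then show ?thesis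
    using that[of 0 "\<theta> 0 + \<theta> 2" "\<theta>s 0 + \<theta>s 2"] by (metis add_diff_cancel_left' diff_0_right
      diff_self_eq_0 mult_zero_left one_add_one)
qed

text \<open>
  The Askey-Wilson relation is behind this. Let \<open>P\<close> be the symmetric quadratic polynomial that vanishes at all
  pairs of consecutive \<open>\<theta>s\<close>; it exists by the recurrence. The operator
  \<open>X = A*\<^sup>2 A - \<beta> A* A A* + A A*\<^sup>2 - \<gamma>s (A A* + A* A) - \<rho> A\<close> has the matrix entries
  \<open>P (\<theta>s i) (\<theta>s j)\<close> times those of \<open>A\<close> in the basis \<open>v\<close>, so it is diagonal there. In the basis \<open>w\<close> it raises
  indices by at most \<open>2\<close>, so it is a quadratic polynomial in \<open>A*\<close>, with leading coefficient \<open>\<gamma>\<close>.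
  Hence \<open>P (\<theta>s i) (\<theta>s i) a i\<close> is a quadratic polynomial in \<open>\<theta>s i\<close>. The symmetry of \<open>\<theta>\<close> yields
  \<open>2 \<gamma> = (2 - \<beta>) s\<close>, so the quadratic terms of \<open>P (\<theta>s i) (\<theta>s i) (2 a i - s)\<close> cancel. What
  remains is affine in \<open>\<theta>s i\<close> and vanishes for \<open>i = 0\<close> and \<open>i = d\<close>, hence identically; and
  \<open>P (\<theta>s i) (\<theta>s i) = (\<theta>s i - \<theta>s (i - 1)) (\<theta>s i - \<theta>s (i + 1))\<close> is nonzero in between.
  Stated without a division by \<open>2\<close>, this covers every characteristic.
\<close>

lemma constant_diagonal:
  assumes "1 \<le> d"
    and sym: "\<And>i. i \<le> d \<Longrightarrow> \<theta> i + \<theta> (d - i) = s"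
    and ends: "2 * a 0 = s" "2 * a d = s"
    and "i \<le> d"
  shows "2 * a i = s"
proof (cases "i = 0 \<or> i = d")
  case False
  then have d: "2 \<le> d" and i: "1 \<le> i" "i < d" using assms(5) by auto
  interpret D: leonard_bases scale d w wc As A \<theta> v vc \<theta>s by (rule dual)
  obtain \<beta> \<gamma> \<gamma>s where
    rec: "\<And>i. 1 \<le> i \<Longrightarrow> i < d \<Longrightarrow> \<theta> (i - 1) - \<beta> * \<theta> i + \<theta> (i + 1) = \<gamma>" and
    recs: "\<And>i. 1 \<le> i \<Longrightarrow> i < d \<Longrightarrow> \<theta>s (i - 1) - \<beta> * \<theta>s i + \<theta>s (i + 1) = \<gamma>s"
    using eigenvalue_recurrence by blast
  define \<rho> where "\<rho> = \<theta>s 0 * \<theta>s 0 - \<beta> * \<theta>s 0 * \<theta>s 1 + \<theta>s 1 * \<theta>s 1 - \<gamma>s * (\<theta>s 0 + \<theta>s 1)"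
  define P where "P x y = x * x - \<beta> * x * y + y * y - \<gamma>s * (x + y) - \<rho>" for x y
  have P_sym: "P x y = P y x" for x y
    by (simp add: P_def algebra_simps)
  have P_diff: "P x y - P x y' = (y - y') * (y + y' - \<beta> * x - \<gamma>s)" for x y y'
    by (simp add: P_def algebra_simps)
  have P_step: "P (\<theta>s n) (\<theta>s (Suc n)) = 0" if "n < d" for n
    using that
  proof (induction n)
    case (Suc n)
    have "P (\<theta>s (Suc n)) (\<theta>s (Suc (Suc n))) - P (\<theta>s (Suc n)) (\<theta>s n) = 0"
      unfolding P_diff using recs[of "Suc n"] Suc.prems by (simp add: algebra_simps)
    then show ?case
      using Suc P_sym[of "\<theta>s (Suc n)" "\<theta>s n"] by simp
  qed (simp add: P_def \<rho>_def)
  define z where "z j = P (\<theta>s j) (\<theta>s j) * a j" for j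
  define X where "X x = As (As (A x)) - \<beta> *s As (A (As x)) + A (As (As x))
    - \<gamma>s *s (A (As x) + As (A x)) - \<rho> *s A x" for x
  have X: "X x = D.spectral z x" for x
  proof (rule vside.eqI_vc)
    fix i assume i: "i \<le> d"
    define m where "m j = vc i (A (v j))" for j
    have vc_A: "vc i (A y) = (\<Sum>j\<le>d. m j * vc j y)" for y
      unfolding m_def using i by (rule vside.vc_A_matrix)
    have "vc i (X x) = (\<Sum>j\<le>d. P (\<theta>s i) (\<theta>s j) * (m j * vc j x))"
      using i by (simp add: X_def P_def vside.vc_linear vside.vc_As vc_A
          sum_distrib_left sum_subtractf[symmetric] sum.distrib[symmetric] algebra_simps)
    also have "\<dots> = (\<Sum>j\<in>{i}. P (\<theta>s i) (\<theta>s j) * (m j * vc j x))"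
    proof (rule sum.mono_neutral_right)
      show "\<forall>j\<in>{..d} - {i}. P (\<theta>s i) (\<theta>s j) * (m j * vc j x) = 0"
      proof
        fix j assume j: "j \<in> {..d} - {i}"
        then consider "j = Suc i" | "i = Suc j" | "\<bar>int i - int j\<bar> > 1" by auto linarith
        then show "P (\<theta>s i) (\<theta>s j) * (m j * vc j x) = 0"
          using P_step[of i] P_step[of j] P_sym[of "\<theta>s i" "\<theta>s j"] vside.A_far[of i j] i j m_def
          by cases auto
      qed
    qed (use i in auto)
    also have "\<dots> = vc i (D.spectral z x)"
      using i by (simp add: D.wc_spectral z_def vside.a_def m_def)
    finally show "vc i (X x) = vc i (D.spectral z x)" .
  qed
  have w0: "wside.vanishes_above 0 (w 0)"
    by (simp add: wside.vanishes_above_v)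
  have b1: "wside.vanishes_above 1 (As (w 0))" "wside.vanishes_above 1 (A (As (w 0)))"
    using wside.vanishes_above_A[OF w0] by (auto intro: wside.vanishes_above_As)
  have b2: "wside.vanishes_above 2 (As (As (w 0)))" "wside.vanishes_above 2 (As (A (As (w 0))))"
    using wside.vanishes_above_A[OF b1(1)] wside.vanishes_above_A[OF b1(2)]
    by (auto simp: eval_nat_numeral)
  have Xw: "X (w 0) = \<theta> 0 *s As (As (w 0)) - \<beta> *s As (A (As (w 0))) + A (As (As (w 0)))
    - \<gamma>s *s (A (As (w 0)) + \<theta> 0 *s As (w 0)) - (\<rho> * \<theta> 0) *s w 0"
    by (simp add: X_def wside.As_v wside.A_scale)
  have "wside.vanishes_above 2 (X (w 0))"
    using w0 b1 b2 by (auto simp: Xw wside.vanishes_above_def wside.vc_linear wside.vc_As)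
  moreover have "wc 2 (X (w 0)) = \<gamma> * wside.lead 2"
  proof -
    have low: "wc 2 (w 0) = 0" "wc 2 (As (w 0)) = 0" "wc 2 (A (As (w 0))) = 0"
      using w0 b1 d by (auto simp: wside.vanishes_above_def)
    have t1: "wc (Suc 0) (As (w 0)) = wside.subdiag 0"
      using wside.vc_Suc_A[OF w0] d by (simp add: wside.vc_v)
    have t2: "wc 2 (As (As (w 0))) = wside.lead 2"
      using wside.vc_Suc_A[OF b1(1)] d t1 by (simp add: wside.lead_def eval_nat_numeral)
    have t3: "wc 2 (As (A (As (w 0)))) = \<theta> 1 * wside.lead 2"
      using wside.vc_Suc_A[OF b1(2)] d t1 by (simp add: wside.lead_def eval_nat_numeral wside.vc_As)
    have "wc 2 (X (w 0)) = (\<theta> 0 - \<beta> * \<theta> 1 + \<theta> 2) * wside.lead 2"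
      using d by (simp add: Xw wside.vc_linear low t2 t3 wside.vc_As algebra_simps)
    also have "\<theta> 0 - \<beta> * \<theta> 1 + \<theta> 2 = \<gamma>"
      using rec[of 1] d by (simp add: eval_nat_numeral)
    finally show ?thesis .
  qed
  ultimately obtain g where
    g: "\<And>j. j \<le> d \<Longrightarrow> z j = (\<Sum>k\<le>2. g k * (\<Prod>h<k. \<theta>s j - \<theta>s h))"
    and "g 2 * wside.lead 2 = \<gamma> * wside.lead 2"
    using D.spectral_newton[OF d, of z] by (metis X)
  then have g2: "g 2 = \<gamma>"
    using wside.lead_nonzero[OF d] by simp
  have z_form: "z j = g 0 + g 1 * (\<theta>s j - \<theta>s 0) + \<gamma> * ((\<theta>s j - \<theta>s 0) * (\<theta>s j - \<theta>s 1))"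
    if "j \<le> d" for j
    using g[OF that] g2 by (simp add: eval_nat_numeral)
  have \<gamma>: "2 * \<gamma> = (2 - \<beta>) * s"
  proof -
    have "2 * \<gamma> = (\<theta> 0 - \<beta> * \<theta> 1 + \<theta> 2) + (\<theta> (d - 2) - \<beta> * \<theta> (d - 1) + \<theta> d)"
      using rec[of 1] rec[of "d - 1"] d by (simp add: eval_nat_numeral)
    also have "\<dots> = (\<theta> 0 + \<theta> d) - \<beta> * (\<theta> 1 + \<theta> (d - 1)) + (\<theta> 2 + \<theta> (d - 2))"
      by (simp add: algebra_simps)
    also have "\<dots> = (2 - \<beta>) * s"
      using sym[of 0] sym[of 1] sym[of 2] d by (simp add: algebra_simps)
    finally show ?thesis .
  qed
  define c1 where "c1 = 2 * g 1 - 2 * \<gamma> * (\<theta>s 0 + \<theta>s 1) + 2 * \<gamma>s * s"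
  define c0 where "c0 = 2 * g 0 - 2 * g 1 * \<theta>s 0 + 2 * \<gamma> * \<theta>s 0 * \<theta>s 1 + \<rho> * s"
  have lin: "P (\<theta>s j) (\<theta>s j) * (2 * a j - s) = c1 * \<theta>s j + c0" if "j \<le> d" for j
  proof -
    have "P (\<theta>s j) (\<theta>s j) * (2 * a j - s) = 2 * z j - P (\<theta>s j) (\<theta>s j) * s"
      by (simp add: z_def algebra_simps)
    also have "P (\<theta>s j) (\<theta>s j) * s = ((2 - \<beta>) * s) * (\<theta>s j * \<theta>s j) - 2 * \<gamma>s * s * \<theta>s j - \<rho> * s"
      by (simp add: P_def algebra_simps)
    also have "\<dots> = 2 * \<gamma> * (\<theta>s j * \<theta>s j) - 2 * \<gamma>s * s * \<theta>s j - \<rho> * s"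
      by (simp add: \<gamma>)
    finally show ?thesis
      by (simp add: z_form[OF that] c1_def c0_def algebra_simps)
  qed
  have "c1 * \<theta>s 0 + c0 = 0" "c1 * \<theta>s d + c0 = 0"
    using lin[of 0] lin[of d] ends by auto
  then have "c1 * (\<theta>s 0 - \<theta>s d) = 0"
    by (metis add_diff_cancel_right diff_self right_diff_distrib)
  then have "c1 = 0"
    using vside.\<theta>s_distinct[of 0 d] d by auto
  then have "c0 = 0"
    using \<open>c1 * \<theta>s 0 + c0 = 0\<close> by simp
  then have zero: "P (\<theta>s i) (\<theta>s i) * (2 * a i - s) = 0"
    using lin[of i] \<open>c1 = 0\<close> assms(5) by simp
  have "P (\<theta>s i) (\<theta>s i) = P (\<theta>s i) (\<theta>s i) - P (\<theta>s i) (\<theta>s (Suc i))"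
    using P_step i by simp
  also have "\<dots> = (\<theta>s i - \<theta>s (Suc i)) * (\<theta>s i - \<theta>s (i - 1))"
  proof -
    have "\<theta>s i + \<theta>s (Suc i) - \<beta> * \<theta>s i - \<gamma>s = \<theta>s i - \<theta>s (i - 1)"
      using recs[OF i] by (simp add: algebra_simps)
    then show ?thesis
      by (simp only: P_diff)
  qed
  finally have "P (\<theta>s i) (\<theta>s i) \<noteq> 0"
    using vside.\<theta>s_distinct[of i "Suc i"] vside.\<theta>s_distinct[of i "i - 1"] i by auto
  then show ?thesis
    using zero by simp
qed (use ends in auto)

end

section \<open>Reversal and intertwining maps\<close>

lemma (in coordinates) reversed_coordinates:
  "coordinates scale d (\<lambda>i. v (d - i)) (\<lambda>i. vc (d - i))"
proof
  fix x show "x = (\<Sum>i\<le>d. vc (d - i) x *s v (d - i))"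
    using expand[of x] sum.nat_diff_reindex[of "\<lambda>i. vc i x *s v i" "Suc d"]
    by (simp add: lessThan_Suc_atMost)
qed (auto simp: vc_linear vc_v)

context leonard_bases
begin

lemma reversed: "leonard_bases scale d v vc A As \<theta>s
    (\<lambda>i. w (d - i)) (\<lambda>i. wc (d - i)) (\<lambda>i. \<theta> (d - i))"
proof -
  interpret R: coordinates scale d "\<lambda>i. w (d - i)" "\<lambda>i. wc (d - i)"
    by (rule wside.reversed_coordinates)
  show ?thesis
  proof
    show "inj_on (\<lambda>i. \<theta> (d - i)) {..d}"
      by (rule inj_onI) (use wside.\<theta>s_distinct in \<open>metis atMost_iff diff_diff_cancel diff_le_self\<close>)
    fix i j assume "i \<le> d" "j \<le> d"
    then have *: "\<bar>int (d - i) - int (d - j)\<bar> = \<bar>int i - int j\<bar>"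
      by linarith
    show "wc (d - i) (As (w (d - j))) = 0" if "1 < \<bar>int i - int j\<bar>"
      using that * by (intro wside.A_far) auto
    show "wc (d - i) (As (w (d - j))) \<noteq> 0" if "\<bar>int i - int j\<bar> = 1"
      using that * by (intro wside.A_near) auto
  qed (auto simp: wside.operators_linear wside.As_v)
qed

text \<open>
  Matching the eigenvectors \<open>w j\<close> and \<open>w2 j\<close>, scaled so that \<open>v 0\<close> goes to \<open>v2 0\<close>, intertwines \<open>A\<close> with
  \<open>A2\<close> and therefore maps split vectors to split vectors. The hypothesis on the partial sums of the
  diagonals makes the split coefficients equal, so that the map intertwines \<open>As\<close> with \<open>As2\<close> on the
  split vectors; these span the space since they are triangular with respect to \<open>v\<close>.
\<close>

lemma intertwiner:
  assumes "leonard_bases scale d v2 vc2 A2 As2 \<theta>s w2 wc2 \<theta>"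
    and same: "\<And>i. i \<in> {1..d} \<Longrightarrow> (\<Sum>h<i. vc h (A (v h))) = (\<Sum>h<i. vc2 h (A2 (v2 h)))"
  obtains P where "bij P" "\<And>x y. P (x + y) = P x + P y" "\<And>c x. P (c *s x) = c *s P x"
    "\<And>x. P (A x) = A2 (P x)" "\<And>x. P (As x) = As2 (P x)"
proof -
  interpret J: leonard_bases scale d v2 vc2 A2 As2 \<theta>s w2 wc2 \<theta> by fact
  \<comment> \<open>The scaling that makes the map below send \<open>v 0\<close> to \<open>v2 0\<close>.\<close>
  define r where "r j = wc2 j (v2 0) / wc j (v 0)" for j
  have r: "r j \<noteq> 0" if "j \<le> d" for j
    using wc_v0_nonzero[OF that] J.wc_v0_nonzero[OF that] by (simp add: r_def)
  define P where "P x = (\<Sum>j\<le>d. (wc j x * r j) *s w2 j)" for x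
  define Q where "Q x = (\<Sum>j\<le>d. (wc2 j x / r j) *s w j)" for x
  have P: "wc2 j (P x) = wc j x * r j" if "j \<le> d" for j x
    unfolding P_def using that by (rule J.wside.vc_combination)
  have Q: "wc j (Q x) = wc2 j x / r j" if "j \<le> d" for j x
    unfolding Q_def using that by (rule wside.vc_combination)
  have add: "P (x + y) = P x + P y" for x y
    by (rule J.wside.eqI_vc) (simp add: P J.wside.vc_linear wside.vc_linear algebra_simps)
  have scale: "P (c *s x) = c *s P x" for c x
    by (rule J.wside.eqI_vc) (simp add: P J.wside.vc_linear wside.vc_linear)
  have diff: "P (x - y) = P x - P y" for x y
    by (rule J.wside.eqI_vc) (simp add: P J.wside.vc_linear wside.vc_linear algebra_simps)
  have PA: "P (A x) = A2 (P x)" for x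
    by (rule J.wside.eqI_vc) (simp add: P J.wside.vc_As wside.vc_As)
  have "Q (P x) = x" "P (Q x) = x" for x
    by (rule wside.eqI_vc J.wside.eqI_vc; simp add: P Q r)+
  then have "bij P"
    by (metis bijI' )
  have "P (v 0) = v2 0"
    by (rule J.wside.eqI_vc) (simp add: P r_def wc_v0_nonzero)
  then have P_split: "P (split n) = J.split n" for n
    by (induction n) (simp_all add: split_def J.split_def diff scale PA)
  have coeff: "split_coeff i = J.split_coeff i" if "i \<in> {1..d}" for i
    using same[OF that]
    by (simp add: split_coeff_def J.split_coeff_def vside.a_def J.vside.a_def sum_subtractf)
  have PAs_split: "P (As (split n)) = As2 (P (split n))" if "n \<le> d" for n
  proof (cases n)
    case 0
    then show ?thesis
      using As_split_0 J.As_split_0 by (simp add: P_split scale)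
  next
    case (Suc m)
    then show ?thesis
      using As_split[of m] J.As_split[of m] coeff[of n] that by (simp add: P_split scale add)
  qed
  have PAs_above: "P (As x) = As2 (P x)" if "n \<le> Suc d" "\<And>j. j \<le> d \<Longrightarrow> n \<le> j \<Longrightarrow> vc j x = 0" for n x
    using that
  proof (induction n arbitrary: x)
    case 0
    then have "x = 0"
      by (intro vside.eqI_vc) (auto simp: vside.vc_zero)
    then show ?case
      using scale[of 0 0] by (simp add: vside.As_zero J.vside.As_zero)
  next
    case (Suc n)
    \<comment> \<open>Subtracting this multiple of the split vector removes the leading term of \<open>x\<close>.\<close>
    define c where "c = vc n x / vside.lead n"
    have n: "n \<le> d" using Suc.prems by simp
    have "vc j (x - c *s split n) = 0" if "j \<le> d" "n \<le> j" for j
    proof (cases "j = n")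
      case True
      then show ?thesis
        using n vside.lead_nonzero[OF n]
        by (simp add: c_def split_def vside.vc_linear vside.vc_top_chain_v0)
    next
      case False
      then show ?thesis
        using that Suc.prems(2)[of j] vside.vanishes_above_chain_v0[of n \<theta>]
        by (simp add: split_def vside.vc_linear vside.vanishes_above_def)
    qed
    then have "P (As (x - c *s split n)) = As2 (P (x - c *s split n))"
      using Suc.IH n by simp
    then show ?case
      by (simp add: diff scale vside.As_diff vside.As_scale J.vside.As_diff J.vside.As_scale
          PAs_split[OF n])
  qed
  have "P (As x) = As2 (P x)" for x
    by (rule PAs_above[of "Suc d"]) auto
  with that \<open>bij P\<close> add scale PA show thesis by blast
qed

section \<open>Dualities of a Leonard pair\<close>

definition affine_swap :: "'k \<Rightarrow> 'k \<Rightarrow> 'k \<Rightarrow> 'k \<Rightarrow> ('v \<Rightarrow> 'v) \<Rightarrow> bool" where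
  "affine_swap \<xi> \<zeta> \<xi>s \<zeta>s P \<longleftrightarrow>
     bij P \<and> (\<forall>x y. P (x + y) = P x + P y) \<and> (\<forall>c x. P (c *s x) = c *s P x) \<and>
     (\<forall>x. P (As x) = \<xi> *s A (P x) + \<zeta> *s P x) \<and> (\<forall>x. P (A x) = \<xi>s *s As (P x) + \<zeta>s *s P x)"

text \<open>
  The pair of affine images of \<open>As\<close> and \<open>A\<close> is again a Leonard pair, with the bases \<open>w'\<close> and \<open>v\<close>
  in exchanged roles; here \<open>w'\<close> is \<open>w\<close> in its given or in reversed order. By
  \<open>split_coeff_dual\<close> its split parameters are \<open>\<xi> \<xi>s\<close> times those of the pair \<open>A\<close>, \<open>As\<close> with the
  ordering \<open>w'\<close>, so the hypotheses provide what \<open>intertwiner\<close> requires.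
\<close>

lemma self_dual_map:
  assumes "leonard_bases scale d v vc A As \<theta>s w' wc' \<theta>'"
    and \<theta>: "\<And>i. i \<le> d \<Longrightarrow> \<theta> i = \<xi>s * \<theta>s i + \<zeta>s"
    and \<theta>s: "\<And>i. i \<le> d \<Longrightarrow> \<theta>s i = \<xi> * \<theta>' i + \<zeta>"
    and "\<xi> \<noteq> 0" "\<xi>s \<noteq> 0"
    and coeff: "\<And>i. i \<in> {1..d} \<Longrightarrow>
      split_coeff i = \<xi> * \<xi>s * ((\<theta>s (i - 1) - \<theta>s i) * (\<Sum>h<i. a h - \<theta>' h))"
  shows "\<exists>P. affine_swap \<xi> \<zeta> \<xi>s \<zeta>s P"
proof -
  interpret R: leonard_bases scale d v vc A As \<theta>s w' wc' \<theta>' by fact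
  define A2 where "A2 x = \<xi>s *s As x + \<zeta>s *s x" for x
  define As2 where "As2 x = \<xi> *s A x + \<zeta> *s x" for x
  interpret J: leonard_bases scale d w' wc' A2 As2 \<theta>s v vc \<theta>
  proof
    show "A2 (x + y) = A2 x + A2 y" "As2 (x + y) = As2 x + As2 y"
        "A2 (c *s x) = c *s A2 x" "As2 (c *s x) = c *s As2 x" for c x y
      by (simp_all add: A2_def As2_def vside.operators_linear vside.scale_right_distrib mult.commute add_ac)
    show "As2 (w' i) = \<theta>s i *s w' i" "A2 (v i) = \<theta> i *s v i" if "i \<le> d" for i
    proof -
      show "As2 (w' i) = \<theta>s i *s w' i"
        using that by (simp add: As2_def R.wside.As_v vside.scale_left_distrib \<theta>s)
      show "A2 (v i) = \<theta> i *s v i"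
        unfolding A2_def \<theta>[OF that] using that by (simp add: vside.As_v vside.scale_left_distrib)
    qed
    show "inj_on \<theta>s {..d}" "inj_on \<theta> {..d}"
      by (rule vside.inj_\<theta>s wside.inj_\<theta>s)+
    fix i j assume ij: "i \<le> d" "j \<le> d"
    have w: "wc' i (A2 (w' j)) = \<xi>s * wc' i (As (w' j))" and v: "vc i (As2 (v j)) = \<xi> * vc i (A (v j))"
      if "i \<noteq> j"
      using ij that by (simp_all add: A2_def As2_def R.wside.vc_linear vside.vc_linear R.wside.vc_v vside.vc_v)
    show "wc' i (A2 (w' j)) = 0" "vc i (As2 (v j)) = 0" if "1 < \<bar>int i - int j\<bar>"
      using w v that ij R.wside.A_far[of i j] vside.A_far[of i j] by auto
    show "wc' i (A2 (w' j)) \<noteq> 0" "vc i (As2 (v j)) \<noteq> 0" if "\<bar>int i - int j\<bar> = 1"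
      using w v that ij R.wside.A_near[of i j] vside.A_near[of i j] assms(4,5) by auto
  qed
  have "(\<Sum>h<i. vc h (A (v h))) = (\<Sum>h<i. wc' h (A2 (w' h)))" if i: "i \<in> {1..d}" for i
  proof -
    have gap: "\<theta>s (i - 1) - \<theta>s i \<noteq> 0"
    proof -
      have le: "i - 1 \<le> d" "i \<le> d" "i - 1 \<noteq> i" using i by auto
      show ?thesis using vside.\<theta>s_distinct[OF le] by simp
    qed
    have "(\<theta>s (i - 1) - \<theta>s i) * (\<Sum>h<i. a h - \<theta> h) = \<xi> * \<xi>s * R.split_coeff i"
      using coeff[OF i] by (simp add: split_coeff_def R.split_coeff_def)
    also have "\<dots> = \<xi> * \<xi>s * ((\<theta>' (i - 1) - \<theta>' i) * (\<Sum>h<i. R.as h - \<theta>s h))"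
      by (simp add: R.split_coeff_dual[OF i])
    also have "\<dots> = (\<xi> * (\<theta>' (i - 1) - \<theta>' i)) * (\<xi>s * (\<Sum>h<i. R.as h - \<theta>s h))"
      by simp
    also have "\<xi> * (\<theta>' (i - 1) - \<theta>' i) = \<theta>s (i - 1) - \<theta>s i"
      using \<theta>s[of i] \<theta>s[of "i - 1"] i by (auto simp: algebra_simps)
    also have "\<xi>s * (\<Sum>h<i. R.as h - \<theta>s h) = (\<Sum>h<i. wc' h (A2 (w' h)) - \<theta> h)"
      unfolding sum_distrib_left using i
      by (intro sum.cong) (auto simp: A2_def R.wside.vc_linear R.wside.vc_v R.wside.a_def \<theta> algebra_simps)
    finally show ?thesis
      using gap by (simp add: sum_subtractf vside.a_def)
  qed
  from intertwiner[OF J.leonard_bases_axioms this] show ?thesis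
    unfolding A2_def As2_def affine_swap_def by metis
qed

lemma sum_as: "(\<Sum>h\<le>d. as h) = (\<Sum>h\<le>d. \<theta>s h)"
proof -
  interpret D: leonard_bases scale d w wc As A \<theta> v vc \<theta>s by (rule dual)
  show ?thesis by (rule D.sum_a)
qed

text \<open>
  The extreme split parameters only see the extreme diagonal entries. For the index \<open>d\<close> this uses
  that the diagonal and the eigenvalues have the same sum.
\<close>

lemma end_split_coeffs:
  assumes "1 \<le> d"
  shows "split_coeff 1 = (\<theta>s 0 - \<theta>s 1) * (a 0 - \<theta> 0)"
    and "split_coeff 1 = (\<theta> 0 - \<theta> 1) * (as 0 - \<theta>s 0)"
    and "split_coeff d = (\<theta>s d - \<theta>s (d - 1)) * (a d - \<theta> d)"
    and "split_coeff d = (\<theta> d - \<theta> (d - 1)) * (as d - \<theta>s d)"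
proof -
  show "split_coeff 1 = (\<theta>s 0 - \<theta>s 1) * (a 0 - \<theta> 0)"
    by (simp add: split_coeff_def)
  show "split_coeff 1 = (\<theta> 0 - \<theta> 1) * (as 0 - \<theta>s 0)"
    using split_coeff_dual[of 1] assms by simp
  have "{..d} = insert d {..<d}" by auto
  then have a_sum: "(\<Sum>h<d. a h - \<theta> h) = \<theta> d - a d" and as_sum: "(\<Sum>h<d. as h - \<theta>s h) = \<theta>s d - as d"
    using sum_a sum_as by (simp_all add: sum_subtractf algebra_simps)
  show "split_coeff d = (\<theta>s d - \<theta>s (d - 1)) * (a d - \<theta> d)"
    by (simp add: split_coeff_def a_sum algebra_simps)
  have "split_coeff d = (\<theta> (d - 1) - \<theta> d) * (\<theta>s d - as d)"
    using split_coeff_dual[of d] assms as_sum by simp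
  then show "split_coeff d = (\<theta> d - \<theta> (d - 1)) * (as d - \<theta>s d)"
    by (simp add: algebra_simps)
qed

text \<open>
  The split coefficients for the reversed order of \<open>w\<close>; this is the second split sequence of the
  parameter array.
\<close>

definition rev_split_coeff :: "nat \<Rightarrow> 'k" where
  "rev_split_coeff i = (\<theta>s (i - 1) - \<theta>s i) * (\<Sum>h<i. a h - \<theta> (d - h))"

lemma end_rev_split_coeffs:
  assumes "1 \<le> d"
  shows "rev_split_coeff 1 = (\<theta>s 0 - \<theta>s 1) * (a 0 - \<theta> d)"
    and "rev_split_coeff 1 = (\<theta> d - \<theta> (d - 1)) * (as d - \<theta>s 0)"
    and "rev_split_coeff d = (\<theta>s d - \<theta>s (d - 1)) * (a d - \<theta> 0)"
    and "rev_split_coeff d = (\<theta> 0 - \<theta> 1) * (as 0 - \<theta>s d)"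
proof -
  interpret R: leonard_bases scale d v vc A As \<theta>s "\<lambda>i. w (d - i)" "\<lambda>i. wc (d - i)" "\<lambda>i. \<theta> (d - i)"
    by (rule reversed)
  have "R.split_coeff = rev_split_coeff"
    by (rule ext) (simp add: R.split_coeff_def rev_split_coeff_def)
  moreover have "R.as i = as (d - i)" for i
    by (simp add: R.wside.a_def wside.a_def)
  ultimately show "rev_split_coeff 1 = (\<theta>s 0 - \<theta>s 1) * (a 0 - \<theta> d)"
    "rev_split_coeff 1 = (\<theta> d - \<theta> (d - 1)) * (as d - \<theta>s 0)"
    "rev_split_coeff d = (\<theta>s d - \<theta>s (d - 1)) * (a d - \<theta> 0)"
    "rev_split_coeff d = (\<theta> 0 - \<theta> 1) * (as 0 - \<theta>s d)"
    using R.end_split_coeffs[OF assms] assms by auto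
qed

text \<open>
  The differences of both end values of \<open>rev_split_coeff\<close> from \<open>split_coeff 1\<close> only involve
  eigenvalues; equality of the end values is exactly the collinearity of the points with indices
  \<open>0\<close>, \<open>1\<close> and \<open>d\<close>.
\<close>

lemma affine_of_rev_split_coeff:
  assumes "1 \<le> d" "rev_split_coeff 1 = rev_split_coeff d" "i \<le> d"
  shows "\<theta>s i = \<theta>s 0 + (\<theta>s d - \<theta>s 0) / (\<theta> d - \<theta> 0) * (\<theta> i - \<theta> 0)"
proof -
  obtain \<beta> \<gamma> \<gamma>s where
    rec: "\<And>i. 1 \<le> i \<Longrightarrow> i < d \<Longrightarrow> \<theta> (i - 1) - \<beta> * \<theta> i + \<theta> (i + 1) = \<gamma>"
    "\<And>i. 1 \<le> i \<Longrightarrow> i < d \<Longrightarrow> \<theta>s (i - 1) - \<beta> * \<theta>s i + \<theta>s (i + 1) = \<gamma>s"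
    using eigenvalue_recurrence by blast
  have "(\<theta>s 0 - \<theta>s 1) * (\<theta> 0 - \<theta> d)
      = (\<theta>s 0 - \<theta>s 1) * (a 0 - \<theta> d) - (\<theta>s 0 - \<theta>s 1) * (a 0 - \<theta> 0)"
    by (simp add: algebra_simps)
  also have "\<dots> = rev_split_coeff d - split_coeff 1"
    using assms end_split_coeffs end_rev_split_coeffs by simp
  also have "\<dots> = (\<theta> 0 - \<theta> 1) * (as 0 - \<theta>s d) - (\<theta> 0 - \<theta> 1) * (as 0 - \<theta>s 0)"
    using assms end_split_coeffs end_rev_split_coeffs by simp
  also have "\<dots> = (\<theta> 0 - \<theta> 1) * (\<theta>s 0 - \<theta>s d)"
    by (simp add: algebra_simps)
  finally show ?thesis
    using collinear_recurrent_sequences[OF assms(1) wside.inj_\<theta>s rec] assms by blast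
qed

lemma duality_map_same_order:
  assumes "1 \<le> d" "rev_split_coeff 1 = rev_split_coeff d"
    and \<xi>: "\<xi> = (\<theta>s d - \<theta>s 0) * inverse (\<theta> d - \<theta> 0)" and \<zeta>: "\<zeta> = \<theta>s 0 - \<xi> * \<theta> 0"
    and \<xi>s: "\<xi>s = inverse \<xi>" and \<zeta>s: "\<zeta>s = \<theta> 0 - \<xi>s * \<theta>s 0"
  shows "\<exists>P. affine_swap \<xi> \<zeta> \<xi>s \<zeta>s P"
proof -
  have "\<theta> d \<noteq> \<theta> 0" "\<theta>s d \<noteq> \<theta>s 0"
    using wside.\<theta>s_distinct[of d 0] vside.\<theta>s_distinct[of d 0] assms(1) by auto
  then have "\<xi> \<noteq> 0" by (simp add: \<xi>)
  have aff: "\<theta>s i = \<xi> * \<theta> i + \<zeta>" if "i \<le> d" for i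
    using affine_of_rev_split_coeff[OF assms(1,2) that]
    by (simp add: \<zeta> \<xi> divide_inverse algebra_simps)
  show ?thesis
  proof (rule self_dual_map[OF leonard_bases_axioms _ aff \<open>\<xi> \<noteq> 0\<close> _ _])
    show "\<theta> i = \<xi>s * \<theta>s i + \<zeta>s" if "i \<le> d" for i
      using aff[OF that] aff[of 0] \<open>\<xi> \<noteq> 0\<close> by (simp add: \<xi>s \<zeta>s field_simps)
    show "split_coeff i = \<xi> * \<xi>s * ((\<theta>s (i - 1) - \<theta>s i) * (\<Sum>h<i. a h - \<theta> h))" for i
      using \<open>\<xi> \<noteq> 0\<close> by (simp add: split_coeff_def \<xi>s)
  qed (use \<open>\<xi> \<noteq> 0\<close> in \<open>simp_all add: \<xi>s\<close>)
qed

text \<open>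
  The hypotheses contain those of \<open>affine_of_rev_split_coeff\<close> for \<open>w\<close> in both orders. So \<open>\<theta>s\<close> is an affine
  function of \<open>\<theta>\<close> and of the reversed \<open>\<theta>\<close>, and consequently \<open>\<theta>\<close> is symmetric about a midpoint. The
  remaining equations place \<open>a 0\<close> and \<open>a d\<close> at this midpoint, \<open>constant_diagonal\<close> does the same for all
  \<open>a i\<close>, and then the two split sequences are opposite.
\<close>

lemma duality_map_reversed_order:
  assumes "1 \<le> d"
    and ends: "split_coeff 1 = split_coeff d" "split_coeff d = - rev_split_coeff 1"
      "- rev_split_coeff 1 = - rev_split_coeff d"
    and \<xi>: "\<xi> = (\<theta>s 0 - \<theta>s d) * inverse (\<theta> d - \<theta> 0)" and \<zeta>: "\<zeta> = \<theta>s d - \<xi> * \<theta> 0"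
    and \<xi>s: "\<xi>s = - inverse \<xi>" and \<zeta>s: "\<zeta>s = \<theta> 0 - \<xi>s * \<theta>s 0"
  shows "\<exists>P. affine_swap \<xi> \<zeta> \<xi>s \<zeta>s P"
proof -
  interpret R: leonard_bases scale d v vc A As \<theta>s "\<lambda>i. w (d - i)" "\<lambda>i. wc (d - i)" "\<lambda>i. \<theta> (d - i)"
    by (rule reversed)
  have R_coeff: "R.rev_split_coeff i = split_coeff i" if "i \<le> d" for i
    unfolding R.rev_split_coeff_def split_coeff_def using that
    by (intro arg_cong2[of _ _ _ _ "(*)"] sum.cong) auto
  have ne: "\<theta> d \<noteq> \<theta> 0" "\<theta>s d \<noteq> \<theta>s 0"
    using wside.\<theta>s_distinct[of d 0] vside.\<theta>s_distinct[of d 0] assms(1) by auto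
  then have "\<xi> \<noteq> 0" by (simp add: \<xi>)
  have slope: "(\<theta>s d - \<theta>s 0) / (\<theta> d - \<theta> 0) = - \<xi>" "(\<theta>s d - \<theta>s 0) / (\<theta> 0 - \<theta> d) = \<xi>"
    using ne by (auto simp: \<xi> field_simps)
  have aff: "\<theta>s i = \<theta>s 0 - \<xi> * (\<theta> i - \<theta> 0)" if "i \<le> d" for i
    using affine_of_rev_split_coeff[OF assms(1) _ that] ends slope by simp
  have aff_rev: "\<theta>s i = \<theta>s 0 + \<xi> * (\<theta> (d - i) - \<theta> d)" if "i \<le> d" for i
    using R.affine_of_rev_split_coeff[OF assms(1) _ that] R_coeff assms(1) ends slope by simp
  have sym: "\<theta> i + \<theta> (d - i) = \<theta> 0 + \<theta> d" if "i \<le> d" for i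
  proof -
    have "\<xi> * (\<theta> i + \<theta> (d - i)) = \<xi> * (\<theta> 0 + \<theta> d)"
      using aff[OF that] aff_rev[OF that] by (simp add: algebra_simps)
    then show ?thesis using \<open>\<xi> \<noteq> 0\<close> by simp
  qed
  have gap: "\<theta>s 0 - \<theta>s 1 \<noteq> 0" "\<theta>s d - \<theta>s (d - 1) \<noteq> 0"
    using vside.\<theta>s_distinct[of 0 1] vside.\<theta>s_distinct[of d "d - 1"] assms(1) by auto
  have "(\<theta>s 0 - \<theta>s 1) * (2 * a 0 - (\<theta> 0 + \<theta> d)) = split_coeff 1 + rev_split_coeff 1"
    unfolding end_split_coeffs(1)[OF assms(1)] end_rev_split_coeffs(1)[OF assms(1)]
    by (simp add: algebra_simps)
  also have "\<dots> = 0"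
    using ends by simp
  finally have a0: "2 * a 0 = \<theta> 0 + \<theta> d"
    using gap by simp
  have "(\<theta>s d - \<theta>s (d - 1)) * (2 * a d - (\<theta> 0 + \<theta> d)) = split_coeff d + rev_split_coeff d"
    unfolding end_split_coeffs(3)[OF assms(1)] end_rev_split_coeffs(3)[OF assms(1)]
    by (simp add: algebra_simps)
  also have "\<dots> = 0"
    using ends by simp
  finally have "2 * a d = \<theta> 0 + \<theta> d"
    using gap by simp
  then have a: "2 * a i = \<theta> 0 + \<theta> d" if "i \<le> d" for i
    using constant_diagonal[OF assms(1) sym a0] that by blast
  have sum_zero: "(\<Sum>h<i. a h - \<theta> h) + (\<Sum>h<i. a h - \<theta> (d - h)) = 0" if "i \<le> d" for i
    unfolding sum.distrib[symmetric]
  proof (intro sum.neutral ballI)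
    fix h assume "h \<in> {..<i}"
    then have "2 * a h = \<theta> h + \<theta> (d - h)"
      using a[of h] sym[of h] that by simp
    then show "a h - \<theta> h + (a h - \<theta> (d - h)) = 0"
      by (simp add: algebra_simps)
  qed
  show ?thesis
  proof (rule self_dual_map[OF R.leonard_bases_axioms _ _ \<open>\<xi> \<noteq> 0\<close> _ _])
    show "\<theta> i = \<xi>s * \<theta>s i + \<zeta>s" if "i \<le> d" for i
    proof -
      have "\<theta> i - \<theta> 0 = inverse \<xi> * (\<theta>s 0 - \<theta>s i)"
        using \<open>\<xi> \<noteq> 0\<close> by (simp add: aff[OF that])
      then show ?thesis by (simp add: \<xi>s \<zeta>s algebra_simps)
    qed
    show "\<theta>s i = \<xi> * \<theta> (d - i) + \<zeta>" if "i \<le> d" for i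
    proof -
      have last: "\<theta>s d = \<theta>s 0 + \<xi> * (\<theta> 0 - \<theta> d)"
        using aff_rev[of d] by simp
      show ?thesis
        unfolding \<zeta> last aff_rev[OF that] by (simp add: algebra_simps)
    qed
    show "split_coeff i = \<xi> * \<xi>s * ((\<theta>s (i - 1) - \<theta>s i) * (\<Sum>h<i. a h - \<theta> (d - h)))"
      if "i \<in> {1..d}" for i
    proof -
      have "(\<Sum>h<i. a h - \<theta> h) = - (\<Sum>h<i. a h - \<theta> (d - h))"
        using sum_zero[of i] that by (simp add: eq_neg_iff_add_eq_0)
      then show ?thesis
        using \<open>\<xi> \<noteq> 0\<close> by (simp add: split_coeff_def \<xi>s)
    qed
  qed (use \<open>\<xi> \<noteq> 0\<close> in \<open>simp_all add: \<xi>s\<close>)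
qed

text \<open>
  The four cases, named after the eigenbases whose order is reversed by the duality: \<open>E\<close> refers to
  the basis \<open>w\<close> and \<open>Es\<close> to the basis \<open>v\<close>.
\<close>

definition keep_case :: "'k \<Rightarrow> 'k \<Rightarrow> 'k \<Rightarrow> 'k \<Rightarrow> bool" where
  "keep_case \<xi> \<zeta> \<xi>s \<zeta>s \<longleftrightarrow> rev_split_coeff 1 = rev_split_coeff d \<and>
     \<xi> = (\<theta>s d - \<theta>s 0) * inverse (\<theta> d - \<theta> 0) \<and> \<zeta> = \<theta>s 0 - \<xi> * \<theta> 0 \<and>
     \<xi>s = inverse \<xi> \<and> \<zeta>s = \<theta> 0 - \<xi>s * \<theta>s 0"

definition rev_E_case :: "'k \<Rightarrow> 'k \<Rightarrow> 'k \<Rightarrow> 'k \<Rightarrow> bool" where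
  "rev_E_case \<xi> \<zeta> \<xi>s \<zeta>s \<longleftrightarrow> split_coeff 1 = split_coeff d \<and> split_coeff d = - rev_split_coeff 1 \<and>
     - rev_split_coeff 1 = - rev_split_coeff d \<and>
     \<xi> = (\<theta>s 0 - \<theta>s d) * inverse (\<theta> d - \<theta> 0) \<and> \<zeta> = \<theta>s d - \<xi> * \<theta> 0 \<and>
     \<xi>s = - inverse \<xi> \<and> \<zeta>s = \<theta> 0 - \<xi>s * \<theta>s 0"

definition rev_Es_case :: "'k \<Rightarrow> 'k \<Rightarrow> 'k \<Rightarrow> 'k \<Rightarrow> bool" where
  "rev_Es_case \<xi> \<zeta> \<xi>s \<zeta>s \<longleftrightarrow> split_coeff 1 = split_coeff d \<and> split_coeff d = - rev_split_coeff 1 \<and>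
     - rev_split_coeff 1 = - rev_split_coeff d \<and>
     \<xi> = (\<theta>s d - \<theta>s 0) * inverse (\<theta> d - \<theta> 0) \<and> \<zeta> = \<theta>s 0 - \<xi> * \<theta> 0 \<and>
     \<xi>s = - inverse \<xi> \<and> \<zeta>s = \<theta> 0 - \<xi>s * \<theta>s d"

definition rev_both_case :: "'k \<Rightarrow> 'k \<Rightarrow> 'k \<Rightarrow> 'k \<Rightarrow> bool" where
  "rev_both_case \<xi> \<zeta> \<xi>s \<zeta>s \<longleftrightarrow> split_coeff 1 = split_coeff d \<and>
     \<xi> = (\<theta>s 0 - \<theta>s d) * inverse (\<theta> d - \<theta> 0) \<and> \<zeta> = \<theta>s d - \<xi> * \<theta> 0 \<and>
     \<xi>s = inverse \<xi> \<and> \<zeta>s = \<theta> 0 - \<xi>s * \<theta>s d"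

text \<open>
  Reversing the order of \<open>w\<close> exchanges the two split sequences, and it exchanges \<open>keep_case\<close> with
  \<open>rev_both_case\<close> and \<open>rev_E_case\<close> with \<open>rev_Es_case\<close>.
\<close>

lemma duality_map_exists:
  assumes "1 \<le> d"
    and "keep_case \<xi> \<zeta> \<xi>s \<zeta>s \<or> rev_E_case \<xi> \<zeta> \<xi>s \<zeta>s \<or>
      rev_Es_case \<xi> \<zeta> \<xi>s \<zeta>s \<or> rev_both_case \<xi> \<zeta> \<xi>s \<zeta>s"
  shows "\<exists>P. affine_swap \<xi> \<zeta> \<xi>s \<zeta>s P"
proof -
  interpret R: leonard_bases scale d v vc A As \<theta>s "\<lambda>i. w (d - i)" "\<lambda>i. wc (d - i)" "\<lambda>i. \<theta> (d - i)"
    by (rule reversed)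
  have R_rev: "R.rev_split_coeff i = split_coeff i" if "i \<le> d" for i
    unfolding R.rev_split_coeff_def split_coeff_def using that
    by (intro arg_cong2[of _ _ _ _ "(*)"] sum.cong) auto
  have R_split: "R.split_coeff i = rev_split_coeff i" for i
    by (simp add: R.split_coeff_def rev_split_coeff_def)
  have ne: "\<theta> d - \<theta> 0 \<noteq> 0" "\<theta>s d - \<theta>s 0 \<noteq> 0"
    using wside.\<theta>s_distinct[of d 0] vside.\<theta>s_distinct[of d 0] assms(1) by auto
  have inv: "inverse (\<theta> d - \<theta> 0) = - inverse (\<theta> 0 - \<theta> d)"
    by (metis inverse_minus_eq minus_diff_eq)
  consider "keep_case \<xi> \<zeta> \<xi>s \<zeta>s" | "rev_E_case \<xi> \<zeta> \<xi>s \<zeta>s" 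
    | "rev_Es_case \<xi> \<zeta> \<xi>s \<zeta>s" | "rev_both_case \<xi> \<zeta> \<xi>s \<zeta>s"
    using assms(2) by blast
  then show ?thesis
  proof cases
    case 1
    then show ?thesis
      unfolding keep_case_def using duality_map_same_order[OF assms(1)] by blast
  next
    case 2
    then show ?thesis
      unfolding rev_E_case_def using duality_map_reversed_order[OF assms(1)] by blast
  next
    case 3
    note 3 = 3[unfolded rev_Es_case_def]
    then have "\<xi> * (\<theta> d - \<theta> 0) = \<theta>s d - \<theta>s 0" and "\<xi> \<noteq> 0"
      using ne by auto
    then have step: "inverse \<xi> * (\<theta>s d - \<theta>s 0) = \<theta> d - \<theta> 0"
      by (metis mult.commute mult.left_commute right_inverse mult_1)
    show ?thesis
    proof (rule R.duality_map_reversed_order[OF assms(1)])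
      show "\<xi> = (\<theta>s 0 - \<theta>s d) * inverse (\<theta> (d - d) - \<theta> (d - 0))"
        using 3 by (simp add: inv algebra_simps)
      show "\<zeta> = \<theta>s d - \<xi> * \<theta> (d - 0)"
      proof -
        have "\<xi> * \<theta> d = \<xi> * \<theta> 0 + (\<theta>s d - \<theta>s 0)"
          using \<open>\<xi> * (\<theta> d - \<theta> 0) = \<theta>s d - \<theta>s 0\<close> by (simp add: algebra_simps)
        then show ?thesis using 3 by simp
      qed
      show "\<zeta>s = \<theta> (d - 0) - \<xi>s * \<theta>s 0"
      proof -
        have "inverse \<xi> * \<theta>s d = inverse \<xi> * \<theta>s 0 + (\<theta> d - \<theta> 0)"
          using step by (simp add: algebra_simps)
        then show ?thesis using 3 by simp
      qed
    qed (use 3 assms(1) in \<open>simp_all add: R_rev R_split\<close>)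
  next
    case 4
    note 4 = 4[unfolded rev_both_case_def]
    then have "\<xi> * (\<theta> d - \<theta> 0) = \<theta>s 0 - \<theta>s d" and "\<xi> \<noteq> 0"
      using ne by auto
    then have step: "inverse \<xi> * (\<theta>s 0 - \<theta>s d) = \<theta> d - \<theta> 0"
      by (metis mult.commute mult.left_commute right_inverse mult_1)
    show ?thesis
    proof (rule R.duality_map_same_order[OF assms(1)])
      show "\<xi> = (\<theta>s d - \<theta>s 0) * inverse (\<theta> (d - d) - \<theta> (d - 0))"
        using 4 by (simp add: inv algebra_simps)
      show "\<zeta> = \<theta>s 0 - \<xi> * \<theta> (d - 0)"
      proof -
        have "\<xi> * \<theta> d = \<xi> * \<theta> 0 + (\<theta>s 0 - \<theta>s d)"
          using \<open>\<xi> * (\<theta> d - \<theta> 0) = \<theta>s 0 - \<theta>s d\<close> by (simp add: algebra_simps)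
        then show ?thesis using 4 by simp
      qed
      show "\<zeta>s = \<theta> (d - 0) - \<xi>s * \<theta>s 0"
      proof -
        have "inverse \<xi> * \<theta>s 0 = inverse \<xi> * \<theta>s d + (\<theta> d - \<theta> 0)"
          using step by (simp add: algebra_simps)
        then show ?thesis using 4 by simp
      qed
    qed (use 4 assms(1) in \<open>simp_all add: R_rev R_split\<close>)
  qed
qed

text \<open>
  Here \<open>\<sigma>\<close> and \<open>\<tau>\<close> are the permutations of the indices induced by a duality. The end values of
  the split sequences have one expression through \<open>a\<close> and one through \<open>as\<close>, and the duality turns one into the
  other; the product \<open>\<xi> \<xi>s\<close> is \<open>1\<close> if both orders are treated alike and \<open>-1\<close> otherwise.
\<close>

lemma affine_swap_conditions:
  assumes "1 \<le> d"
    and \<sigma>: "(\<forall>i\<le>d. \<sigma> i = i) \<or> (\<forall>i\<le>d. \<sigma> i = d - i)"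
    and \<tau>: "(\<forall>i\<le>d. \<tau> i = i) \<or> (\<forall>i\<le>d. \<tau> i = d - i)"
    and \<theta>s: "\<And>i. i \<le> d \<Longrightarrow> \<theta>s i = \<xi> * \<theta> (\<sigma> i) + \<zeta>"
    and \<theta>: "\<And>i. i \<le> d \<Longrightarrow> \<theta> i = \<xi>s * \<theta>s (\<tau> i) + \<zeta>s"
    and a: "\<And>i. i \<le> d \<Longrightarrow> a i = \<xi>s * as (\<sigma> i) + \<zeta>s"
    and as: "\<And>i. i \<le> d \<Longrightarrow> as i = \<xi> * a (\<tau> i) + \<zeta>"
  shows "keep_case \<xi> \<zeta> \<xi>s \<zeta>s \<or> rev_E_case \<xi> \<zeta> \<xi>s \<zeta>s \<or>
      rev_Es_case \<xi> \<zeta> \<xi>s \<zeta>s \<or> rev_both_case \<xi> \<zeta> \<xi>s \<zeta>s"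
proof -
  note sp = end_split_coeffs[OF assms(1)] and rsp = end_rev_split_coeffs[OF assms(1)]
  have ne: "\<theta> d - \<theta> 0 \<noteq> 0"
    using wside.\<theta>s_distinct[of d 0] assms(1) by auto
  have slope: "\<xi> = t * inverse (\<theta> d - \<theta> 0)" if "t = \<xi> * (\<theta> d - \<theta> 0)" for t
    using ne that by simp
  have cancel: "\<xi>s = c * inverse \<xi>" if "\<theta> d - \<theta> 0 = \<xi>s * \<xi> * (c * (\<theta> d - \<theta> 0))" "c * c = 1" for c
  proof -
    have "\<xi>s * \<xi> * c = 1"
      using that(1) ne by (metis mult.assoc mult_cancel_right1)
    moreover have "\<xi> \<noteq> 0"
      using calculation by auto
    ultimately show ?thesis
      using that(2) by (metis (no_types, opaque_lifting) mult.assoc mult.commute mult_1 right_inverse)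
  qed
  have prod: "\<xi> * \<xi>s = c" if "\<xi>s = c * inverse \<xi>" "c * c = 1" for c
  proof -
    have "\<xi> \<noteq> 0"
    proof
      assume "\<xi> = 0"
      then have "\<theta> d = \<theta> 0" using that \<theta>[of d] \<theta>[of 0] by simp
      then show False using ne by simp
    qed
    then show ?thesis using that by simp
  qed
  consider (ii) "\<forall>i\<le>d. \<sigma> i = i" "\<forall>i\<le>d. \<tau> i = i" | (ri) "\<forall>i\<le>d. \<sigma> i = d - i" "\<forall>i\<le>d. \<tau> i = i"
    | (ir) "\<forall>i\<le>d. \<sigma> i = i" "\<forall>i\<le>d. \<tau> i = d - i" | (rr) "\<forall>i\<le>d. \<sigma> i = d - i" "\<forall>i\<le>d. \<tau> i = d - i"
    using \<sigma> \<tau> by blast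
  then show ?thesis
  proof cases
    case ii
    have s: "\<theta>s i = \<xi> * \<theta> i + \<zeta>" and t: "\<theta> i = \<xi>s * \<theta>s i + \<zeta>s"
      and as': "as i = \<xi> * a i + \<zeta>" if "i \<le> d" for i
      using \<theta>s[OF that] \<theta>[OF that] as[OF that] ii that by auto
    have "\<theta> d - \<theta> 0 = \<xi>s * (\<theta>s d - \<theta>s 0)"
      using t[of d] t[of 0] by (simp add: algebra_simps)
    also have "\<theta>s d - \<theta>s 0 = \<xi> * (\<theta> d - \<theta> 0)"
      using s[of d] s[of 0] by (simp add: algebra_simps)
    finally have \<xi>s: "\<xi>s = inverse \<xi>"
      using cancel[of 1] by (simp add: mult.assoc)
    have "rev_split_coeff 1 = (\<xi> * (\<theta> 0 - \<theta> 1)) * (a 0 - \<theta> d)"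
      unfolding rsp(1) using s[of 0] s[of 1] assms(1) by (simp add: algebra_simps)
    also have "\<dots> = (\<theta> 0 - \<theta> 1) * (\<xi> * (a 0 - \<theta> d))"
      by simp
    also have "\<xi> * (a 0 - \<theta> d) = as 0 - \<theta>s d"
      using s[of d] as'[of 0] by (simp add: algebra_simps)
    finally have "rev_split_coeff 1 = rev_split_coeff d"
      by (simp only: rsp(4))
    moreover have "\<xi> = (\<theta>s d - \<theta>s 0) * inverse (\<theta> d - \<theta> 0)"
      using s[of d] s[of 0] by (intro slope) (simp add: algebra_simps)
    moreover have "\<zeta> = \<theta>s 0 - \<xi> * \<theta> 0" "\<zeta>s = \<theta> 0 - \<xi>s * \<theta>s 0"
      using s[of 0] t[of 0] by (auto simp: algebra_simps)
    ultimately show ?thesis using \<xi>s unfolding keep_case_def by blast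
  next
    case ri
    have s: "\<theta>s i = \<xi> * \<theta> (d - i) + \<zeta>" and t: "\<theta> i = \<xi>s * \<theta>s i + \<zeta>s"
      and as': "as i = \<xi> * a i + \<zeta>" if "i \<le> d" for i
      using \<theta>s[OF that] \<theta>[OF that] as[OF that] ri that by auto
    have s0: "\<theta>s 0 = \<xi> * \<theta> d + \<zeta>" and sd: "\<theta>s d = \<xi> * \<theta> 0 + \<zeta>"
      using s[of 0] s[of d] by auto
    have "\<theta> d - \<theta> 0 = \<xi>s * (\<theta>s d - \<theta>s 0)"
      using t[of d] t[of 0] by (simp add: algebra_simps)
    also have "\<theta>s d - \<theta>s 0 = \<xi> * (-1 * (\<theta> d - \<theta> 0))"
      using s0 sd by (simp add: algebra_simps)
    finally have "\<theta> d - \<theta> 0 = \<xi>s * \<xi> * (-1 * (\<theta> d - \<theta> 0))"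
      by (simp only: mult.assoc)
    then have \<xi>s: "\<xi>s = -1 * inverse \<xi>"
      by (rule cancel) simp
    have prod': "\<xi> * \<xi>s = -1"
      using prod[OF \<xi>s] by simp
    have t_top: "\<theta> d - \<theta> (d - 1) = \<xi>s * (\<theta>s d - \<theta>s (d - 1))"
      using t[of d] t[of "d - 1"] by (simp add: algebra_simps)
    have "\<theta> 0 - \<theta> 1 = \<xi>s * (\<theta>s 0 - \<theta>s 1)" "as 0 - \<theta>s 0 = \<xi> * (a 0 - \<theta> d)"
      using t[of 0] t[of 1] assms(1) s0 as'[of 0] by (simp_all add: algebra_simps)
    then have c1: "split_coeff 1 = (\<xi> * \<xi>s) * rev_split_coeff 1"
      unfolding sp(2) rsp(1) by simp
    have "as d - \<theta>s d = \<xi> * (a d - \<theta> 0)"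
      using sd as'[of d] by (simp add: algebra_simps)
    then have c2: "split_coeff d = (\<xi> * \<xi>s) * rev_split_coeff d"
      unfolding sp(4) rsp(3) t_top by simp
    have "as d - \<theta>s 0 = \<xi> * (a d - \<theta> d)"
      using s0 as'[of d] by (simp add: algebra_simps)
    then have c3: "rev_split_coeff 1 = (\<xi> * \<xi>s) * split_coeff d"
      unfolding sp(3) rsp(2) t_top by simp
    have "\<xi> = (\<theta>s 0 - \<theta>s d) * inverse (\<theta> d - \<theta> 0)"
      using s0 sd by (intro slope) (simp add: algebra_simps)
    moreover have "\<zeta> = \<theta>s d - \<xi> * \<theta> 0" "\<zeta>s = \<theta> 0 - \<xi>s * \<theta>s 0"
      using sd t[of 0] by (auto simp: algebra_simps)
    moreover have "\<xi>s = - inverse \<xi>"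
      using \<xi>s by simp
    moreover have "split_coeff 1 = split_coeff d" "split_coeff d = - rev_split_coeff 1"
        "- rev_split_coeff 1 = - rev_split_coeff d"
      using c1 c2 c3 prod' by auto
    ultimately show ?thesis unfolding rev_E_case_def by blast
  next
    case ir
    have s: "\<theta>s i = \<xi> * \<theta> i + \<zeta>" and t: "\<theta> i = \<xi>s * \<theta>s (d - i) + \<zeta>s"
      and a': "a i = \<xi>s * as i + \<zeta>s" if "i \<le> d" for i
      using \<theta>s[OF that] \<theta>[OF that] a[OF that] ir that by auto
    have t0: "\<theta> 0 = \<xi>s * \<theta>s d + \<zeta>s" and td: "\<theta> d = \<xi>s * \<theta>s 0 + \<zeta>s"
      using t[of 0] t[of d] by auto
    have "\<theta> d - \<theta> 0 = \<xi>s * (\<theta>s 0 - \<theta>s d)"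
      using t0 td by (simp add: algebra_simps)
    also have "\<theta>s 0 - \<theta>s d = \<xi> * (-1 * (\<theta> d - \<theta> 0))"
      using s[of 0] s[of d] by (simp add: algebra_simps)
    finally have "\<theta> d - \<theta> 0 = \<xi>s * \<xi> * (-1 * (\<theta> d - \<theta> 0))"
      by (simp only: mult.assoc)
    then have \<xi>s: "\<xi>s = -1 * inverse \<xi>"
      by (rule cancel) simp
    have prod': "\<xi> * \<xi>s = -1"
      using prod[OF \<xi>s] by simp
    have s_bot: "\<theta>s 0 - \<theta>s 1 = \<xi> * (\<theta> 0 - \<theta> 1)"
      using s[of 0] s[of 1] assms(1) by (simp add: algebra_simps)
    have "a 0 - \<theta> 0 = \<xi>s * (as 0 - \<theta>s d)"
      using t0 a'[of 0] by (simp add: algebra_simps)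
    then have c1: "split_coeff 1 = (\<xi> * \<xi>s) * rev_split_coeff d"
      unfolding sp(1) rsp(4) s_bot by simp
    have "\<theta>s d - \<theta>s (d - 1) = \<xi> * (\<theta> d - \<theta> (d - 1))" "a d - \<theta> d = \<xi>s * (as d - \<theta>s 0)"
      using s[of d] s[of "d - 1"] td a'[of d] by (simp_all add: algebra_simps)
    then have c2: "split_coeff d = (\<xi> * \<xi>s) * rev_split_coeff 1"
      unfolding sp(3) rsp(2) by simp
    have "a 0 - \<theta> d = \<xi>s * (as 0 - \<theta>s 0)"
      using td a'[of 0] by (simp add: algebra_simps)
    then have c3: "rev_split_coeff 1 = (\<xi> * \<xi>s) * split_coeff 1"
      unfolding sp(2) rsp(1) s_bot by simp
    have "\<xi> = (\<theta>s d - \<theta>s 0) * inverse (\<theta> d - \<theta> 0)"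
      using s[of d] s[of 0] by (intro slope) (simp add: algebra_simps)
    moreover have "\<zeta> = \<theta>s 0 - \<xi> * \<theta> 0" "\<zeta>s = \<theta> 0 - \<xi>s * \<theta>s d"
      using s[of 0] t0 by (auto simp: algebra_simps)
    moreover have "\<xi>s = - inverse \<xi>"
      using \<xi>s by simp
    moreover have "split_coeff 1 = split_coeff d" "split_coeff d = - rev_split_coeff 1"
        "- rev_split_coeff 1 = - rev_split_coeff d"
      using c1 c2 c3 prod' by auto
    ultimately show ?thesis unfolding rev_Es_case_def by blast
  next
    case rr
    have s: "\<theta>s i = \<xi> * \<theta> (d - i) + \<zeta>" and t: "\<theta> i = \<xi>s * \<theta>s (d - i) + \<zeta>s"
      and as': "as i = \<xi> * a (d - i) + \<zeta>" if "i \<le> d" for i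
      using \<theta>s[OF that] \<theta>[OF that] as[OF that] rr that by auto
    have s0: "\<theta>s 0 = \<xi> * \<theta> d + \<zeta>" and sd: "\<theta>s d = \<xi> * \<theta> 0 + \<zeta>"
      and t0: "\<theta> 0 = \<xi>s * \<theta>s d + \<zeta>s" and td: "\<theta> d = \<xi>s * \<theta>s 0 + \<zeta>s"
      using s[of 0] s[of d] t[of 0] t[of d] by auto
    have "\<theta> d - \<theta> 0 = \<xi>s * (\<theta>s 0 - \<theta>s d)"
      using t0 td by (simp add: algebra_simps)
    also have "\<theta>s 0 - \<theta>s d = \<xi> * (\<theta> d - \<theta> 0)"
      using s0 sd by (simp add: algebra_simps)
    finally have \<xi>s: "\<xi>s = inverse \<xi>"
      using cancel[of 1] by (simp add: mult.assoc)
    have prod': "\<xi> * \<xi>s = 1"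
      using prod[of 1] \<xi>s by simp
    have "\<theta> 0 - \<theta> 1 = \<xi>s * (\<theta>s d - \<theta>s (d - 1))" "as 0 - \<theta>s 0 = \<xi> * (a d - \<theta> d)"
      using t0 t[of 1] assms(1) s0 as'[of 0] by (simp_all add: algebra_simps)
    then have "split_coeff 1 = (\<xi> * \<xi>s) * split_coeff d"
      unfolding sp(2) sp(3) by simp
    then have "split_coeff 1 = split_coeff d"
      using prod' by simp
    moreover have "\<xi> = (\<theta>s 0 - \<theta>s d) * inverse (\<theta> d - \<theta> 0)"
      using s0 sd by (intro slope) (simp add: algebra_simps)
    moreover have "\<zeta> = \<theta>s d - \<xi> * \<theta> 0" "\<zeta>s = \<theta> 0 - \<xi>s * \<theta>s d"
      using sd t0 by (auto simp: algebra_simps)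
    ultimately show ?thesis using \<xi>s unfolding rev_both_case_def by blast
  qed
qed

end

section \<open>The algebra and its module\<close>

lemma trace_coordinate_free:
  fixes scale :: "'k::field \<Rightarrow> 'v::ab_group_add \<Rightarrow> 'v"
  assumes "coordinates scale d b bc" "coordinates scale d v vc"
    and add: "\<And>x y. T (x + y) = T x + T y" and scaled: "\<And>c x. T (scale c x) = scale c (T x)"
  shows "(\<Sum>i\<le>d. bc i (T (b i))) = (\<Sum>i\<le>d. vc i (T (v i)))"
proof -
  interpret B: coordinates scale d b bc by fact
  interpret V: coordinates scale d v vc by fact
  have T_sum: "T (sum g S) = (\<Sum>s\<in>S. T (g s))" for g :: "nat \<Rightarrow> 'v" and S
    by (rule B.linear_map_sum[OF add scaled])
  have "(\<Sum>i\<le>d. bc i (T (b i))) = (\<Sum>i\<le>d. bc i (T (\<Sum>j\<le>d. scale (vc j (b i)) (v j))))"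
    using V.expand by simp
  also have "\<dots> = (\<Sum>i\<le>d. \<Sum>j\<le>d. vc j (b i) * bc i (T (v j)))"
    by (simp add: T_sum scaled B.vc_linear)
  also have "\<dots> = (\<Sum>j\<le>d. \<Sum>i\<le>d. vc j (b i) * bc i (T (v j)))"
    by (rule sum.swap)
  also have "\<dots> = (\<Sum>j\<le>d. vc j (\<Sum>i\<le>d. scale (bc i (T (v j))) (b i)))"
    by (simp add: V.vc_linear mult.commute)
  also have "\<dots> = (\<Sum>j\<le>d. vc j (T (v j)))"
    using B.expand by simp
  finally show ?thesis .
qed

lemma (in vector_space) basis_coordinates:
  assumes "is_basis d scale b"
  shows "coordinates scale d b (\<lambda>i x. representation (b ` {..d}) x (b i))"
proof -
  have inj: "inj_on b {..d}" and indep: "\<not> dependent (b ` {..d})" and all: "x \<in> span (b ` {..d})" for x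
    using assms by (auto simp: is_basis_def)
  show ?thesis
  proof
    show "representation (b ` {..d}) (b j) (b i) = (if i = j then 1 else 0)" if "i \<le> d" "j \<le> d" for i j
      using that inj by (auto simp: representation_basis[OF indep] inj_on_def)
    show "x = (\<Sum>i\<le>d. scale (representation (b ` {..d}) x (b i)) (b i))" for x
      using sum_representation_eq[OF indep all, of "b ` {..d}"] by (simp add: sum.reindex[OF inj])
  qed (use all in \<open>simp_all add: representation_add[OF indep] representation_scale[OF indep]\<close>)
qed

text \<open>
  An automorphism of a path is the identity or the reversal: the first step fixes the direction, and
  injectivity forbids turning back.
\<close>

lemma path_permutation:
  fixes \<sigma> :: "nat \<Rightarrow> nat"
  assumes bij: "bij_betw \<sigma> {..d} {..d}"
    and step: "\<And>i. i < d \<Longrightarrow> \<bar>int (\<sigma> (Suc i)) - int (\<sigma> i)\<bar> = 1"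
  shows "(\<forall>i\<le>d. \<sigma> i = i) \<or> (\<forall>i\<le>d. \<sigma> i = d - i)"
proof (cases "d = 0")
  case True
  then show ?thesis using bij by (auto simp: bij_betw_def)
next
  case False
  have inj: "\<sigma> i \<noteq> \<sigma> j" if "i \<le> d" "j \<le> d" "i \<noteq> j" for i j
    using bij that by (auto simp: bij_betw_def inj_on_def)
  have bound: "\<sigma> i \<le> d" if "i \<le> d" for i
    using bij that by (auto simp: bij_betw_def)
  \<comment> \<open>The common direction of all steps.\<close>
  define e where "e = int (\<sigma> 1) - int (\<sigma> 0)"
  have e: "\<bar>e\<bar> = 1"
    using step[of 0] False by (simp add: e_def)
  have line: "int (\<sigma> i) = int (\<sigma> 0) + int i * e" if "i \<le> d" for i
    using that
  proof (induction i rule: induct_nat_012)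
    case (ge2 i)
    have "\<sigma> (Suc (Suc i)) \<noteq> \<sigma> i"
      using inj ge2.prems by simp
    moreover have "\<bar>int (\<sigma> (Suc (Suc i))) - int (\<sigma> (Suc i))\<bar> = 1"
      using step[of "Suc i"] ge2.prems by simp
    ultimately have "int (\<sigma> (Suc (Suc i))) = int (\<sigma> (Suc i)) + e"
      using ge2.IH ge2.prems e by (auto simp: algebra_simps abs_if split: if_splits)
    then show ?case
      using ge2 by (simp add: algebra_simps)
  qed (auto simp: e_def)
  show ?thesis
  proof (cases "e = 1")
    case True
    then have "\<sigma> 0 = 0"
      using line[of d] bound[of d] by simp
    then show ?thesis
      using line True by auto
  next
    case False
    then have "e = -1" using e by linarith
    then have "\<sigma> 0 = d"
      using line[of d] bound[of d] bound[of 0] by simp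
    then have "\<sigma> i = d - i" if "i \<le> d" for i
      using line[OF that] \<open>e = -1\<close> that by simp
    then show ?thesis by blast
  qed
qed

lemma algebra_iso_simps:
  assumes "algebra_iso sc sc f"
  shows "f (x + y) = f x + f y" "f (x * y) = f x * f y" "f (sc c x) = sc c (f x)" "f 1 = 1"
    "inj f" "f 0 = 0"
proof -
  show "f (x + y) = f x + f y" for x y
    using assms by (simp add: algebra_iso_def)
  from this[of 0 0] show "f 0 = 0" by simp
qed (use assms in \<open>auto simp: algebra_iso_def bij_def\<close>)

context leonard_setting
begin

lemma act_zero [simp]: "act 0 x = 0" "act X 0 = 0"
proof -
  have "act 0 x + act 0 x = act 0 x"
    unfolding act_add_left[symmetric] by (simp only: add_0)
  then show "act 0 x = 0"
    by simp
  have "act X 0 + act X 0 = act X 0"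
    unfolding act_add_right[symmetric] by (simp only: add_0)
  then show "act X 0 = 0"
    by simp
qed

lemma act_uminus: "act (- X) x = - act X x"
proof -
  have "act (- X) x + act X x = 0"
    by (simp add: act_add_left[symmetric])
  then show ?thesis
    by (simp only: eq_neg_iff_add_eq_0)
qed

lemma act_diff: "act (X - Y) x = act X x - act Y x"
  using act_add_left[of X "- Y" x] by (simp add: act_uminus)

lemma act_sum: "act (sum F S) x = (\<Sum>s\<in>S. act (F s) x)"
  by (induction S rule: infinite_finite_induct) (auto simp: act_add_left)

text \<open>
  An element that acts as zero generates a two-sided ideal of such elements. If it were nonzero, then
  multiplying its matrix by matrix units on both sides and summing over the diagonal would put the identity
  into this ideal. The matrix units are transported into the ring because the matrices of a
  fixed size do not form a type.
\<close>

lemma faithful_zero: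
  assumes zero: "\<And>x. act X x = 0"
  shows "X = 0"
proof (rule ccontr)
  assume "X \<noteq> 0"
  obtain f where f: "matrix_algebra_iso (d + 1) sc f"
    using matrix_algebra by blast
  define n where "n = d + 1"
  have bij: "bij_betw f UNIV (carrier_mat n n)" and f_one: "f 1 = 1\<^sub>m n"
    and f_add: "\<And>x y. f (x + y) = f x + f y" and f_mult: "\<And>x y. f (x * y) = f x * f y"
    and f_scale: "\<And>c x. f (sc c x) = c \<cdot>\<^sub>m f x"
    using f by (auto simp: matrix_algebra_iso_def n_def)
  have carrier: "f x \<in> carrier_mat n n" for x
    using bij by (auto simp: bij_betw_def)
  have inj: "f x = f y \<Longrightarrow> x = y" for x y
    using bij by (auto simp: bij_betw_def inj_on_def)
  have "\<exists>x. f x = M" if "M \<in> carrier_mat n n" for M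
    using bij that by (metis bij_betw_imp_surj_on imageE)
  then obtain g where g: "\<And>M. M \<in> carrier_mat n n \<Longrightarrow> f (g M) = M"
    by metis
  have f_zero: "f 0 = 0\<^sub>m n n"
  proof -
    have "0 \<cdot>\<^sub>m f 0 = 0\<^sub>m n n"
      using carrier[of 0] by (intro eq_matI) auto
    then show ?thesis
      using f_scale[of 0 0] by simp
  qed
  define U where "U i k = mat n n (\<lambda>(r, s). if r = i \<and> s = k then 1 else (0::'k))" for i k
  have U: "U i k \<in> carrier_mat n n" for i k
    by (simp add: U_def)
  obtain k l where kl: "k < n" "l < n" "f X $$ (k, l) \<noteq> 0"
    using \<open>X \<noteq> 0\<close> inj[of X 0] carrier[of X] f_zero by (metis eq_matI carrier_matD index_zero_mat)
  define c where "c = f X $$ (k, l)"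
  \<comment> \<open>Up to the isomorphism \<open>f\<close>, this element is the diagonal matrix unit with index \<open>i\<close>.\<close>
  define Y where "Y i = sc (1 / c) (g (U i k) * X * g (U l i))" for i
  have left: "(U i k * M) $$ (r, s) = (if r = i then M $$ (k, s) else 0)"
    if "M \<in> carrier_mat n n" "r < n" "s < n" for M i r s
    using that kl by (simp add: U_def scalar_prod_def if_distrib[of "\<lambda>t. t * _"] cong: if_cong)
  have right: "(M * U l i) $$ (r, s) = (if s = i then M $$ (r, l) else 0)"
    if "M \<in> carrier_mat n n" "r < n" "s < n" for M i r s
    using that kl by (simp add: U_def scalar_prod_def if_distrib[of "\<lambda>t. _ * t"] cong: if_cong)
  have unit: "f (Y i) = U i i" if "i < n" for i
  proof (rule eq_matI)
    fix r s assume "r < dim_row (U i i)" "s < dim_col (U i i)"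
    then have rs: "r < n" "s < n" by (simp_all add: U_def)
    have fX: "f X \<in> carrier_mat n n" "U i k * f X \<in> carrier_mat n n"
      by (rule carrier mult_carrier_mat[OF U carrier])+
    have "f (Y i) = (1 / c) \<cdot>\<^sub>m (U i k * f X * U l i)"
      by (simp add: Y_def f_scale f_mult g U)
    then have "f (Y i) $$ (r, s) = 1 / c * (U i k * f X * U l i) $$ (r, s)"
      using rs carrier_matD[OF mult_carrier_mat[OF fX(2) U[of l i]]] by (simp add: U_def)
    also have "(U i k * f X * U l i) $$ (r, s) = (if r = i \<and> s = i then c else 0)"
      unfolding right[OF fX(2) rs] left[OF fX(1) rs(1) kl(2)] by (simp add: c_def)
    finally show "f (Y i) $$ (r, s) = U i i $$ (r, s)"
      using rs kl(3) by (simp add: U_def c_def)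
  qed (use carrier[of "Y i"] in \<open>auto simp: U_def\<close>)
  have partial: "f (\<Sum>i<m. Y i) = mat n n (\<lambda>(r, s). if r = s \<and> r < m then 1 else 0)" if "m \<le> n" for m
    using that
  proof (induction m)
    case 0
    show ?case by (auto simp: f_zero)
  next
    case (Suc m)
    then show ?case
      by (auto simp: f_add unit U_def less_Suc_eq)
  qed
  have "f (\<Sum>i<n. Y i) = f 1"
    unfolding partial[OF order.refl] f_one by auto
  then have one: "(\<Sum>i<n. Y i) = 1"
    by (rule inj)
  have "act (Y i) x = 0" for i x
    by (simp add: Y_def act_scale act_mult zero)
  then have "act (\<Sum>i<n. Y i) x = 0" for x
    by (simp add: act_sum)
  then show False
    using nontrivial by (auto simp: one act_one)
qed

lemma faithful: "(\<And>x. act X x = act Y x) \<Longrightarrow> X = Y"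
  using faithful_zero[of "X - Y"] by (simp add: act_diff)

lemma act_transitive:
  assumes "v \<noteq> 0" obtains X where "act X v = w"
proof -
  have "submodule_of act (range (\<lambda>X. act X v))"
    unfolding submodule_of_def
  proof (intro conjI ballI allI)
    show "0 \<in> range (\<lambda>X. act X v)"
      using act_zero(1)[of v] by (metis rangeI)
  next
    fix y z assume "y \<in> range (\<lambda>X. act X v)" "z \<in> range (\<lambda>X. act X v)"
    then show "y + z \<in> range (\<lambda>X. act X v)"
      by (auto simp: act_add_left[symmetric])
  next
    fix X y assume "y \<in> range (\<lambda>X. act X v)"
    then show "act X y \<in> range (\<lambda>X. act X v)"
      by (auto simp: act_mult[symmetric])
  qed
  moreover have "v \<in> range (\<lambda>X. act X v)"
    using act_one[of v] by (metis rangeI)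
  ultimately have "range (\<lambda>X. act X v) = UNIV"
    using irreducible assms by blast
  then show thesis
    using that by (metis rangeE UNIV_I)
qed

lemma act_vsc: "act X (vsc c x) = vsc c (act X x)"
proof -
  have "act X (vsc c x) = act X (act (sc c 1) x)"
    by (simp add: act_scale act_one)
  also have "\<dots> = act (sc c X) x"
    by (simp only: act_mult[symmetric] alg.scale_mult_right mult_1_right)
  also have "\<dots> = vsc c (act X x)"
    by (rule act_scale)
  finally show ?thesis .
qed

text \<open>
  By irreducibility some \<open>Y i\<close> maps \<open>v i\<close> to \<open>T (v i)\<close>; composed with the projections \<open>F i\<close> onto the
  basis lines, these elements assemble to \<open>T\<close>.
\<close>

lemma operator_represented:
  assumes "coordinates vsc d v vc"
    and F: "\<And>i x. i \<le> d \<Longrightarrow> act (F i) x = vsc (vc i x) (v i)"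
    and add: "\<And>x y. T (x + y) = T x + T y" and scale: "\<And>c x. T (vsc c x) = vsc c (T x)"
  shows "\<exists>X. \<forall>x. act X x = T x"
proof -
  interpret V: coordinates vsc d v vc by fact
  have "\<exists>X. act X (v i) = T (v i)" if "i \<le> d" for i
    using act_transitive[OF V.v_nonzero[OF that]] by blast
  then have "\<exists>Y. \<forall>i\<le>d. act (Y i) (v i) = T (v i)"
    by metis
  then obtain Y where Y: "\<And>i. i \<le> d \<Longrightarrow> act (Y i) (v i) = T (v i)" by blast
  have "act (\<Sum>i\<le>d. Y i * F i) x = T x" for x
  proof -
    have "act (\<Sum>i\<le>d. Y i * F i) x = (\<Sum>i\<le>d. vsc (vc i x) (T (v i)))"
      by (simp add: act_sum act_mult F act_vsc Y)
    also have "\<dots> = T (\<Sum>i\<le>d. vsc (vc i x) (v i))"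
      by (simp add: vs.linear_map_sum[OF add scale] scale)
    finally show ?thesis
      using V.expand[of x] by simp
  qed
  then show ?thesis by blast
qed


text \<open>
  The existence of some basis makes the arbitrary choice in the definition of the trace a legitimate
  one.
\<close>

lemma alg_trace_coordinates:
  assumes "coordinates vsc d v vc"
    and "is_basis d vsc b"
  shows "alg_trace d vsc act X = (\<Sum>i\<le>d. vc i (act X (v i)))"
proof -
  define b' where "b' = (SOME b. is_basis d vsc b)"
  have "is_basis d vsc b'"
    using someI[of "is_basis d vsc" b] assms(2) by (simp add: b'_def)
  then have b': "coordinates vsc d b' (\<lambda>i x. vs.representation (b' ` {..d}) x (b' i))"
    by (rule vs.basis_coordinates)
  have "alg_trace d vsc act X = (\<Sum>i\<le>d. vs.representation (b' ` {..d}) (act X (b' i)) (b' i))"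
    unfolding alg_trace_def b'_def[symmetric] by (intro sum.cong) (auto simp: rep_mat_def)
  also have "\<dots> = (\<Sum>i\<le>d. vc i (act X (v i)))"
    by (rule trace_coordinate_free[OF b' assms(1), where T = "act X"])
      (simp_all add: act_add_right act_vsc)
  finally show ?thesis .
qed

text \<open>
  A diagonalising basis is, up to a permutation, ordered like the given eigenvalues, and Lagrange
  interpolation shows that the primitive idempotents are the projections onto its lines.
\<close>

lemma eigenbasis:
  assumes basis: "is_basis d vsc b" and diag: "diagonal_mat (rep_mat d vsc act b X)"
    and mult_free: "multiplicity_free d vsc act X"
    and ord: "idempotent_ordering d sc vsc act X F \<eta>"
  obtains v vc where "coordinates vsc d v vc" "\<And>i. i \<le> d \<Longrightarrow> act X (v i) = vsc (\<eta> i) (v i)"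
    "\<And>i x. i \<le> d \<Longrightarrow> act (F i) x = vsc (vc i x) (v i)"
proof -
  define bc where "bc i x = vs.representation (b ` {..d}) x (b i)" for i x
  interpret B: coordinates vsc d b bc
    unfolding bc_def using basis by (rule vs.basis_coordinates)
  define ev where "ev i = bc i (act X (b i))" for i
  have off: "bc i (act X (b j)) = 0" if "i \<le> d" "j \<le> d" "i \<noteq> j" for i j
    using diag that by (auto simp: diagonal_mat_def rep_mat_def bc_def)
  have X_b: "act X (b j) = vsc (ev j) (b j)" if "j \<le> d" for j
    by (rule B.eqI_vc) (use that off in \<open>auto simp: B.vc_linear B.vc_v ev_def\<close>)
  have X_lin: "act X (sum g S) = (\<Sum>s\<in>S. act X (g s))" for g :: "nat \<Rightarrow> 'v" and S
    by (rule vs.linear_map_sum) (simp_all add: act_add_right act_vsc)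
  have bc_X: "bc i (act X x) = ev i * bc i x" if "i \<le> d" for i x
  proof -
    have "bc i (act X x) = bc i (act X (\<Sum>j\<le>d. vsc (bc j x) (b j)))"
      using B.expand[of x] by simp
    also have "\<dots> = bc i (\<Sum>j\<le>d. vsc (bc j x * ev j) (b j))"
      by (simp add: X_lin act_vsc X_b)
    also have "\<dots> = ev i * bc i x"
      using B.vc_combination[OF that, of "\<lambda>j. bc j x * ev j"] by simp
    finally show ?thesis .
  qed
  have eig: "eigenvalues_of vsc act X = ev ` {..d}"
  proof
    show "eigenvalues_of vsc act X \<subseteq> ev ` {..d}"
    proof
      fix t assume "t \<in> eigenvalues_of vsc act X"
      then obtain x where x: "x \<noteq> 0" "act X x = vsc t x"
        by (auto simp: eigenvalues_of_def)
      then obtain i where i: "i \<le> d" "bc i x \<noteq> 0"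
        using B.eqI_vc[of x 0] by (auto simp: B.vc_zero)
      then have "ev i * bc i x = t * bc i x"
        using bc_X[of i x] x(2) by (simp add: B.vc_scale)
      then show "t \<in> ev ` {..d}"
        using i by auto
    qed
    show "ev ` {..d} \<subseteq> eigenvalues_of vsc act X"
      using X_b B.v_nonzero by (auto simp: eigenvalues_of_def)
  qed
  have inj: "inj_on ev {..d}"
    using mult_free by (intro eq_card_imp_inj_on) (simp_all add: multiplicity_free_def eig)
  have \<eta>: "bij_betw \<eta> {..d} (ev ` {..d})" and F: "\<And>i. i \<le> d \<Longrightarrow> F i = primitive_idempotent d sc X \<eta> i"
    using ord by (auto simp: idempotent_ordering_def eig)
  define p where "p = inv_into {..d} ev \<circ> \<eta>"
  have p: "bij_betw p {..d} {..d}"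
    unfolding p_def using \<eta> inj
    by (intro bij_betw_trans[OF \<eta>] bij_betw_inv_into) (simp add: bij_betw_def)
  have p_le: "p i \<le> d" if "i \<le> d" for i
    using bij_betwE[OF p] that by auto
  have p_inj: "p i = p j \<longleftrightarrow> i = j" if "i \<le> d" "j \<le> d" for i j
    using p that by (auto simp: bij_betw_def inj_on_def)
  have ev_p: "ev (p i) = \<eta> i" if "i \<le> d" for i
  proof -
    have "\<eta> i \<in> ev ` {..d}"
      using bij_betwE[OF \<eta>] that by auto
    then show ?thesis
      by (simp add: p_def f_inv_into_f)
  qed
  define v where "v i = b (p i)" for i
  define vc where "vc i = bc (p i)" for i
  interpret V: coordinates vsc d v vc
  proof
    show "x = (\<Sum>i\<le>d. vsc (vc i x) (v i))" for x
      using B.expand[of x] sum.reindex_bij_betw[OF p, of "\<lambda>i. vsc (bc i x) (b i)"]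
      by (simp add: v_def vc_def)
  qed (auto simp: v_def vc_def p_le p_inj B.vc_linear B.vc_v)
  have X_v: "act X (v i) = vsc (\<eta> i) (v i)" if "i \<le> d" for i
    using that by (simp add: v_def X_b p_le ev_p)
  have vc_X: "vc i (act X x) = \<eta> i * vc i x" if "i \<le> d" for i x
    using that by (simp add: vc_def bc_X p_le ev_p)
  have \<eta>_inj: "\<eta> i = \<eta> j \<longleftrightarrow> i = j" if "i \<le> d" "j \<le> d" for i j
    using \<eta> that by (auto simp: bij_betw_def inj_on_def)
  have factors: "vc k (act (\<Prod>j\<leftarrow>js. sc (1 / (\<eta> i - \<eta> j)) (X - sc (\<eta> j) 1)) x)
      = (\<Prod>j\<leftarrow>js. (\<eta> k - \<eta> j) / (\<eta> i - \<eta> j)) * vc k x" if "k \<le> d" for i js k x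
    using that
    by (induction js arbitrary: x)
      (simp_all add: act_one act_mult act_scale act_diff V.vc_linear vc_X algebra_simps diff_divide_distrib)
  have "act (F i) x = vsc (vc i x) (v i)" if i: "i \<le> d" for i x
  proof (rule V.eqI_vc)
    fix k assume k: "k \<le> d"
    let ?js = "filter (\<lambda>j. j \<noteq> i) [0..<d + 1]"
    have "(\<Prod>j\<leftarrow>?js. (\<eta> k - \<eta> j) / (\<eta> i - \<eta> j)) = (if k = i then 1 else 0)"
    proof (cases "k = i")
      case True
      have "(\<Prod>j\<leftarrow>js. (\<eta> i - \<eta> j) / (\<eta> i - \<eta> j)) = 1" if "set js \<subseteq> {..d} - {i}" for js
        using that i \<eta>_inj by (induction js) auto
      moreover have "set ?js \<subseteq> {..d} - {i}" by auto
      ultimately show ?thesis using True by simp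
    next
      case False
      have "(\<eta> k - \<eta> k) / (\<eta> i - \<eta> k) \<in> set (map (\<lambda>j. (\<eta> k - \<eta> j) / (\<eta> i - \<eta> j)) ?js)"
        unfolding set_map by (rule imageI) (use False k in auto)
      then show ?thesis
        using False by (auto simp: prod_list_zero_iff simp del: upt_Suc set_map)
    qed
    then show "vc k (act (F i) x) = vc k (vsc (vc i x) (v i))"
      using i k by (auto simp: F primitive_idempotent_def factors V.vc_linear V.vc_v simp del: upt_Suc)
  qed
  with X_v V.coordinates_axioms show thesis by (intro that)
qed

lemma inner_automorphism:
  assumes coords: "coordinates vsc d v vc" "\<And>i x. i \<le> d \<Longrightarrow> act (F i) x = vsc (vc i x) (v i)"
    and "bij P" and add: "\<And>x y. P (x + y) = P x + P y" and scale: "\<And>c x. P (vsc c x) = vsc c (P x)"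
  obtains f where "algebra_iso sc sc f" "\<And>X x. act (f X) (P x) = P (act X x)"
proof -
  define Q where "Q = inv_into UNIV P"
  have PQ: "P (Q x) = x" and QP: "Q (P x) = x" for x
    using \<open>bij P\<close> by (simp_all add: Q_def bij_is_surj f_inv_into_f bij_is_inj)
  have Q_add: "Q (x + y) = Q x + Q y" for x y
    by (metis PQ QP add)
  have Q_scale: "Q (vsc c x) = vsc c (Q x)" for c x
    by (metis PQ QP scale)
  have "\<exists>Y. \<forall>x. act Y x = P (act X (Q x))" for X
    by (rule operator_represented[OF coords])
      (simp_all add: add scale Q_add Q_scale act_add_right act_vsc)
  then obtain f where f: "\<And>X x. act (f X) x = P (act X (Q x))"
    by metis
  have "\<exists>X. \<forall>x. act X x = Q (act Y (P x))" for Y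
    by (rule operator_represented[OF coords])
      (simp_all add: add scale Q_add Q_scale act_add_right act_vsc)
  then obtain g where g: "\<And>Y x. act (g Y) x = Q (act Y (P x))"
    by metis
  have "g (f X) = X" "f (g X) = X" for X
    by (rule faithful; simp add: f g PQ QP)+
  then have "bij f"
    by (metis bijI')
  moreover have "f 1 = 1" "f (X + Y) = f X + f Y" "f (X * Y) = f X * f Y" "f (sc c X) = sc c (f X)"
    for X Y c
    by (rule faithful; simp add: f act_one act_add_left act_mult act_scale add scale PQ QP)+
  ultimately have "algebra_iso sc sc f"
    by (simp add: algebra_iso_def)
  then show thesis
    by (rule that) (simp add: f QP)
qed

text \<open>
  The idempotent \<open>f (F i)\<close> absorbs \<open>f X = \<xi> Y + \<zeta>\<close> from the right up to the scalar \<open>\<alpha> i\<close>, whereas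
  \<open>E k\<close> absorbs it from the left up to \<open>\<xi> \<theta> k + \<zeta>\<close>. Hence \<open>f (F i) * E k\<close> vanishes unless the two scalars
  agree, which happens for exactly one \<open>k\<close>; since both families sum to \<open>1\<close>, the two idempotents
  coincide for this \<open>k\<close>.
\<close>

lemma iso_permutes_idempotents:
  assumes v: "coordinates vsc d v vc" and w: "coordinates vsc d w wc"
    and F: "\<And>i x. i \<le> d \<Longrightarrow> act (F i) x = vsc (vc i x) (v i)"
    and E: "\<And>i x. i \<le> d \<Longrightarrow> act (E i) x = vsc (wc i x) (w i)"
    and X: "\<And>i x. i \<le> d \<Longrightarrow> vc i (act X x) = \<alpha> i * vc i x"
    and Y: "\<And>i. i \<le> d \<Longrightarrow> act Y (w i) = vsc (\<theta> i) (w i)"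
    and inj: "inj_on \<alpha> {..d}" "inj_on \<theta> {..d}"
    and f: "algebra_iso sc sc f" "f X = sc \<xi> Y + sc \<zeta> 1"
    and "\<xi> \<noteq> 0"
  obtains \<sigma> where "bij_betw \<sigma> {..d} {..d}" "\<And>i. i \<le> d \<Longrightarrow> f (F i) = E (\<sigma> i)"
    "\<And>i. i \<le> d \<Longrightarrow> \<alpha> i = \<xi> * \<theta> (\<sigma> i) + \<zeta>"
proof -
  interpret V: coordinates vsc d v vc by fact
  interpret W: coordinates vsc d w wc by fact
  note f_simps = algebra_iso_simps[OF f(1)]
  define G where "G i = f (F i)" for i
  have f_sum: "f (sum g S) = (\<Sum>s\<in>S. f (g s))" for g :: "nat \<Rightarrow> 'a" and S
    by (induction S rule: infinite_finite_induct) (auto simp: f_simps)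
  have sum_F: "(\<Sum>i\<le>d. F i) = 1"
    by (rule faithful) (simp add: act_sum F act_one V.expand[symmetric])
  have sum_E: "(\<Sum>i\<le>d. E i) = 1"
    by (rule faithful) (simp add: act_sum E act_one W.expand[symmetric])
  have sum_G: "(\<Sum>i\<le>d. G i) = 1"
    using arg_cong[OF sum_F, of f] by (simp add: G_def f_sum f_simps)
  have G_nonzero: "G i \<noteq> 0" if "i \<le> d" for i
  proof
    assume "G i = 0"
    then have "F i = 0"
      using injD[OF f_simps(5), of "F i" 0] by (simp add: G_def f_simps)
    then have "vsc 1 (v i) = 0"
      using F[OF that, of "v i"] that by (simp add: V.vc_v)
    then show False
      using V.v_nonzero[OF that] by simp
  qed
  have "F i * X = sc (\<alpha> i) (F i)" if "i \<le> d" for i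
    by (rule faithful) (simp add: act_mult act_scale F X that)
  then have GX: "G i * f X = sc (\<alpha> i) (G i)" if "i \<le> d" for i
    using that by (simp add: G_def f_simps(2,3)[symmetric])
  have XE: "f X * E k = sc (\<xi> * \<theta> k + \<zeta>) (E k)" if "k \<le> d" for k
    by (rule faithful)
      (simp add: f(2) act_mult act_add_left act_scale act_one E act_vsc Y that vs.scale_left_distrib
        vs.scale_right_distrib distrib_left mult_ac)
  have match: "\<alpha> i = \<xi> * \<theta> k + \<zeta>" if "i \<le> d" "k \<le> d" "G i * E k \<noteq> 0" for i k
  proof -
    have "sc (\<alpha> i) (G i * E k) = G i * f X * E k"
      by (simp add: GX that alg.scale_mult_left)
    also have "\<dots> = sc (\<xi> * \<theta> k + \<zeta>) (G i * E k)"
      by (simp add: mult.assoc XE that alg.scale_mult_right)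
    finally show ?thesis
      using that(3) by simp
  qed
  have "\<exists>k\<le>d. G i * E k \<noteq> 0" if "i \<le> d" for i
  proof (rule ccontr)
    assume "\<not> ?thesis"
    then have "G i * (\<Sum>k\<le>d. E k) = 0"
      by (simp add: sum_distrib_left)
    then show False
      using G_nonzero[OF that] by (simp add: sum_E)
  qed
  then obtain \<sigma> where \<sigma>: "\<And>i. i \<le> d \<Longrightarrow> \<sigma> i \<le> d \<and> G i * E (\<sigma> i) \<noteq> 0"
    by metis
  have \<alpha>_\<sigma>: "\<alpha> i = \<xi> * \<theta> (\<sigma> i) + \<zeta>" if "i \<le> d" for i
    using match[of i "\<sigma> i"] \<sigma>[OF that] that by blast
  have zero: "G i * E k = 0" if "i \<le> d" "k \<le> d" "k \<noteq> \<sigma> i" for i k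
  proof (rule ccontr)
    assume "G i * E k \<noteq> 0"
    then have "\<xi> * \<theta> k + \<zeta> = \<xi> * \<theta> (\<sigma> i) + \<zeta>"
      using match[of i k] \<alpha>_\<sigma>[of i] that by metis
    then show False
      using inj(2) \<sigma>[of i] that \<open>\<xi> \<noteq> 0\<close> by (auto simp: inj_on_def)
  qed
  have \<sigma>_inj: "inj_on \<sigma> {..d}"
  proof (rule inj_onI)
    fix i j assume ij: "i \<in> {..d}" "j \<in> {..d}" and eq: "\<sigma> i = \<sigma> j"
    have "\<alpha> i = \<alpha> j"
      using \<alpha>_\<sigma>[of i] \<alpha>_\<sigma>[of j] ij eq by simp
    then show "i = j"
      using inj(1) ij by (auto simp: inj_on_def)
  qed
  then have bij: "bij_betw \<sigma> {..d} {..d}"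
    unfolding bij_betw_def using endo_inj_surj[OF finite_atMost _ \<sigma>_inj] \<sigma> by auto
  have "G i = E (\<sigma> i)" if i: "i \<le> d" for i
  proof -
    have "G i = G i * (\<Sum>k\<le>d. E k)"
      by (simp add: sum_E)
    also have "\<dots> = (\<Sum>k\<in>{\<sigma> i}. G i * E k)"
      unfolding sum_distrib_left
      by (rule sum.mono_neutral_right) (use i \<sigma> zero in auto)
    also have "\<dots> = (\<Sum>j\<le>d. G j * E (\<sigma> i))"
    proof (simp, rule sum.mono_neutral_left[of "{..d}" "{i}", simplified])
      have "\<sigma> i \<noteq> \<sigma> j" if "j \<le> d" "j \<noteq> i" for j
        using \<sigma>_inj i that by (auto simp: inj_on_def)
      then show "\<forall>j\<in>{..d} - {i}. G j * E (\<sigma> i) = 0"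
        using \<sigma> i zero by auto
    qed (use i in auto)
    also have "\<dots> = E (\<sigma> i)"
      by (simp add: sum_distrib_right[symmetric] sum_G)
    finally show ?thesis .
  qed
  then show thesis
    by (intro that[OF bij _ \<alpha>_\<sigma>]) (simp_all add: G_def[symmetric])
qed

text \<open>
  Apply \<open>f\<close> to the products \<open>F i * X * F j\<close>. They are nonzero for adjacent indices, so the
  permutation preserves adjacency; for \<open>i = j\<close> they carry the diagonal entries.
\<close>

lemma iso_permutes_path:
  assumes v: "coordinates vsc d v vc" and w: "coordinates vsc d w wc"
    and F: "\<And>i x. i \<le> d \<Longrightarrow> act (F i) x = vsc (vc i x) (v i)"
    and E: "\<And>i x. i \<le> d \<Longrightarrow> act (E i) x = vsc (wc i x) (w i)"
    and near: "\<And>i j. i \<le> d \<Longrightarrow> j \<le> d \<Longrightarrow> \<bar>int i - int j\<bar> = 1 \<Longrightarrow> vc i (act X (v j)) \<noteq> 0"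
    and far: "\<And>i j. i \<le> d \<Longrightarrow> j \<le> d \<Longrightarrow> \<bar>int i - int j\<bar> > 1 \<Longrightarrow> wc i (act Y (w j)) = 0"
    and f: "algebra_iso sc sc f" "f X = sc \<xi> Y + sc \<zeta> 1"
    and \<sigma>: "bij_betw \<sigma> {..d} {..d}" "\<And>i. i \<le> d \<Longrightarrow> f (F i) = E (\<sigma> i)"
  shows "(\<forall>i\<le>d. \<sigma> i = i) \<or> (\<forall>i\<le>d. \<sigma> i = d - i)"
    and "i \<le> d \<Longrightarrow> vc i (act X (v i)) = \<xi> * wc (\<sigma> i) (act Y (w (\<sigma> i))) + \<zeta>"
proof -
  interpret V: coordinates vsc d v vc by fact
  interpret W: coordinates vsc d w wc by fact
  note f_simps = algebra_iso_simps[OF f(1)]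
  have \<sigma>_le: "\<sigma> i \<le> d" if "i \<le> d" for i
    using bij_betwE[OF \<sigma>(1)] that by auto
  have image: "act (f (F i * X * F j)) x
      = vsc (wc (\<sigma> j) x * (\<xi> * wc (\<sigma> i) (act Y (w (\<sigma> j))) + (if \<sigma> i = \<sigma> j then \<zeta> else 0))) (w (\<sigma> i))"
    if "i \<le> d" "j \<le> d" for i j x
    using that \<sigma>_le
    by (simp add: f_simps f(2) \<sigma>(2) act_mult E act_vsc act_add_left act_scale act_one W.vc_linear W.vc_v)
  show "vc i (act X (v i)) = \<xi> * wc (\<sigma> i) (act Y (w (\<sigma> i))) + \<zeta>" if i: "i \<le> d" for i
  proof -
    have "F i * X * F i = sc (vc i (act X (v i))) (F i)"
      by (rule faithful) (simp add: act_mult act_scale F i act_vsc V.vc_linear mult.commute)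
    then have "f (F i * X * F i) = sc (vc i (act X (v i))) (E (\<sigma> i))"
      using i by (simp add: f_simps \<sigma>(2))
    then have "wc (\<sigma> i) (act (f (F i * X * F i)) (w (\<sigma> i))) = vc i (act X (v i))"
      using \<sigma>_le[OF i] by (simp add: act_scale E W.vc_linear W.vc_v)
    then show ?thesis
      using \<sigma>_le[OF i] by (simp add: image i W.vc_linear W.vc_v)
  qed
  show "(\<forall>i\<le>d. \<sigma> i = i) \<or> (\<forall>i\<le>d. \<sigma> i = d - i)"
  proof (rule path_permutation[OF \<sigma>(1)])
    fix i assume "i < d"
    then have i: "Suc i \<le> d" "i \<le> d" by auto
    have ne: "\<sigma> (Suc i) \<noteq> \<sigma> i"
      using inj_onD[OF bij_betw_imp_inj_on[OF \<sigma>(1)], of "Suc i" i] i by auto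
    have "F (Suc i) * X * F i \<noteq> 0"
    proof
      assume "F (Suc i) * X * F i = 0"
      then have "vc (Suc i) (act (F (Suc i) * X * F i) (v i)) = 0"
        using i by (simp add: V.vc_zero)
      then show False
        using near[of "Suc i" i] i by (simp add: act_mult F act_vsc V.vc_linear V.vc_v)
    qed
    then have "f (F (Suc i) * X * F i) \<noteq> 0"
      using injD[OF f_simps(5), of _ 0] f_simps(6) by metis
    then have "wc (\<sigma> (Suc i)) (act Y (w (\<sigma> i))) \<noteq> 0"
      using faithful_zero[of "f (F (Suc i) * X * F i)"] ne by (auto simp: image[OF i])
    then have "\<not> \<bar>int (\<sigma> (Suc i)) - int (\<sigma> i)\<bar> > 1"
      using far \<sigma>_le i by blast
    then show "\<bar>int (\<sigma> (Suc i)) - int (\<sigma> i)\<bar> = 1"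
      using ne by linarith
  qed
qed

end

lemma (in leonard_setting) system_bases:
  assumes pair: "leonard_pair d vsc act A As"
    and system: "leonard_system d sc vsc act A E As Es"
    and ordA: "idempotent_ordering d sc vsc act A E \<theta>"
    and ordAs: "idempotent_ordering d sc vsc act As Es \<theta>s"
  obtains v vc w wc where "leonard_bases vsc d v vc (act A) (act As) \<theta>s w wc \<theta>"
    "\<And>i x. i \<le> d \<Longrightarrow> act (E i) x = vsc (wc i x) (w i)"
    "\<And>i x. i \<le> d \<Longrightarrow> act (Es i) x = vsc (vc i x) (v i)"
proof -
  obtain b where "is_basis d vsc b" "diagonal_mat (rep_mat d vsc act b As)"
    using pair by (auto simp: leonard_pair_def)
  then obtain v vc where v: "coordinates vsc d v vc"
    and As_v: "\<And>i. i \<le> d \<Longrightarrow> act As (v i) = vsc (\<theta>s i) (v i)"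
    and Es: "\<And>i x. i \<le> d \<Longrightarrow> act (Es i) x = vsc (vc i x) (v i)"
    using eigenbasis[of b As Es \<theta>s] system ordAs by (auto simp: leonard_system_def)
  obtain b' where "is_basis d vsc b'" "diagonal_mat (rep_mat d vsc act b' A)"
    using pair by (auto simp: leonard_pair_def)
  then obtain w wc where w: "coordinates vsc d w wc"
    and A_w: "\<And>i. i \<le> d \<Longrightarrow> act A (w i) = vsc (\<theta> i) (w i)"
    and E: "\<And>i x. i \<le> d \<Longrightarrow> act (E i) x = vsc (wc i x) (w i)"
    using eigenbasis[of b' A E \<theta>] system ordA by (auto simp: leonard_system_def)
  interpret V: coordinates vsc d v vc by fact
  interpret W: coordinates vsc d w wc by fact
  have inj: "inj_on \<theta>s {..d}" "inj_on \<theta> {..d}"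
    using ordA ordAs by (auto simp: idempotent_ordering_def bij_betw_def)
  have Es_A_Es: "act (Es i * A * Es j) x = vsc (vc j x * vc i (act A (v j))) (v i)"
    and E_As_E: "act (E i * As * E j) x = vsc (wc j x * wc i (act As (w j))) (w i)"
    if "i \<le> d" "j \<le> d" for i j x
    using that by (simp_all add: act_mult E Es act_vsc V.vc_linear W.vc_linear)
  have "leonard_bases vsc d v vc (act A) (act As) \<theta>s w wc \<theta>"
  proof
    fix i j assume ij: "i \<le> d" "j \<le> d"
    show "vc i (act A (v j)) = 0" "wc i (act As (w j)) = 0" if "1 < \<bar>int i - int j\<bar>"
    proof -
      have "Es i * A * Es j = 0" "E i * As * E j = 0"
        using system ij that by (auto simp: leonard_system_def)
      then show "vc i (act A (v j)) = 0" "wc i (act As (w j)) = 0"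
        using Es_A_Es[OF ij, of "v j"] E_As_E[OF ij, of "w j"] ij V.v_nonzero W.v_nonzero
        by (auto simp: V.vc_v W.vc_v)
    qed
    show "vc i (act A (v j)) \<noteq> 0" "wc i (act As (w j)) \<noteq> 0" if "\<bar>int i - int j\<bar> = 1"
    proof -
      have "Es i * A * Es j \<noteq> 0" "E i * As * E j \<noteq> 0"
        using system ij that by (auto simp: leonard_system_def)
      then show "vc i (act A (v j)) \<noteq> 0" "wc i (act As (w j)) \<noteq> 0"
        using faithful_zero[of "Es i * A * Es j"] faithful_zero[of "E i * As * E j"]
        by (auto simp: Es_A_Es[OF ij] E_As_E[OF ij])
    qed
  qed (use As_v A_w inj in \<open>simp_all add: act_add_right act_vsc\<close>)
  then show thesis
    using E Es by (rule that)
qed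

section \<open>Isomorphisms between the exchanged pair and an affine image\<close>

theorem proposition11p3:
  fixes d :: nat
    and sc :: "'k::field \<Rightarrow> 'a::ring_1 \<Rightarrow> 'a"
    and vsc :: "'k \<Rightarrow> 'v::ab_group_add \<Rightarrow> 'v"
    and act :: "'a \<Rightarrow> 'v \<Rightarrow> 'v"
    and A As :: 'a
    and E Es :: "nat \<Rightarrow> 'a"
    and \<theta> \<theta>s vphi phi :: "nat \<Rightarrow> 'k"
    and \<xi> \<zeta> \<xi>s \<zeta>s :: 'k
  assumes "leonard_setting d sc vsc act"
    and "leonard_pair d vsc act A As"
    and "leonard_system d sc vsc act A E As Es"
    and "parameter_array d sc vsc act A E As Es \<theta> \<theta>s vphi phi"
    and "d \<ge> 1"
    and "\<xi> \<noteq> 0" and "\<xi>s \<noteq> 0"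
  shows
    "let isom = leonard_pairs_isomorphic sc sc
           (As, A) (sc \<xi> A + sc \<zeta> 1, sc \<xi>s As + sc \<zeta>s 1);
         c1 = (phi 1 = phi d \<and>
               \<xi> = (\<theta>s d - \<theta>s 0) * inverse (\<theta> d - \<theta> 0) \<and> \<zeta> = \<theta>s 0 - \<xi> * \<theta> 0 \<and>
               \<xi>s = inverse \<xi> \<and> \<zeta>s = \<theta> 0 - \<xi>s * \<theta>s 0);
         c2 = (vphi 1 = vphi d \<and> vphi d = - phi 1 \<and> - phi 1 = - phi d \<and>
               \<xi> = (\<theta>s 0 - \<theta>s d) * inverse (\<theta> d - \<theta> 0) \<and> \<zeta> = \<theta>s d - \<xi> * \<theta> 0 \<and>
               \<xi>s = - inverse \<xi> \<and> \<zeta>s = \<theta> 0 - \<xi>s * \<theta>s 0);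
         c3 = (vphi 1 = vphi d \<and> vphi d = - phi 1 \<and> - phi 1 = - phi d \<and>
               \<xi> = (\<theta>s d - \<theta>s 0) * inverse (\<theta> d - \<theta> 0) \<and> \<zeta> = \<theta>s 0 - \<xi> * \<theta> 0 \<and>
               \<xi>s = - inverse \<xi> \<and> \<zeta>s = \<theta> 0 - \<xi>s * \<theta>s d);
         c4 = (vphi 1 = vphi d \<and>
               \<xi> = (\<theta>s 0 - \<theta>s d) * inverse (\<theta> d - \<theta> 0) \<and> \<zeta> = \<theta>s d - \<xi> * \<theta> 0 \<and>
               \<xi>s = inverse \<xi> \<and> \<zeta>s = \<theta> 0 - \<xi>s * \<theta>s d)
     in (isom \<longleftrightarrow> c1 \<or> c2 \<or> c3 \<or> c4) \<and>
        (isom \<longrightarrow> (\<exists>!k. k < 4 \<and> [c1, c2, c3, c4] ! k))"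
proof -
  interpret leonard_setting d sc vsc act by fact
  have ord: "idempotent_ordering d sc vsc act A E \<theta>" "idempotent_ordering d sc vsc act As Es \<theta>s"
    using assms(4) by (auto simp: parameter_array_def)
  obtain v vc w wc where bases: "leonard_bases vsc d v vc (act A) (act As) \<theta>s w wc \<theta>"
    and E: "\<And>i x. i \<le> d \<Longrightarrow> act (E i) x = vsc (wc i x) (w i)"
    and Es: "\<And>i x. i \<le> d \<Longrightarrow> act (Es i) x = vsc (vc i x) (v i)"
    using system_bases[OF assms(2,3) ord] by blast
  interpret L: leonard_bases vsc d v vc "act A" "act As" \<theta>s w wc \<theta> by fact
  interpret R: leonard_bases vsc d v vc "act A" "act As" \<theta>s
    "\<lambda>i. w (d - i)" "\<lambda>i. wc (d - i)" "\<lambda>i. \<theta> (d - i)"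
    by (rule L.reversed)
  obtain b where b: "is_basis d vsc b"
    using assms(2) by (auto simp: leonard_pair_def)
  have shifted: "act (shifted_prod sc A \<eta> n) x = L.vside.chain \<eta> n x" for \<eta> n x
  proof (rule L.wside.eqI_vc)
    fix j assume j: "j \<le> d"
    have "wc j (act (\<Prod>h\<leftarrow>hs. A - sc (\<eta> h) 1) x) = (\<Prod>h\<leftarrow>hs. \<theta> j - \<eta> h) * wc j x" for hs x
      using j by (induction hs arbitrary: x)
        (simp_all add: act_one act_mult act_diff act_scale L.wside.vc_linear L.wside.vc_As algebra_simps)
    then have "wc j (act (shifted_prod sc A \<eta> n) x) = (\<Prod>h\<leftarrow>[0..<n]. \<theta> j - \<eta> h) * wc j x"
      by (simp add: shifted_prod_def)
    also have "(\<Prod>h\<leftarrow>[0..<n]. \<theta> j - \<eta> h) = (\<Prod>h<n. \<theta> j - \<eta> h)"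
      by (induction n) simp_all
    finally show "wc j (act (shifted_prod sc A \<eta> n) x) = wc j (L.vside.chain \<eta> n x)"
      using j by (simp add: L.wc_chain)
  qed
  have trace: "alg_trace d vsc act (Es 0 * shifted_prod sc A \<eta> n) = vc 0 (L.vside.chain \<eta> n (v 0))"
    for \<eta> n
  proof -
    have "alg_trace d vsc act (Es 0 * shifted_prod sc A \<eta> n)
        = (\<Sum>i\<le>d. vc i (vsc (vc 0 (L.vside.chain \<eta> n (v i))) (v 0)))"
      by (subst alg_trace_coordinates[OF L.vside.coordinates_axioms b])
        (simp add: act_mult Es shifted)
    also have "\<dots> = (\<Sum>i\<in>{0}. vc i (vsc (vc 0 (L.vside.chain \<eta> n (v i))) (v 0)))"
      by (rule sum.mono_neutral_right) (auto simp: L.vside.vc_linear L.vside.vc_v)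
    finally show ?thesis
      by (simp add: L.vside.vc_linear L.vside.vc_v)
  qed
  have vphi: "vphi i = L.split_coeff i" if "i \<in> {1..d}" for i
    using assms(4) that L.split_coeff_quotient[OF that]
    by (simp add: parameter_array_def trace L.split_def)
  have phi: "phi i = L.rev_split_coeff i" if "i \<in> {1..d}" for i
  proof -
    have "phi i = R.split_coeff i"
      using assms(4) that R.split_coeff_quotient[OF that]
      by (simp add: parameter_array_def trace R.split_def)
    then show ?thesis
      by (simp add: R.split_coeff_def L.rev_split_coeff_def)
  qed
  define B where "B = sc \<xi> A + sc \<zeta> 1"
  define Bs where "Bs = sc \<xi>s As + sc \<zeta>s 1"
  have act_B: "act B x = vsc \<xi> (act A x) + vsc \<zeta> x" and act_Bs: "act Bs x = vsc \<xi>s (act As x) + vsc \<zeta>s x" for x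
    by (simp_all add: B_def Bs_def act_add_left act_scale act_one)
  define c1 where "c1 \<longleftrightarrow> phi 1 = phi d \<and>
      \<xi> = (\<theta>s d - \<theta>s 0) * inverse (\<theta> d - \<theta> 0) \<and> \<zeta> = \<theta>s 0 - \<xi> * \<theta> 0 \<and>
      \<xi>s = inverse \<xi> \<and> \<zeta>s = \<theta> 0 - \<xi>s * \<theta>s 0"
  define c2 where "c2 \<longleftrightarrow> vphi 1 = vphi d \<and> vphi d = - phi 1 \<and> - phi 1 = - phi d \<and>
      \<xi> = (\<theta>s 0 - \<theta>s d) * inverse (\<theta> d - \<theta> 0) \<and> \<zeta> = \<theta>s d - \<xi> * \<theta> 0 \<and>
      \<xi>s = - inverse \<xi> \<and> \<zeta>s = \<theta> 0 - \<xi>s * \<theta>s 0"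
  define c3 where "c3 \<longleftrightarrow> vphi 1 = vphi d \<and> vphi d = - phi 1 \<and> - phi 1 = - phi d \<and>
      \<xi> = (\<theta>s d - \<theta>s 0) * inverse (\<theta> d - \<theta> 0) \<and> \<zeta> = \<theta>s 0 - \<xi> * \<theta> 0 \<and>
      \<xi>s = - inverse \<xi> \<and> \<zeta>s = \<theta> 0 - \<xi>s * \<theta>s d"
  define c4 where "c4 \<longleftrightarrow> vphi 1 = vphi d \<and>
      \<xi> = (\<theta>s 0 - \<theta>s d) * inverse (\<theta> d - \<theta> 0) \<and> \<zeta> = \<theta>s d - \<xi> * \<theta> 0 \<and>
      \<xi>s = inverse \<xi> \<and> \<zeta>s = \<theta> 0 - \<xi>s * \<theta>s d"
  define isom where "isom \<longleftrightarrow> leonard_pairs_isomorphic sc sc (As, A) (B, Bs)"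
  have ends: "vphi 1 = L.split_coeff 1" "vphi d = L.split_coeff d"
      "phi 1 = L.rev_split_coeff 1" "phi d = L.rev_split_coeff d"
    using assms(5) vphi phi by auto
  have "isom" if "c1 \<or> c2 \<or> c3 \<or> c4"
  proof -
    have "\<exists>P. L.affine_swap \<xi> \<zeta> \<xi>s \<zeta>s P"
      by (rule L.duality_map_exists[OF assms(5)], unfold L.keep_case_def L.rev_E_case_def
          L.rev_Es_case_def L.rev_both_case_def)
        (fact that[unfolded c1_def c2_def c3_def c4_def ends])
    then obtain P where "L.affine_swap \<xi> \<zeta> \<xi>s \<zeta>s P"
      by blast
    then have P: "bij P" "\<And>x y. P (x + y) = P x + P y" "\<And>c x. P (vsc c x) = vsc c (P x)"
      and PAs: "\<And>x. P (act As x) = act B (P x)" and PA: "\<And>x. P (act A x) = act Bs (P x)"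
      by (simp_all add: L.affine_swap_def act_B act_Bs)
    obtain f where f: "algebra_iso sc sc f" "\<And>X x. act (f X) (P x) = P (act X x)"
      using inner_automorphism[OF L.vside.coordinates_axioms Es P] by blast
    have surj: "\<exists>y. x = P y" for x
      using P(1) by (metis bij_pointE)
    have "f As = B"
    proof (rule faithful)
      fix x obtain y where "x = P y" using surj by blast
      then show "act (f As) x = act B x" by (simp add: f PAs)
    qed
    moreover have "f A = Bs"
    proof (rule faithful)
      fix x obtain y where "x = P y" using surj by blast
      then show "act (f A) x = act Bs x" by (simp add: f PA)
    qed
    ultimately show ?thesis
      using f(1) by (auto simp: isom_def leonard_pairs_isomorphic_def)
  qed
  moreover have "c1 \<or> c2 \<or> c3 \<or> c4" if isom
  proof -
    obtain f where f: "algebra_iso sc sc f" and fAs: "f As = B" and fA: "f A = Bs"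
      using \<open>isom\<close> by (auto simp: isom_def leonard_pairs_isomorphic_def)
    note f_simps = algebra_iso_simps[OF f]
    obtain \<sigma> where \<sigma>: "bij_betw \<sigma> {..d} {..d}" and fEs: "\<And>i. i \<le> d \<Longrightarrow> f (Es i) = E (\<sigma> i)"
      and \<theta>s: "\<And>i. i \<le> d \<Longrightarrow> \<theta>s i = \<xi> * \<theta> (\<sigma> i) + \<zeta>"
      using iso_permutes_idempotents[OF L.vside.coordinates_axioms L.wside.coordinates_axioms Es E
          L.vside.vc_As L.wside.As_v L.vside.inj_\<theta>s L.wside.inj_\<theta>s f fAs[unfolded B_def] assms(6)]
      by blast
    obtain \<tau> where \<tau>: "bij_betw \<tau> {..d} {..d}" and fE: "\<And>i. i \<le> d \<Longrightarrow> f (E i) = Es (\<tau> i)"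
      and \<theta>: "\<And>i. i \<le> d \<Longrightarrow> \<theta> i = \<xi>s * \<theta>s (\<tau> i) + \<zeta>s"
      using iso_permutes_idempotents[OF L.wside.coordinates_axioms L.vside.coordinates_axioms E Es
          L.wside.vc_As L.vside.As_v L.wside.inj_\<theta>s L.vside.inj_\<theta>s f fA[unfolded Bs_def] assms(7)]
      by blast
    note path_\<sigma> = iso_permutes_path[OF L.vside.coordinates_axioms L.wside.coordinates_axioms Es E
        L.vside.A_near L.wside.A_far f fA[unfolded Bs_def] \<sigma> fEs]
    note path_\<tau> = iso_permutes_path[OF L.wside.coordinates_axioms L.vside.coordinates_axioms E Es
        L.wside.A_near L.vside.A_far f fAs[unfolded B_def] \<tau> fE]
    show ?thesis
      unfolding c1_def c2_def c3_def c4_def ends L.keep_case_def[symmetric] L.rev_E_case_def[symmetric]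
        L.rev_Es_case_def[symmetric] L.rev_both_case_def[symmetric]
      by (rule L.affine_swap_conditions[OF assms(5) path_\<sigma>(1) path_\<tau>(1) \<theta>s \<theta>])
        (simp_all add: L.vside.a_def L.wside.a_def path_\<sigma>(2) path_\<tau>(2))
  qed
  moreover have "\<exists>!k. k < 4 \<and> [c1, c2, c3, c4] ! k" if "c1 \<or> c2 \<or> c3 \<or> c4"
  proof -
    have ne: "\<theta>s 0 \<noteq> \<theta>s d"
      using L.vside.\<theta>s_distinct[of 0 d] assms(5) by auto
    \<comment> \<open>In characteristic \<open>2\<close> the values of \<open>\<xi>\<close> and \<open>\<xi>s\<close> do not separate the cases; those of
        \<open>\<zeta>\<close> and \<open>\<zeta>s\<close> always do.\<close>
    have order_A: "\<not> (\<zeta> = \<theta>s 0 - \<xi> * \<theta> 0 \<and> \<zeta> = \<theta>s d - \<xi> * \<theta> 0)"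
      and order_As: "\<not> (\<zeta>s = \<theta> 0 - \<xi>s * \<theta>s 0 \<and> \<zeta>s = \<theta> 0 - \<xi>s * \<theta>s d)"
      using ne assms(7) by auto
    have excl: "\<not> (c1 \<and> c2)" "\<not> (c1 \<and> c3)" "\<not> (c1 \<and> c4)" "\<not> (c2 \<and> c3)" "\<not> (c2 \<and> c4)" "\<not> (c3 \<and> c4)"
      using order_A order_As unfolding c1_def c2_def c3_def c4_def by blast+
    have nth: "k < 4 \<and> [c1, c2, c3, c4] ! k \<longleftrightarrow> k = 0 \<and> c1 \<or> k = 1 \<and> c2 \<or> k = 2 \<and> c3 \<or> k = 3 \<and> c4" for k :: nat
      by (auto simp: less_Suc_eq eval_nat_numeral)
    show ?thesis
      unfolding nth using that excl by auto
  qed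
  ultimately have "(isom \<longleftrightarrow> c1 \<or> c2 \<or> c3 \<or> c4) \<and> (isom \<longrightarrow> (\<exists>!k. k < 4 \<and> [c1, c2, c3, c4] ! k))"
    by blast
  then show ?thesis
    unfolding isom_def B_def Bs_def c1_def c2_def c3_def c4_def Let_def .
qed

end
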